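(* Let $G$ be a Wheeler graph with $n$ vertices and a fixed Wheeler order $\pi$, let $r$ be the number of runs in the Burrows-Wheeler Transform $B$ of $G$ according to $\pi$, let $D$ be a decomposition of $G$ into $\upsilon$ edge-disjoint directed paths whose internal vertices each have in-degree exactly 1 and out-degree exactly 1, and let the vertices of $G$ be assigned identifiers compatible with $D$. Then $G$ can be stored in a data structure using $O(r + \upsilon)$ words of space such that later, given any pattern $P$ (a finite string over the alphabet of edge labels), one can count in $O(|P| \log \log n)$ time the vertices of $G$ reachable by directed paths labelled $P$, and then report (the identifiers of) those vertices in $O(\log \log n)$ time per reported vertex.
   Context: Wheeler graph: a (finite) directed multigraph whose edges are labelled with characters from a totally ordered alphabet and whose vertices can be totally ordered so that the vertices of in-degree 0 precede those of positive in-degree and, for any pair of edges $e = (u,v)$ and $e' = (u',v')$ labelled $a$ and $a'$ respectively: (i) if $a \prec a'$ then $v < v'$; (ii) if $a = a'$ and $u < u'$ then $v \le v'$. Any such order on the vertices is called a Wheeler order. A Wheeler graph may have many Wheeler orders; one, denoted $\pi$, is fixed. Burrows-Wheeler Transform (BWT): the BWT $B$ of $G$ according to $\pi$ is the listing of all the edge labels of $G$ (one entry per edge) such that, for edges $(u,v)$ and $(u',v')$ labelled $a$ and $a'$, if $u < u'$ in $\pi$ then $a$ precedes $a'$ in the listing; the labels of the out-edges of a single vertex are listed in the order in $\pi$ of their destinations. A run in $B$ is a maximal non-empty substring consisting of copies of one character; $r$ is the number of runs in $B$. Decomposition: $D$ is a set of $\upsilon$ edge-disjoint directed paths that together make up $G$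 (every edge lies on exactly one of the paths, every vertex lies on at least one, and a path consisting of a single vertex is allowed for an isolated vertex), such that each internal vertex of each path has in-degree and out-degree exactly 1 in $G$. The first and last vertices of a path are its endpoints (they may coincide). Identifiers: the vertices have distinct numeric identifiers from $\{0, \ldots, n-1\}$. They are compatible with $D$ if, whenever $(u,v)$ is an edge, neither $u$ nor $v$ is an endpoint of a path in $D$, and $u$ has identifier $i$, then $v$ has identifier $i+1$. The identifiers need not be the ranks of the vertices in $\pi$. A vertex is reachable by a directed path labelled $P$ if it is the last vertex of a directed walk whose sequence of edge labels spells $P$ (every vertex is reachable by a path labelled with the empty string); whether labels are read forwards or backwards along the walk is immaterial, as this only replaces $P$ by its reverse. Computational model and conventions: word RAM with words of $\Theta(\log n)$ bits; space is measured in words; a character fits in one word; the number of edges of $G$ is assumed to be polynomial in $n$; the data structure is static and the construction time is not restricted. Asymptotic time bounds are understood up to an additive $O(1)$. The identifiers are part of the given data. *)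

theory Defs
  imports Complex_Main "Graph_Theory.Arc_Walk"
begin

section \<open>Wheeler graphs\<close>

definition wheeler_order ::
  "('v, 'e) pre_digraph \<Rightarrow> ('e \<Rightarrow> 'a :: linorder) \<Rightarrow> 'v rel \<Rightarrow> bool" where
  "wheeler_order G lab \<pi> \<longleftrightarrow>
     linear_order_on (verts G) \<pi> \<and>
     (\<forall>u\<in>verts G. \<forall>v\<in>verts G.
        in_degree G u = 0 \<and> in_degree G v > 0 \<longrightarrow> (u, v) \<in> \<pi> \<and> u \<noteq> v) \<and>
     (\<forall>e\<in>arcs G. \<forall>e'\<in>arcs G.
        (lab e < lab e' \<longrightarrow> (head G e, head G e') \<in> \<pi> \<and> head G e \<noteq> head G e') \<and>
        (lab e = lab e' \<and> (tail G e, tail G e') \<in> \<pi> \<and> tail G e \<noteq> tail G e'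
           \<longrightarrow> (head G e, head G e') \<in> \<pi>))"

text \<open>
  For a Wheeler order the listed arcs \<open>es\<close> are determined up to permuting parallel arcs, which
  carry equal labels; hence exactly one list \<open>B\<close> satisfies the following predicate.
\<close>

definition is_BWT ::
  "('v, 'e) pre_digraph \<Rightarrow> ('e \<Rightarrow> 'a) \<Rightarrow> 'v rel \<Rightarrow> 'a list \<Rightarrow> bool" where
  "is_BWT G lab \<pi> B \<longleftrightarrow>
     (\<exists>es. distinct es \<and> set es = arcs G \<and> B = map lab es \<and>
       sorted_wrt (\<lambda>e e'.
         (tail G e, tail G e') \<in> \<pi> \<and> tail G e \<noteq> tail G e' \<or>
         tail G e = tail G e' \<and> (head G e, head G e') \<in> \<pi>) es)"

text \<open>The pair \<open>(i, j)\<close> stands for the substring at the positions \<open>i, \<dots>, j - 1\<close>.\<close>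

definition const_substring :: "'a list \<Rightarrow> nat \<Rightarrow> nat \<Rightarrow> bool" where
  "const_substring B i j \<longleftrightarrow> i < j \<and> j \<le> length B \<and> (\<exists>c. \<forall>l\<in>{i..<j}. B ! l = c)"

definition runs :: "'a list \<Rightarrow> (nat \<times> nat) set" where
  "runs B = {(i, j). const_substring B i j \<and>
     (\<forall>i' j'. const_substring B i' j' \<and> i' \<le> i \<and> j \<le> j' \<longrightarrow> i' = i \<and> j' = j)}"

definition reachable_by ::
  "('v, 'e) pre_digraph \<Rightarrow> ('e \<Rightarrow> 'a) \<Rightarrow> 'a list \<Rightarrow> 'v set" where
  "reachable_by G lab P = {v. \<exists>u p. pre_digraph.awalk G u p v \<and> map lab p = P}"


section \<open>Path decompositions and identifiers\<close>

text \<open>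
  A path is a pair of its first vertex and its list of arcs; only the first and the last vertex
  of a path may coincide.
\<close>

definition dpath :: "('v, 'e) pre_digraph \<Rightarrow> 'v \<times> 'e list \<Rightarrow> bool" where
  "dpath G = (\<lambda>(u, p). (\<exists>v. pre_digraph.apath G u p v) \<or>
     pre_digraph.awalk G u p u \<and> p \<noteq> [] \<and> distinct (tl (pre_digraph.awalk_verts G u p)))"

definition path_verts :: "('v, 'e) pre_digraph \<Rightarrow> 'v \<times> 'e list \<Rightarrow> 'v list" where
  "path_verts G = (\<lambda>(u, p). pre_digraph.awalk_verts G u p)"

definition path_decomposition ::
  "('v, 'e) pre_digraph \<Rightarrow> ('v \<times> 'e list) set \<Rightarrow> bool" where
  "path_decomposition G D \<longleftrightarrow>
     (\<forall>q\<in>D. dpath G q) \<and>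
     (\<forall>(u, p)\<in>D. p = [] \<longrightarrow> in_degree G u = 0 \<and> out_degree G u = 0) \<and>
     (\<forall>e\<in>arcs G. \<exists>!q. q \<in> D \<and> e \<in> set (snd q)) \<and>
     (\<forall>v\<in>verts G. \<exists>q\<in>D. v \<in> set (path_verts G q)) \<and>
     (\<forall>q\<in>D. \<forall>v\<in>set (butlast (tl (path_verts G q))). in_degree G v = 1 \<and> out_degree G v = 1)"

definition endpoints :: "('v, 'e) pre_digraph \<Rightarrow> ('v \<times> 'e list) set \<Rightarrow> 'v set" where
  "endpoints G D = (\<Union>q\<in>D. {hd (path_verts G q), last (path_verts G q)})"

definition compatible_ids ::
  "('v, 'e) pre_digraph \<Rightarrow> ('v \<times> 'e list) set \<Rightarrow> ('v \<Rightarrow> nat) \<Rightarrow> bool" where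
  "compatible_ids G D ident \<longleftrightarrow>
     inj_on ident (verts G) \<and> ident ` verts G \<subseteq> {0..<card (verts G)} \<and>
     (\<forall>e\<in>arcs G. tail G e \<notin> endpoints G D \<and> head G e \<notin> endpoints G D
        \<longrightarrow> ident (head G e) = ident (tail G e) + 1)"


section \<open>A word RAM\<close>

text \<open>
  All values are words, i.e. naturals below \<open>2 ^ w\<close>. A program uses the finitely many registers
  that occur in it, a random-access memory, and an input from which words are read one after
  the other (so that the input need not be addressable by a word). Every instruction and every
  test costs one unit of time.
\<close>

type_synonym reg = nat

datatype binop = Add | Sub | Mul | Div | Mod | And | Or | Xor | Shl | Shr | Lt | Eq

fun binop_val :: "nat \<Rightarrow> binop \<Rightarrow> nat \<Rightarrow> nat \<Rightarrow> nat" where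
  "binop_val w Add a b = (a + b) mod 2 ^ w"
| "binop_val w Sub a b = (a + (2 ^ w - b)) mod 2 ^ w"
| "binop_val w Mul a b = (a * b) mod 2 ^ w"
| "binop_val w Div a b = a div b"
| "binop_val w Mod a b = a mod b"
| "binop_val w And a b = Bit_Operations.and a b"
| "binop_val w Or a b = Bit_Operations.or a b"
| "binop_val w Xor a b = Bit_Operations.xor a b"
| "binop_val w Shl a b = (a * 2 ^ b) mod 2 ^ w"
| "binop_val w Shr a b = a div 2 ^ b"
| "binop_val w Lt a b = of_bool (a < b) mod 2 ^ w"
| "binop_val w Eq a b = of_bool (a = b) mod 2 ^ w"

datatype com =
    Skip
  | Const reg nat
  | Op binop reg reg reg  \<comment> \<open>destination, then the two operands\<close>
  | Load reg reg          \<comment> \<open>destination, register holding the address\<close>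
  | Store reg reg         \<comment> \<open>register holding the address, source\<close>
  | Read reg reg          \<comment> \<open>destination, flag that is 0 iff the input is exhausted\<close>
  | Seq com com
  | If reg com com
  | While reg com

record state =
  regs :: "reg \<Rightarrow> nat"
  mem :: "nat list"
  inp :: "nat list"

text \<open>
  \<open>exec w c s t s'\<close>: with word length \<open>w\<close>, the program \<open>c\<close> started in \<open>s\<close> stops in \<open>s'\<close> after
  time \<open>t\<close>. There is no such \<open>s'\<close> if \<open>c\<close> diverges or accesses an address outside of the memory.
\<close>

inductive exec :: "nat \<Rightarrow> com \<Rightarrow> state \<Rightarrow> nat \<Rightarrow> state \<Rightarrow> bool" for w where
  Skip: "exec w Skip s 1 s"
| Const: "exec w (Const x k) s 1 (s\<lparr>regs := (regs s)(x := k mod 2 ^ w)\<rparr>)"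
| Op: "exec w (Op f x y z) s 1
         (s\<lparr>regs := (regs s)(x := binop_val w f (regs s y) (regs s z))\<rparr>)"
| Load: "regs s y < length (mem s) \<Longrightarrow>
         exec w (Load x y) s 1 (s\<lparr>regs := (regs s)(x := mem s ! regs s y)\<rparr>)"
| Store: "regs s x < length (mem s) \<Longrightarrow>
         exec w (Store x y) s 1 (s\<lparr>mem := (mem s)[regs s x := regs s y]\<rparr>)"
| Read_Nil: "inp s = [] \<Longrightarrow>
         exec w (Read x f) s 1 (s\<lparr>regs := (regs s)(f := 0)\<rparr>)"
| Read_Cons: "inp s = a # as \<Longrightarrow>
         exec w (Read x f) s 1 (s\<lparr>regs := (regs s)(x := a, f := 1 mod 2 ^ w), inp := as\<rparr>)"
| Seq: "exec w c1 s t1 s' \<Longrightarrow> exec w c2 s' t2 s'' \<Longrightarrow> exec w (Seq c1 c2) s (t1 + t2) s''"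
| If_True: "regs s x \<noteq> 0 \<Longrightarrow> exec w c1 s t s' \<Longrightarrow> exec w (If x c1 c2) s (t + 1) s'"
| If_False: "regs s x = 0 \<Longrightarrow> exec w c2 s t s' \<Longrightarrow> exec w (If x c1 c2) s (t + 1) s'"
| While_False: "regs s x = 0 \<Longrightarrow> exec w (While x c) s 1 s"
| While_True: "regs s x \<noteq> 0 \<Longrightarrow> exec w c s t1 s' \<Longrightarrow> exec w (While x c) s' t2 s'' \<Longrightarrow>
         exec w (While x c) s (t1 + t2 + 1) s''"

text \<open>Zero registers; \<open>M\<close> is the content of the memory and \<open>xs\<close> the input.\<close>

definition start :: "nat list \<Rightarrow> nat list \<Rightarrow> state" where
  "start M xs = \<lparr>regs = (\<lambda>_. 0), mem = M, inp = xs\<rparr>"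

definition words :: "nat \<Rightarrow> nat list \<Rightarrow> bool" where
  "words w xs \<longleftrightarrow> (\<forall>x\<in>set xs. x < 2 ^ w)"

text \<open>The truncation only matters for \<open>n < 4\<close>, where \<open>log 2 (log 2 n) < 1\<close> or is meaningless.\<close>

definition loglog :: "nat \<Rightarrow> real" where
  "loglog n = max 1 (log 2 (log 2 (real n)))"

text \<open>
  The memory consists of the structure \<open>S\<close>, which no query may change, followed by a work area
  \<open>W\<close>, which may hold arbitrary values when a query begins.

  A query runs \<open>cnt\<close>, which reads the word list \<open>xs\<close> and must leave the cardinality of the
  answer \<open>A\<close> in register 0, in time at most \<open>tcnt\<close>. From there on, every further run of \<open>rep\<close>,
  continuing with the state left behind by the preceding run, must leave another element of
  \<open>A\<close> in register 0, in time at most \<open>trep\<close>, until all of \<open>A\<close> has been reported.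
\<close>

definition answers_query ::
  "nat \<Rightarrow> com \<Rightarrow> com \<Rightarrow> nat list \<Rightarrow> nat list \<Rightarrow> nat list \<Rightarrow> nat set \<Rightarrow> real \<Rightarrow> real \<Rightarrow> bool" where
  "answers_query w cnt rep S W xs A tcnt trep \<longleftrightarrow>
     (\<exists>st.
        (\<exists>t. exec w cnt (start (S @ W) xs) t (st 0) \<and> real t \<le> tcnt) \<and>
        regs (st 0) 0 = card A \<and>
        (\<forall>i<card A. \<exists>t. exec w rep (st i) t (st (Suc i)) \<and> real t \<le> trep) \<and>
        bij_betw (\<lambda>i. regs (st (Suc i)) 0) {..<card A} A \<and>
        (\<forall>i\<le>card A. take (length S) (mem (st i)) = S))"

end

theory Submission
  imports Defs "HOL-Number_Theory.Cong"
begin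

text \<open>
  The vertices reached by paths labelled \<open>P\<close> form an interval of \<open>\<pi>\<close>. For a fixed character, the
  first and the last vertex of the interval after one more step are, as functions of the ends of the
  interval, piecewise linear with slopes 0 and 1, and over all characters the number of pieces is
  \<open>O(r + \<upsilon>)\<close>: away from the endpoints of the paths of \<open>D\<close> a new piece starts only at the end of a
  run. Likewise the map from the identifier of a vertex to that of its predecessor in \<open>\<pi>\<close> increases
  by 1 from one identifier to the next with \<open>O(r + \<upsilon>)\<close> exceptions, and the identifier of the last
  vertex of the interval can be maintained from \<open>O(r + \<upsilon>)\<close> samples. All of these maps are
  evaluated by predecessor queries in a y-fast trie, whose hash tables are two-level tables with
  multiply-shift hash functions.
\<close>

section \<open>Perfect hashing\<close>

text \<open>Nothing may be stored per vertex or per arc, which leaves hashed samples and predecessor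
  search. The keys are pairs of a label and a rank, or identifiers. Arcs with different labels enter
  different vertices, so there are at most \<open>n\<close> labels, the keys are polynomial in
  \<open>n\<close> and have \<open>u\<close> = O(log n) bits, and binary search over the heights of
  the trie and inside a block takes O(log u) = O(log log n) steps. A trie on all \<open>m\<close>
  keys would have about \<open>u * m\<close> nodes; one representative per block of
  \<open>u + 1\<close> keys brings this down to O(m).

  Reporting walks down from the last vertex of the interval, so its identifier is carried along
  while counting. If that vertex and its successor in \<pi> are entered by equally labelled arcs
  from consecutive ranks, away from endpoints, then the arc into it leaves the previous last vertex
  and the identifier grows by 1; only the remaining ranks are sampled.

  The hash multipliers come from averaging, since construction time is free. The data of a query fit
  in registers, so the memory is only read and the work area is empty.\<close>

definition ms :: "nat \<Rightarrow> nat \<Rightarrow> nat \<Rightarrow> nat \<Rightarrow> nat" where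
  "ms w a s x = a * x mod 2 ^ w div 2 ^ s"

lemma odd_part_exists:
  assumes "(d::nat) > 0"
  obtains j z where "d = 2 ^ j * z" "odd z"
  using assms
proof (induction d arbitrary: thesis rule: less_induct)
  case (less d)
  show ?case
  proof (cases "odd d")
    case True
    then show ?thesis using less.prems(1)[of 0 d] by simp
  next
    case False
    then obtain d' where d': "d = 2 * d'" by blast
    with less obtain j z where "d' = 2 ^ j * z" "odd z" by (metis mult_2 less_add_same_cancel1 nat_0_less_mult_iff)
    then show ?thesis using less.prems(1)[of "Suc j" z] d' by simp
  qed
qed

text \<open>Write the difference of the keys as \<open>2 ^ j * z\<close> with \<open>z\<close> odd.
  A collision puts \<open>a * d mod 2 ^ w\<close> within \<open>2 ^ s\<close> of a multiple of
  \<open>2 ^ w\<close>, and this number is \<open>2 ^ j * f a\<close> with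
  \<open>f a = a * z mod 2 ^ (w - j)\<close>. As \<open>z\<close> is invertible modulo
  \<open>2 ^ (w - j)\<close>, each admissible value of \<open>f a\<close> comes from at most
  \<open>2 ^ j\<close> multipliers. Among the \<open>2 ^ (w - 1)\<close> odd multipliers this is a
  fraction of at most 4 divided by the table size \<open>2 ^ (w - s)\<close>.\<close>

lemma ms_collision:
  assumes xy: "x < 2 ^ w" "y < x" and s: "s \<le> w"
  shows "card {a. a < 2 ^ w \<and> odd a \<and> ms w a s x = ms w a s y} \<le> 2 ^ (s + 1)"
proof -
  define d where "d = x - y"
  have d: "0 < d" "d < 2 ^ w" using xy by (auto simp: d_def)
  obtain j z where jz: "d = 2 ^ j * z" "odd z" using odd_part_exists[OF d(1)] .
  have "2 ^ j \<le> d" using jz by (cases z) auto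
  with d have "(2::nat) ^ j < 2 ^ w" by linarith
  then have j: "j < w" by simp
  define A where "A = {a. a < 2 ^ w \<and> odd a \<and> ms w a s x = ms w a s y}"
  define f where "f = (\<lambda>a::nat. a * z mod 2 ^ (w - j))"
  have ww: "(2::nat) ^ w = 2 ^ j * 2 ^ (w - j)" using j by (simp flip: power_add)
  have fd: "a * d mod 2 ^ w = 2 ^ j * f a" for a
    unfolding f_def jz ww by (metis mult.left_commute mult_mod_right)
  have ms: "a * d mod 2 ^ w < 2 ^ s \<or> 2 ^ w < a * d mod 2 ^ w + 2 ^ s" if "a \<in> A" for a
  proof -
    define p q where "p = a * x mod 2 ^ w" and "q = a * y mod 2 ^ w"
    have pq: "p < 2 ^ w" "q < 2 ^ w" by (auto simp: p_def q_def)
    have e: "p div 2 ^ s = q div 2 ^ s" using that by (auto simp: A_def ms_def p_def q_def)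
    have "p mod 2 ^ s < 2 ^ s" "q mod 2 ^ s < 2 ^ s" by auto
    moreover have "p = p div 2 ^ s * 2 ^ s + p mod 2 ^ s" "q = p div 2 ^ s * 2 ^ s + q mod 2 ^ s"
      using div_mult_mod_eq[of p "2 ^ s"] div_mult_mod_eq[of q "2 ^ s"] e by simp_all
    ultimately have close: "p < q + 2 ^ s" "q < p + 2 ^ s" by linarith+
    have "(q + a * d) mod 2 ^ w = p"
      unfolding p_def q_def d_def using xy by (simp add: mod_add_left_eq add_mult_distrib2[symmetric])
    then have "(q + a * d mod 2 ^ w) mod 2 ^ w = p" by (simp add: mod_add_right_eq)
    moreover have "(q + a * d mod 2 ^ w) mod 2 ^ w = (if q + a * d mod 2 ^ w < 2 ^ w then q + a * d mod 2 ^ w else q + a * d mod 2 ^ w - 2 ^ w)"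
      using pq(2) mod_less_divisor[of "2 ^ w" "a * d"] by (simp add: le_mod_geq del: mod_less_divisor)
    ultimately show ?thesis using close by (auto split: if_splits)
  qed
  have f0: "f a \<noteq> 0" if "a \<in> A" for a
  proof
    assume "f a = 0"
    then have "2 ^ (w - j) dvd a * z" by (auto simp: f_def)
    moreover have "(2::nat) dvd 2 ^ (w - j)" using j by simp
    ultimately have "2 dvd a * z" using dvd_trans by blast
    then show False using that jz(2) by (auto simp: A_def)
  qed
  have flt: "f a < 2 ^ (w - j)" for a by (simp add: f_def)
  \<comment> \<open>The admissible values of \<open>f\<close> are nonzero (this is where
    \<open>a\<close> has to be odd) and less than \<open>2 ^ (s - j)\<close> away from 0 on the
    cycle modulo \<open>2 ^ (w - j)\<close>. If \<open>s <= j\<close>, there are none and the two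
    keys never collide.\<close>
  define N where "N = (2::nat) ^ (s - j)"
  define V where "V = (if s \<le> j then {} else {1..<N} \<union> {2 ^ (w - j) - N<..<2 ^ (w - j)})"
  have fV: "f a \<in> V" if a: "a \<in> A" for a
  proof -
    have m: "2 ^ j * f a < 2 ^ s \<or> 2 ^ j * 2 ^ (w - j) < 2 ^ j * f a + 2 ^ s"
      using ms[OF a] unfolding fd unfolding ww .
    show ?thesis
    proof (cases "s \<le> j")
      case True
      then have "(2::nat) ^ s \<le> 2 ^ j" by simp
      moreover have "2 ^ j \<le> 2 ^ j * f a" using f0[OF a] by simp
      moreover have "2 ^ j * (f a + 1) \<le> 2 ^ j * 2 ^ (w - j)" using flt[of a] by (intro mult_le_mono2) simp
      then have "2 ^ j * f a + 2 ^ j \<le> 2 ^ j * 2 ^ (w - j)" by (simp add: distrib_left)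
      ultimately have False using m by linarith
      then show ?thesis ..
    next
      case False
      then have "(2::nat) ^ s = 2 ^ j * N" by (simp add: N_def flip: power_add)
      then have "f a < N \<or> 2 ^ (w - j) < f a + N" using m
        by (auto simp flip: distrib_left)
      then show ?thesis using False f0[OF a] flt[of a] by (auto simp: V_def)
    qed
  qed
  \<comment> \<open>\<open>f a\<close> determines \<open>a mod 2 ^ (w - j)\<close>, because
    \<open>z\<close> is invertible; the quotient supplies the missing high \<open>j\<close>
    bits.\<close>
  define g where "g = (\<lambda>a::nat. (a div 2 ^ (w - j), f a))"
  have "inj_on g A"
  proof (rule inj_onI)
    fix a b assume ab: "a \<in> A" "b \<in> A" "g a = g b"
    have "coprime z (2 ^ (w - j))" using jz(2) by simp
    moreover have "a * z mod 2 ^ (w - j) = b * z mod 2 ^ (w - j)" using ab(3) by (simp add: g_def f_def)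
    ultimately have "a mod 2 ^ (w - j) = b mod 2 ^ (w - j)"
      using cong_mult_rcancel_nat[of z "2 ^ (w - j)" a b] by (simp add: cong_def)
    with ab(3) show "a = b" unfolding g_def by (metis div_mult_mod_eq prod.inject)
  qed
  moreover have "g ` A \<subseteq> {..<2 ^ j} \<times> V"
  proof
    fix p assume "p \<in> g ` A"
    then obtain a where a: "a \<in> A" "p = g a" by blast
    have "a < 2 ^ j * 2 ^ (w - j)" using a unfolding ww[symmetric] by (simp add: A_def)
    then have "a div 2 ^ (w - j) < 2 ^ j" by (simp add: less_mult_imp_div_less)
    then show "p \<in> {..<2 ^ j} \<times> V" using fV[OF a(1)] a(2) by (simp add: g_def)
  qed
  ultimately have "card A \<le> card ({..<(2::nat) ^ j} \<times> V)"
    by (intro card_inj_on_le) (auto simp: V_def)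
  also have "\<dots> = 2 ^ j * card V" by (simp add: card_cartesian_product)
  also have "card V \<le> (if s \<le> j then 0 else 2 * N)"
  proof (cases "s \<le> j")
    case False
    have "card V \<le> card {1..<N} + card {2 ^ (w - j) - N<..<2 ^ (w - j)}"
      using False card_Un_le by (simp only: V_def if_False)
    also have "\<dots> \<le> N + N" by auto
    finally show ?thesis using False by simp
  qed (simp add: V_def)
  also have "2 ^ j * (if s \<le> j then 0 else 2 * N) \<le> 2 ^ (s + 1)"
    by (auto simp: N_def mult.left_commute simp flip: power_add)
  finally show ?thesis by (simp add: A_def)
qed

lemma ms_less:
  assumes "b \<le> w"
  shows "ms w a (w - b) x < 2 ^ b"
  unfolding ms_def using assms
  by (auto intro!: less_mult_imp_div_less simp flip: power_add)

lemma card_odd_less: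
  assumes "w \<ge> 1"
  shows "card {a::nat. a < 2 ^ w \<and> odd a} = 2 ^ (w - 1)"
proof -
  have "{a::nat. a < 2 ^ w \<and> odd a} = (\<lambda>k. 2 * k + 1) ` {..<2 ^ (w - 1)}"
  proof (intro set_eqI iffI)
    fix a :: nat assume "a \<in> {a. a < 2 ^ w \<and> odd a}"
    then obtain k where "a = 2 * k + 1" "a < 2 * 2 ^ (w - 1)" using assms
      by (auto elim!: oddE simp flip: power_Suc)
    then show "a \<in> (\<lambda>k. 2 * k + 1) ` {..<2 ^ (w - 1)}" by auto
  next
    fix a :: nat assume "a \<in> (\<lambda>k. 2 * k + 1) ` {..<2 ^ (w - 1)}"
    then obtain k where k: "a = 2 * k + 1" "k < 2 ^ (w - 1)" by auto
    then have "a < 2 * 2 ^ (w - 1)" by linarith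
    with k(1) assms show "a \<in> {a. a < 2 ^ w \<and> odd a}" by (auto simp flip: power_Suc)
  qed
  then show ?thesis by (simp add: card_image inj_on_def)
qed

text \<open>Double counting of multipliers and colliding pairs of keys: if every odd multiplier had
  more collisions than claimed, their sum would exceed what \<open>ms_collision\<close> allows when
  summed over all pairs. Pairs are ordered, so each collision is counted twice.\<close>

lemma ms_few_collisions:
  assumes X: "finite X" "X \<subseteq> {..<2 ^ w}" and b: "b \<le> w" and w: "w \<ge> 1"
  obtains a where "odd a" "a < 2 ^ w"
    "card {p \<in> X \<times> X. fst p \<noteq> snd p \<and> ms w a (w - b) (fst p) = ms w a (w - b) (snd p)} * 2 ^ b
       \<le> 4 * (card X * (card X - 1))"
proof -
  define A where "A = {a::nat. a < 2 ^ w \<and> odd a}"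
  define co where "co = (\<lambda>a (p::nat\<times>nat). ms w a (w - b) (fst p) = ms w a (w - b) (snd p))"
  define Y where "Y = {p \<in> X \<times> X. fst p \<noteq> snd p}"
  have A: "finite A" "card A = 2 ^ (w - 1)" using card_odd_less[OF w] by (auto simp: A_def)
  have "Y = X \<times> X - (\<lambda>x. (x, x)) ` X" by (auto simp: Y_def)
  moreover have "card ((\<lambda>x. (x, x)) ` X) = card X" by (simp add: card_image inj_on_def)
  ultimately have Y: "finite Y" "card Y = card X * (card X - 1)"
    using X(1) by (auto simp: card_Diff_subset card_cartesian_product algebra_simps diff_mult_distrib2 image_subset_iff)
  have pair: "card {a \<in> A. co a p} \<le> 2 ^ (w - b + 1)" if pY: "p \<in> Y" for p
  proof -
    obtain x y where p: "p = (x, y)" "x < 2 ^ w" "y < 2 ^ w" "x \<noteq> y"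
      using pY X(2) by (cases p) (auto simp: Y_def)
    show ?thesis
    proof (cases "y < x")
      case True
      show ?thesis using ms_collision[OF p(2) True, of "w - b"] by (simp add: A_def co_def p(1))
    next
      case False
      then have "x < y" using p by simp
      from ms_collision[OF p(3) this, of "w - b"] show ?thesis
        by (simp add: A_def co_def p(1) eq_commute[of "ms w _ _ x"])
    qed
  qed
  have "\<exists>a\<in>A. card {p \<in> Y. co a p} * 2 ^ b \<le> 4 * card Y"
  proof (rule ccontr)
    assume "\<not> ?thesis"
    then have lt: "4 * card Y < card {p \<in> Y. co a p} * 2 ^ b" if "a \<in> A" for a using that by auto
    have "(\<Sum>a\<in>A. 4 * card Y) < (\<Sum>a\<in>A. card {p \<in> Y. co a p} * 2 ^ b)"
      using lt A by (intro sum_strict_mono) (auto simp: card_gt_0_iff)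
    also have "\<dots> = (\<Sum>a\<in>A. \<Sum>p\<in>Y. of_bool (co a p)) * 2 ^ b"
      using Y(1) by (simp add: sum_distrib_right Int_def conj_commute)
    also have "(\<Sum>a\<in>A. \<Sum>p\<in>Y. of_bool (co a p)) = (\<Sum>p\<in>Y. card {a \<in> A. co a p})"
      using A(1) by (subst sum.swap) (simp add: Int_def)
    also have "\<dots> \<le> (\<Sum>p\<in>Y. 2 ^ (w - b + 1))" by (intro sum_mono pair)
    also have "(\<Sum>p\<in>Y. 2 ^ (w - b + 1)) * 2 ^ b = card Y * (2 * 2 ^ w)"
      using b by (simp flip: power_add)
    also have "\<dots> = (\<Sum>a\<in>A. 4 * card Y)" using A(2) w by (cases w) auto
    finally show False by simp
  qed
  then obtain a where "a \<in> A" "card {p \<in> Y. co a p} * 2 ^ b \<le> 4 * card Y" by blast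
  moreover have "{p \<in> Y. co a p} =
      {p \<in> X \<times> X. fst p \<noteq> snd p \<and> ms w a (w - b) (fst p) = ms w a (w - b) (snd p)}"
    by (auto simp: Y_def co_def)
  ultimately show ?thesis using that[of a] Y(2) by (auto simp: A_def)
qed

lemma ms_injective:
  assumes X: "finite X" "X \<subseteq> {..<2 ^ w}" and b: "b \<le> w" and w: "w \<ge> 1"
    and large: "4 * (card X * (card X - 1)) < 2 ^ b"
  obtains a where "a < 2 ^ w" "inj_on (ms w a (w - b)) X"
proof -
  obtain a where a: "a < 2 ^ w"
    "card {p \<in> X \<times> X. fst p \<noteq> snd p \<and> ms w a (w - b) (fst p) = ms w a (w - b) (snd p)} * 2 ^ b
       \<le> 4 * (card X * (card X - 1))" (is "card ?C * _ \<le> _")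
    using ms_few_collisions[OF X b w] .
  have "card ?C = 0"
  proof (rule ccontr)
    assume "card ?C \<noteq> 0"
    then have "1 * 2 ^ b \<le> card ?C * 2 ^ b" by (intro mult_le_mono1) simp
    with a(2) large show False by simp
  qed
  moreover have "finite ?C" using X(1) by simp
  ultimately have "?C = {}" by simp
  then have "inj_on (ms w a (w - b)) X" by (auto simp: inj_on_def)
  with a(1) that show ?thesis by blast
qed

lemma power_of_two_between: "\<exists>b. N < 2 ^ b \<and> 2 ^ b \<le> 2 * N + (1::nat)"
proof (induction N)
  case 0
  show ?case by (intro exI[of _ 0]) simp
next
  case (Suc N)
  then obtain b where b: "N < 2 ^ b" "2 ^ b \<le> 2 * N + (1::nat)" by blast
  show ?case
  proof (cases "Suc N < 2 ^ b")
    case True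
    with b show ?thesis by (intro exI[of _ b]) auto
  next
    case False
    with b have "2 ^ b = Suc N" by simp
    then show ?thesis by (intro exI[of _ "Suc b"]) simp
  qed
qed

section \<open>Layout and size of two-level hash tables\<close>

lemma concat_blocks:
  fixes bl :: "nat \<Rightarrow> 'a list"
  defines "off \<equiv> \<lambda>i. length (concat (map bl [0..<i]))"
  assumes "i < N"
  shows "off i + length (bl i) \<le> length (concat (map bl [0..<N]))"
    and "k < length (bl i) \<Longrightarrow> concat (map bl [0..<N]) ! (off i + k) = bl i ! k"
proof -
  have "[0..<N] = [0..<i] @ i # [Suc i..<N]" using assms(2)
    upt_add_eq_append[of 0 i "N - i"]
    by (simp add: upt_conv_Cons)
  then have e: "concat (map bl [0..<N])
      = concat (map bl [0..<i]) @ bl i @ concat (map bl [Suc i..<N])" by simp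
  show "off i + length (bl i) \<le> length (concat (map bl [0..<N]))" unfolding e off_def by simp
  show "k < length (bl i) \<Longrightarrow> concat (map bl [0..<N]) ! (off i + k) = bl i ! k"
    unfolding e off_def by (simp add: nth_append)
qed

text \<open>
  A dictionary is a two-level hash table: the multiplier and the shift of the first level, then a
  triple (multiplier, shift, offset) for every bucket, then the slots, each one a key and its
  value. Keys with value \<open>0\<close> are absent.
\<close>

definition bucket_pos :: "nat \<Rightarrow> nat list \<Rightarrow> nat \<Rightarrow> nat" where
  "bucket_pos w L q = 2 + 3 * ms w (L ! 0) (L ! 1) q"

definition slot_pos :: "nat \<Rightarrow> nat list \<Rightarrow> nat \<Rightarrow> nat" where
  "slot_pos w L q = (let i = bucket_pos w L q in L ! (i + 2) + 2 * ms w (L ! i) (L ! (i + 1)) q)"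

definition dictionary :: "nat \<Rightarrow> (nat \<Rightarrow> nat) \<Rightarrow> nat list \<Rightarrow> bool" where
  "dictionary w f L \<longleftrightarrow> 2 \<le> length L \<and>
     (\<forall>q<2 ^ w. bucket_pos w L q + 2 < length L \<and> slot_pos w L q + 1 < length L \<and>
        f q = (if L ! slot_pos w L q = q then L ! (slot_pos w L q + 1) else 0))"

text \<open>The construction of Fredman, Komlos and Szemeredi. With more than \<open>m\<close>
  buckets, at most \<open>5 * m\<close> ordered pairs of keys share a bucket, diagonal included.
  This is the sum of the squares of the bucket sizes, so giving bucket \<open>i\<close> a
  collision-free table quadratic in its size \<open>c i\<close> costs linear space in all. The bound
  on \<open>w\<close> makes table sizes and addresses fit in words.\<close>

lemma dictionary_exists:
  fixes f :: "nat \<Rightarrow> nat"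
  defines "X \<equiv> {q. f q \<noteq> 0}"
  assumes X: "finite X" "X \<subseteq> {..<2 ^ w}" and f: "\<And>q. f q < 2 ^ w"
    and m: "card X \<le> m" and w: "100 * (m + 1)\<^sup>2 < 2 ^ w"
  obtains L where "dictionary w f L" "words w L" "length L \<le> 100 * (m + 1)"
proof -
  have w1: "w \<ge> 1" using w by (cases w) auto
  have w2: "200 * m + 100 * m\<^sup>2 + 100 < 2 ^ w" using w by (simp add: power2_eq_square algebra_simps)
  have "m + 1 \<le> (m + 1)\<^sup>2" by (simp add: power2_eq_square)
  then have w3: "100 * (m + 1) < 2 ^ w" using w by (meson le_less_trans mult_le_mono2)
  obtain b where b: "m < 2 ^ b" "2 ^ b \<le> 2 * m + (1::nat)" using power_of_two_between by blast
  have pw: "b' \<le> w" if "(2::nat) ^ b' \<le> 2 ^ w" for b' using that by simp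
  have bw: "b \<le> w" by (intro pw order.trans[OF b(2)] order.trans[OF _ less_imp_le[OF w3]]) simp
  obtain a where a: "a < 2 ^ w"
    "card {p \<in> X \<times> X. fst p \<noteq> snd p \<and> ms w a (w - b) (fst p) = ms w a (w - b) (snd p)} * 2 ^ b
       \<le> 4 * (card X * (card X - 1))" (is "card ?C * _ \<le> _")
    using ms_few_collisions[OF X bw w1] .
  define bu where "bu = (\<lambda>i. {x \<in> X. ms w a (w - b) x = i})"
  define c where "c = (\<lambda>i. card (bu i))"
  have c: "c i \<le> m" for i
    unfolding c_def bu_def using X(1) m by (intro order.trans[OF card_mono m]) auto
  have "\<exists>b'. 4 * (c i * (c i - 1)) < 2 ^ b' \<and> 2 ^ b' \<le> 8 * (c i)\<^sup>2 + (1::nat)" for i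
  proof -
    obtain b' where b': "4 * (c i * (c i - 1)) < 2 ^ b'" "2 ^ b' \<le> 2 * (4 * (c i * (c i - 1))) + (1::nat)"
      using power_of_two_between by blast
    moreover have "c i * (c i - 1) \<le> (c i)\<^sup>2" unfolding power2_eq_square by (intro mult_le_mono2) simp
    ultimately show ?thesis by (intro exI[of _ b']) linarith
  qed
  then obtain bb where bb: "\<And>i. 4 * (c i * (c i - 1)) < 2 ^ bb i" "\<And>i. 2 ^ bb i \<le> 8 * (c i)\<^sup>2 + (1::nat)"
    by metis
  have bbw: "bb i \<le> w" for i
  proof (rule pw)
    have "(c i)\<^sup>2 \<le> m\<^sup>2" using c[of i] by (rule power_mono) simp
    then show "(2::nat) ^ bb i \<le> 2 ^ w" using bb(2)[of i] w2 by linarith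
  qed
  have "\<exists>a'. a' < 2 ^ w \<and> inj_on (ms w a' (w - bb i)) (bu i)" for i
    using ms_injective[of "bu i" w "bb i"] X bbw[of i] w1 bb(1)[of i]
    by (auto simp: c_def bu_def subset_iff)
  then obtain aa where aa: "\<And>i. aa i < 2 ^ w" "\<And>i. inj_on (ms w (aa i) (w - bb i)) (bu i)" by metis
  \<comment> \<open>An empty slot holds the key 0 together with the value \<open>f 0\<close>: a
    look-up of any other key that ends there fails, and one of 0 is answered correctly, so no marker
    for empty slots is needed.\<close>
  define key where "key = (\<lambda>i h. if \<exists>x\<in>bu i. ms w (aa i) (w - bb i) x = h
     then SOME x. x \<in> bu i \<and> ms w (aa i) (w - bb i) x = h else 0)"
  have key_eq: "key i (ms w (aa i) (w - bb i) x) = x" if "x \<in> bu i" for i x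
  proof -
    have "key i (ms w (aa i) (w - bb i) x)
        = (SOME y. y \<in> bu i \<and> ms w (aa i) (w - bb i) y = ms w (aa i) (w - bb i) x)"
      using that by (auto simp: key_def)
    also have "\<dots> = x"
      using that aa(2)[of i] by (intro some_equality) (auto simp: inj_on_def)
    finally show ?thesis .
  qed
  have key_less: "key i h < 2 ^ w" for i h
  proof (cases "\<exists>x\<in>bu i. ms w (aa i) (w - bb i) x = h")
    case True
    then obtain x where "x \<in> bu i" "key i h = x" using key_eq by blast
    then show ?thesis using X(2) by (auto simp: bu_def)
  qed (simp add: key_def)
  define bl where "bl = (\<lambda>i. concat (map (\<lambda>h. [key i h, f (key i h)]) [0..<2 ^ bb i]))"
  have len_bl: "length (bl i) = 2 * 2 ^ bb i" for i
    by (simp add: bl_def length_concat comp_def sum_list_triv)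
  have bl_nth: "bl i ! (2 * h) = key i h" "bl i ! (2 * h + 1) = f (key i h)" if "h < 2 ^ bb i" for i h
  proof -
    define g where "g = (\<lambda>h. [key i h, f (key i h)])"
    have off: "length (concat (map g [0..<h])) = 2 * h"
      by (simp add: g_def length_concat comp_def sum_list_triv)
    have e: "bl i = concat (map g [0..<2 ^ bb i])" by (simp add: bl_def g_def)
    show "bl i ! (2 * h) = key i h" "bl i ! (2 * h + 1) = f (key i h)"
      using concat_blocks(2)[OF that, of 0 g] concat_blocks(2)[OF that, of 1 g]
      unfolding off e by (simp_all add: g_def)
  qed
  define N :: nat where "N = 2 ^ b"
  define Z where "Z = concat (map bl [0..<N])"
  define off where "off = (\<lambda>i. length (concat (map bl [0..<i])))"
  define hdr where "hdr = (\<lambda>i. [aa i, w - bb i, 2 + 3 * N + off i])"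
  define H where "H = concat (map hdr [0..<N])"
  define L where "L = [a, w - b] @ H @ Z"
  have off_h: "length (concat (map hdr [0..<i])) = 3 * i" for i
    by (simp add: hdr_def length_concat comp_def sum_list_triv)
  have len_H: "length H = 3 * N" unfolding H_def off_h ..
  have len_Z: "length Z = 2 * (\<Sum>i<N. 2 ^ bb i)"
    by (simp add: Z_def length_concat comp_def len_bl sum_list_distinct_conv_sum_set atLeast0LessThan
        flip: sum_distrib_left)
  have len: "length L = 2 + 3 * N + length Z" by (simp add: L_def len_H)
  have msN: "ms w a (w - b) q < N" for q unfolding N_def by (rule ms_less[OF bw])
  have HL: "L ! (2 + 3 * i + k) = hdr i ! k" if "i < N" "k < 3" for i k
  proof -
    have "3 * i + k < 3 * N" using that by linarith
    then have "L ! (2 + 3 * i + k) = H ! (3 * i + k)" by (simp add: L_def nth_append len_H)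
    also have "\<dots> = hdr i ! k" unfolding H_def
      using concat_blocks(2)[OF that(1), of k hdr] that(2) by (simp add: off_h) (simp add: hdr_def)
    finally show ?thesis .
  qed
  have ZL: "L ! (2 + 3 * N + off i + k) = bl i ! k" "2 + 3 * N + off i + k < length L"
    if "i < N" "k < 2 * 2 ^ bb i" for i k
  proof -
    have "L ! (2 + 3 * N + off i + k) = Z ! (off i + k)" by (simp add: L_def nth_append len_H)
    also have "\<dots> = bl i ! k" using concat_blocks(2)[OF that(1), of k bl] that(2)
      by (simp add: Z_def off_def len_bl)
    finally show "L ! (2 + 3 * N + off i + k) = bl i ! k" .
    show "2 + 3 * N + off i + k < length L"
      using concat_blocks(1)[OF that(1), of bl] that(2) by (simp add: len Z_def off_def len_bl)
  qed
  have "dictionary w f L"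
    unfolding dictionary_def
  proof (intro conjI allI impI)
    show "2 \<le> length L" by (simp add: len)
  next
    fix q :: nat assume q: "q < 2 ^ w"
    define i where "i = ms w a (w - b) q"
    have i: "i < N" unfolding i_def by (rule msN)
    have bp: "bucket_pos w L q = 2 + 3 * i" by (simp add: bucket_pos_def L_def i_def)
    then show "bucket_pos w L q + 2 < length L" using i len by linarith
    define h where "h = ms w (aa i) (w - bb i) q"
    have h: "h < 2 ^ bb i" unfolding h_def by (rule ms_less[OF bbw])
    have sp: "slot_pos w L q = 2 + 3 * N + off i + 2 * h"
      using HL[OF i, of 0] HL[OF i, of 1] HL[OF i, of 2]
      by (simp add: slot_pos_def bp h_def hdr_def)
    have s1: "L ! slot_pos w L q = key i h" "L ! (slot_pos w L q + 1) = f (key i h)"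
      using ZL(1)[OF i, of "2 * h"] ZL(1)[OF i, of "2 * h + 1"] h bl_nth[OF h] by (simp_all add: sp)
    show "slot_pos w L q + 1 < length L"
      using ZL(2)[OF i, of "2 * h + 1"] h by (simp add: sp)
    show "f q = (if L ! slot_pos w L q = q then L ! (slot_pos w L q + 1) else 0)"
    proof (cases "key i h = q")
      case False
      then have "q \<notin> X" using key_eq[of q i] by (auto simp: h_def i_def bu_def)
      then show ?thesis using False by (simp add: s1 X_def)
    qed (use s1 in simp)
  qed
  \<comment> \<open>Altogether \<open>2 + 3 * N + 2 * (40 * m + N)\<close> words at most, with
    \<open>N <= 2 * m + 1\<close>; this is at most \<open>90 * m + 7\<close>.\<close>
  moreover have len_le: "length L \<le> 100 * (m + 1)"
  proof -
    have "(\<Sum>i<N. (c i)\<^sup>2) = card {p \<in> X \<times> X. ms w a (w - b) (fst p) = ms w a (w - b) (snd p)}"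
    proof -
      have "{p \<in> X \<times> X. ms w a (w - b) (fst p) = ms w a (w - b) (snd p)} = (\<Union>i<N. bu i \<times> bu i)"
        using msN by (auto simp: bu_def)
      moreover have "card (\<Union>i<N. bu i \<times> bu i) = (\<Sum>i<N. card (bu i \<times> bu i))"
        using X(1) by (intro card_UN_disjoint) (auto simp: bu_def)
      ultimately show ?thesis by (simp add: c_def card_cartesian_product power2_eq_square)
    qed
    also have "\<dots> \<le> card (?C \<union> (\<lambda>x. (x, x)) ` X)"
      using X(1) by (intro card_mono) auto
    also have "\<dots> \<le> card ?C + card ((\<lambda>x. (x, x)) ` X)" by (rule card_Un_le)
    also have "\<dots> \<le> card ?C + m" using card_image_le[OF X(1), of "\<lambda>x. (x, x)"] m by linarith
    also have "card ?C \<le> 4 * m"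
    proof (cases "card ?C = 0")
      case False
      have "card ?C * 2 ^ b \<le> 4 * (card X * (card X - 1))" by (rule a(2))
      also have "\<dots> \<le> 4 * (m * 2 ^ b)" using m b(1) by (intro mult_le_mono2 mult_le_mono) auto
      finally show ?thesis by simp
    qed simp
    finally have sq: "(\<Sum>i<N. (c i)\<^sup>2) \<le> 5 * m" by simp
    have "(\<Sum>i<N. 2 ^ bb i) \<le> (\<Sum>i<N. 8 * (c i)\<^sup>2 + (1::nat))" by (intro sum_mono bb(2))
    also have "\<dots> = 8 * (\<Sum>i<N. (c i)\<^sup>2) + N" unfolding sum.distrib sum_distrib_left by simp
    finally have "(\<Sum>i<N. 2 ^ bb i) \<le> 40 * m + N" using sq by linarith
    moreover have "N \<le> 2 * m + 1" using b(2) by (simp add: N_def)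
    ultimately show ?thesis unfolding len len_Z by simp
  qed
  moreover have "words w L"
  proof -
    have lt: "length L < 2 ^ w" using len_le w3 by linarith
    have sh: "w - k < 2 ^ w" for k using less_exp[of w] by (metis diff_le_self le_less_trans)
    have offs: "2 + 3 * N + off i < 2 ^ w" if "i < N" for i
      using concat_blocks(1)[OF that, of bl] lt by (simp add: len Z_def off_def)
    show ?thesis unfolding words_def L_def H_def Z_def
      using a(1) sh aa(1) offs key_less f by (auto simp: hdr_def bl_def)
  qed
  ultimately show ?thesis using that by blast
qed

section \<open>Expressions on the word RAM\<close>

text \<open>Expressions only read: their evaluation changes neither the memory nor a register below
  the evaluation stack. \<open>HashTimes\<close>, meant to wrap around, is kept apart from
  \<open>Times\<close>, whose uses have to be shown free of overflow.\<close>

datatype expr =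
    Var nat
  | Num nat
  | Plus expr expr
  | Minus expr expr
  | Times expr expr
  | HashTimes expr expr
  | Shift expr expr
  | Less expr expr
  | Equal expr expr
  | Fetch expr

fun val :: "nat \<Rightarrow> nat list \<Rightarrow> (nat \<Rightarrow> nat) \<Rightarrow> expr \<Rightarrow> nat" where
  "val w M V (Var x) = V x"
| "val w M V (Num k) = k"
| "val w M V (Plus a b) = val w M V a + val w M V b"
| "val w M V (Minus a b) = val w M V a - val w M V b"
| "val w M V (Times a b) = val w M V a * val w M V b"
| "val w M V (HashTimes a b) = val w M V a * val w M V b mod 2 ^ w"
| "val w M V (Shift a b) = val w M V a div 2 ^ val w M V b"
| "val w M V (Less a b) = of_bool (val w M V a < val w M V b)"
| "val w M V (Equal a b) = of_bool (val w M V a = val w M V b)"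
| "val w M V (Fetch a) = M ! val w M V a"

text \<open>Safety means that the machine arithmetic modulo \<open>2 ^ w\<close> agrees with \<open>val\<close>.\<close>

fun safe :: "nat \<Rightarrow> nat list \<Rightarrow> (nat \<Rightarrow> nat) \<Rightarrow> expr \<Rightarrow> bool" where
  "safe w M V (Var x) \<longleftrightarrow> x < 100"
| "safe w M V (Num k) \<longleftrightarrow> k < 2 ^ w"
| "safe w M V (Plus a b) \<longleftrightarrow> safe w M V a \<and> safe w M V b \<and> val w M V a + val w M V b < 2 ^ w"
| "safe w M V (Minus a b) \<longleftrightarrow> safe w M V a \<and> safe w M V b \<and> val w M V b \<le> val w M V a \<and> val w M V a < 2 ^ w"
| "safe w M V (Times a b) \<longleftrightarrow> safe w M V a \<and> safe w M V b \<and> val w M V a * val w M V b < 2 ^ w"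
| "safe w M V (HashTimes a b) \<longleftrightarrow> safe w M V a \<and> safe w M V b"
| "safe w M V (Shift a b) \<longleftrightarrow> safe w M V a \<and> safe w M V b"
| "safe w M V (Less a b) \<longleftrightarrow> safe w M V a \<and> safe w M V b"
| "safe w M V (Equal a b) \<longleftrightarrow> safe w M V a \<and> safe w M V b"
| "safe w M V (Fetch a) \<longleftrightarrow> safe w M V a \<and> val w M V a < length M"

fun cost :: "expr \<Rightarrow> nat" where
  "cost (Var x) = 1"
| "cost (Num k) = 1"
| "cost (Plus a b) = cost a + (cost b + 1)"
| "cost (Minus a b) = cost a + (cost b + 1)"
| "cost (Times a b) = cost a + (cost b + 1)"
| "cost (HashTimes a b) = cost a + (cost b + 1)"
| "cost (Shift a b) = cost a + (cost b + 1)"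
| "cost (Less a b) = cost a + (cost b + 1)"
| "cost (Equal a b) = cost a + (cost b + 1)"
| "cost (Fetch a) = cost a + 1"

text \<open>The registers from \<open>d\<close> on serve as an evaluation stack; programs use those below \<open>100\<close>.\<close>

fun code :: "expr \<Rightarrow> nat \<Rightarrow> com" where
  "code (Var x) d = Op Or d x x"
| "code (Num k) d = Const d k"
| "code (Plus a b) d = Seq (code a d) (Seq (code b (Suc d)) (Op Add d d (Suc d)))"
| "code (Minus a b) d = Seq (code a d) (Seq (code b (Suc d)) (Op Sub d d (Suc d)))"
| "code (Times a b) d = Seq (code a d) (Seq (code b (Suc d)) (Op Mul d d (Suc d)))"
| "code (HashTimes a b) d = Seq (code a d) (Seq (code b (Suc d)) (Op Mul d d (Suc d)))"
| "code (Shift a b) d = Seq (code a d) (Seq (code b (Suc d)) (Op Shr d d (Suc d)))"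
| "code (Less a b) d = Seq (code a d) (Seq (code b (Suc d)) (Op Lt d d (Suc d)))"
| "code (Equal a b) d = Seq (code a d) (Seq (code b (Suc d)) (Op Eq d d (Suc d)))"
| "code (Fetch a) d = Seq (code a d) (Load d d)"

section \<open>Correctness and cost of compiled expressions\<close>

definition computes :: "nat \<Rightarrow> com \<Rightarrow> nat \<Rightarrow> state \<Rightarrow> nat \<Rightarrow> nat \<Rightarrow> bool" where
  "computes w c d s t v \<longleftrightarrow> (\<exists>s'. exec w c s t s' \<and> mem s' = mem s \<and> inp s' = inp s \<and>
     (\<forall>x<d. regs s' x = regs s x) \<and> regs s' d = v)"

lemma computes_binary:
  assumes a: "computes w ca d s ta va"
    and b: "\<And>s'. mem s' = mem s \<Longrightarrow> \<forall>x<d. regs s' x = regs s x \<Longrightarrow> computes w cb (Suc d) s' tb vb"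
    and f: "binop_val w f va vb = v"
  shows "computes w (Seq ca (Seq cb (Op f d d (Suc d)))) d s (ta + (tb + 1)) v"
proof -
  obtain s1 where s1: "exec w ca s ta s1" "mem s1 = mem s" "inp s1 = inp s"
    "\<forall>x<d. regs s1 x = regs s x" "regs s1 d = va" using a by (auto simp: computes_def)
  from b[OF s1(2,4)] obtain s2 where s2: "exec w cb s1 tb s2" "mem s2 = mem s1" "inp s2 = inp s1"
    "\<forall>x<Suc d. regs s2 x = regs s1 x" "regs s2 (Suc d) = vb" by (auto simp: computes_def)
  have "exec w (Seq ca (Seq cb (Op f d d (Suc d)))) s (ta + (tb + 1))
    (s2\<lparr>regs := (regs s2)(d := binop_val w f (regs s2 d) (regs s2 (Suc d)))\<rparr>)"
    by (rule exec.Seq[OF s1(1) exec.Seq[OF s2(1) exec.Op]])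
  then show ?thesis unfolding computes_def using s1 s2 f by (intro exI conjI) (assumption, auto)
qed

lemma computes_code:
  assumes "w \<ge> 1" "safe w M V e" "mem s = M" "\<forall>x<100. regs s x = V x" "100 \<le> d"
  shows "computes w (code e d) d s (cost e) (val w M V e)"
  using assms
proof (induction e arbitrary: d s)
  case (Var x)
  have "exec w (Op Or d x x) s 1 (s\<lparr>regs := (regs s)(d := binop_val w Or (regs s x) (regs s x))\<rparr>)"
    by (rule exec.Op)
  with Var show ?case by (auto simp: computes_def)
next
  case (Num k)
  have "exec w (Const d k) s 1 (s\<lparr>regs := (regs s)(d := k mod 2 ^ w)\<rparr>)"
    by (rule exec.Const)
  with Num show ?case by (auto simp: computes_def)
next
  case (Fetch a)
  then have "computes w (code a d) d s (cost a) (val w M V a)" by simp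
  then obtain s1 where s1: "exec w (code a d) s (cost a) s1" "mem s1 = mem s" "inp s1 = inp s"
    "\<forall>x<d. regs s1 x = regs s x" "regs s1 d = val w M V a" by (auto simp: computes_def)
  have "exec w (code (Fetch a) d) s (cost a + 1) (s1\<lparr>regs := (regs s1)(d := mem s1 ! regs s1 d)\<rparr>)"
    using exec.Seq[OF s1(1) exec.Load[of s1 d w d]] s1 Fetch.prems by simp
  with s1 Fetch.prems show ?case by (auto simp: computes_def)
next
  case (Plus a b)
  then show ?case unfolding code.simps cost.simps
    by (intro computes_binary[where va = "val w M V a" and vb = "val w M V b"]) auto
next
  case (Minus a b)
  then show ?case unfolding code.simps cost.simps
    by (intro computes_binary[where va = "val w M V a" and vb = "val w M V b"]) (auto simp: le_mod_geq)
next
  case (Times a b)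
  then show ?case unfolding code.simps cost.simps
    by (intro computes_binary[where va = "val w M V a" and vb = "val w M V b"]) auto
next
  case (HashTimes a b)
  then show ?case unfolding code.simps cost.simps
    by (intro computes_binary[where va = "val w M V a" and vb = "val w M V b"]) auto
next
  case (Shift a b)
  then show ?case unfolding code.simps cost.simps
    by (intro computes_binary[where va = "val w M V a" and vb = "val w M V b"]) auto
next
  case (Less a b)
  then show ?case unfolding code.simps cost.simps
    by (intro computes_binary[where va = "val w M V a" and vb = "val w M V b"]) auto
next
  case (Equal a b)
  then show ?case unfolding code.simps cost.simps
    by (intro computes_binary[where va = "val w M V a" and vb = "val w M V b"]) auto
qed

text \<open>There is no move instruction; the bitwise \<open>Or\<close> of a register with itself
  copies it.\<close>

definition assign :: "nat \<Rightarrow> expr \<Rightarrow> com" where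
  "assign x e = Seq (code e 100) (Op Or x 100 100)"

definition ifc :: "expr \<Rightarrow> com \<Rightarrow> com \<Rightarrow> com" where
  "ifc e c1 c2 = Seq (code e 100) (If 100 c1 c2)"

definition whilec :: "expr \<Rightarrow> com \<Rightarrow> com" where
  "whilec e c = Seq (code e 100) (While 100 (Seq c (code e 100)))"

section \<open>A program logic with time bounds\<close>

abbreviation holds :: "nat list \<Rightarrow> (nat \<Rightarrow> nat) \<Rightarrow> nat list \<Rightarrow> state \<Rightarrow> bool" where
  "holds M V xs s \<equiv> mem s = M \<and> inp s = xs \<and> (\<forall>x<100. regs s x = V x)"

abbreviation reaches :: "nat \<Rightarrow> nat list \<Rightarrow> com \<Rightarrow> state \<Rightarrow> nat \<Rightarrow>
    ((nat \<Rightarrow> nat) \<Rightarrow> nat list \<Rightarrow> bool) \<Rightarrow> bool" where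
  "reaches w M c s t Q \<equiv> \<exists>t' s' V'. exec w c s t' s' \<and> t' \<le> t \<and> mem s' = M \<and>
     (\<forall>x<100. regs s' x = V' x) \<and> Q V' (inp s')"

text \<open>Total correctness with a time bound. The memory is the same \<open>M\<close> before and
  after, which is how the queries are shown to leave the structure alone; \<open>V\<close> stands
  for the registers below 100 only, the others being scratch space.\<close>

definition wp :: "nat \<Rightarrow> nat list \<Rightarrow> com \<Rightarrow> nat \<Rightarrow> (nat \<Rightarrow> nat) \<Rightarrow> nat list \<Rightarrow>
    ((nat \<Rightarrow> nat) \<Rightarrow> nat list \<Rightarrow> bool) \<Rightarrow> bool" where
  "wp w M c t V xs Q \<longleftrightarrow> (\<forall>s. holds M V xs s \<longrightarrow> reaches w M c s t Q)"

lemma wp_mono: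
  assumes "wp w M c t V xs Q" "t \<le> t'" "\<And>V xs. Q V xs \<Longrightarrow> Q' V xs"
  shows "wp w M c t' V xs Q'"
  unfolding wp_def
proof (intro allI impI)
  fix s :: state assume "holds M V xs s"
  then obtain t1 s' V' where "exec w c s t1 s'" "t1 \<le> t" "mem s' = M"
        "\<forall>x<100. regs s' x = V' x" "Q V' (inp s')" using assms(1) unfolding wp_def by blast
  then show "reaches w M c s t' Q'" using assms(2,3)
    by (intro exI[of _ t1] exI[of _ s'] exI[of _ V']) auto
qed

lemma wp_skip:
  assumes "Q V xs"
  shows "wp w M Skip 1 V xs Q"
  unfolding wp_def using exec.Skip assms by blast

lemma wp_seq:
  assumes "wp w M c1 t1 V xs (\<lambda>V' xs'. wp w M c2 t2 V' xs' Q)"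
  shows "wp w M (Seq c1 c2) (t1 + t2) V xs Q"
  unfolding wp_def
proof (intro allI impI)
  fix s :: state assume s: "holds M V xs s"
  then obtain t1' s' V' where 1: "exec w c1 s t1' s'" "t1' \<le> t1" "mem s' = M"
        "\<forall>x<100. regs s' x = V' x" "wp w M c2 t2 V' (inp s') Q" using assms unfolding wp_def[of _ _ c1] by blast
  then obtain t2' s'' V'' where 2: "exec w c2 s' t2' s''" "t2' \<le> t2" "mem s'' = M"
        "\<forall>x<100. regs s'' x = V'' x" "Q V'' (inp s'')" unfolding wp_def by blast
  show "reaches w M (Seq c1 c2) s (t1 + t2) Q"
    using exec.Seq[OF 1(1) 2(1)] 1(2) 2
    by (intro exI[of _ "t1' + t2'"] exI[of _ s''] exI[of _ V'']) auto
qed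

lemma wp_assign:
  assumes "w \<ge> 1" "safe w M V e" "x < 100" "Q (V(x := val w M V e)) xs"
  shows "wp w M (assign x e) (cost e + 1) V xs Q"
  unfolding wp_def
proof (intro allI impI)
  fix s :: state assume s: "holds M V xs s"
  then have "computes w (code e 100) 100 s (cost e) (val w M V e)"
    using assms by (intro computes_code) auto
  then obtain s' where s': "exec w (code e 100) s (cost e) s'" "mem s' = mem s" "inp s' = inp s"
     "\<forall>x<100. regs s' x = regs s x" "regs s' 100 = val w M V e" by (auto simp: computes_def)
  let ?s = "s'\<lparr>regs := (regs s')(x := binop_val w Or (regs s' 100) (regs s' 100))\<rparr>"
  have "exec w (assign x e) s (cost e + 1) ?s"
    unfolding assign_def by (rule exec.Seq[OF s'(1) exec.Op])
  moreover have "\<forall>y<100. regs ?s y = (V(x := val w M V e)) y" using s s' by auto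
  moreover have "mem ?s = M" "inp ?s = xs" using s s' by auto
  ultimately show "reaches w M (assign x e) s (cost e + 1) Q" using assms(4) by (metis order_refl)
qed

lemma wp_ifc:
  assumes "w \<ge> 1" "safe w M V e"
    and "val w M V e \<noteq> 0 \<Longrightarrow> wp w M c1 t V xs Q"
    and "val w M V e = 0 \<Longrightarrow> wp w M c2 t V xs Q"
  shows "wp w M (ifc e c1 c2) (cost e + (t + 1)) V xs Q"
  unfolding wp_def
proof (intro allI impI)
  fix s :: state assume s: "holds M V xs s"
  then have "computes w (code e 100) 100 s (cost e) (val w M V e)"
    using assms by (intro computes_code) auto
  then obtain s1 where s1: "exec w (code e 100) s (cost e) s1" "mem s1 = mem s" "inp s1 = inp s"
     "\<forall>x<100. regs s1 x = regs s x" "regs s1 100 = val w M V e" by (auto simp: computes_def)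
  then have s1': "holds M V xs s1" using s by auto
  show "reaches w M (ifc e c1 c2) s (cost e + (t + 1)) Q"
  proof (cases "val w M V e = 0")
    case False
    from assms(3)[OF this] s1' obtain t' s' V' where x: "exec w c1 s1 t' s'" "t' \<le> t" "mem s' = M"
        "\<forall>x<100. regs s' x = V' x" "Q V' (inp s')" unfolding wp_def by blast
    have "exec w (ifc e c1 c2) s (cost e + (t' + 1)) s'"
      unfolding ifc_def by (rule exec.Seq[OF s1(1) exec.If_True[OF _ x(1)]]) (use False s1(5) in simp)
    with x show ?thesis by (intro exI[of _ "cost e + (t' + 1)"] exI[of _ s'] exI[of _ V']) auto
  next
    case True
    from assms(4)[OF this] s1' obtain t' s' V' where x: "exec w c2 s1 t' s'" "t' \<le> t" "mem s' = M"
        "\<forall>x<100. regs s' x = V' x" "Q V' (inp s')" unfolding wp_def by blast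
    have "exec w (ifc e c1 c2) s (cost e + (t' + 1)) s'"
      unfolding ifc_def by (rule exec.Seq[OF s1(1) exec.If_False[OF _ x(1)]]) (use True s1(5) in simp)
    with x show ?thesis by (intro exI[of _ "cost e + (t' + 1)"] exI[of _ s'] exI[of _ V']) auto
  qed
qed

lemma wp_read:
  assumes "w \<ge> 1" "x < 100" "f < 100" "x \<noteq> f"
    and "xs = [] \<Longrightarrow> Q (V(f := 0)) []"
    and "\<And>a as. xs = a # as \<Longrightarrow> Q (V(x := a, f := 1)) as"
  shows "wp w M (Read x f) 1 V xs Q"
  unfolding wp_def
proof (intro allI impI)
  fix s :: state assume s: "holds M V xs s"
  show "reaches w M (Read x f) s 1 Q"
  proof (cases xs)
    case Nil
    let ?s = "s\<lparr>regs := (regs s)(f := 0)\<rparr>"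
    have "exec w (Read x f) s 1 ?s" using s Nil by (intro exec.Read_Nil) auto
    moreover have "mem ?s = M" "inp ?s = []" "\<forall>y<100. regs ?s y = (V(f := 0)) y" using s Nil by auto
    ultimately show ?thesis using assms(5)[OF Nil] by (metis order_refl)
  next
    case (Cons a as)
    let ?s = "s\<lparr>regs := (regs s)(x := a, f := 1 mod 2 ^ w), inp := as\<rparr>"
    have "exec w (Read x f) s 1 ?s" using s Cons by (intro exec.Read_Cons) auto
    moreover have "mem ?s = M" "inp ?s = as" "\<forall>y<100. regs ?s y = (V(x := a, f := 1)) y"
      using s assms(1) by auto
    ultimately show ?thesis using assms(6)[OF Cons] by (metis order_refl)
  qed
qed

text \<open>The index of the invariant is the exact number of rounds still to come. It serves both
  as termination measure and as factor in the time bound; at index 0 the guard must fail.\<close>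

lemma wp_whilec:
  assumes w: "w \<ge> 1" and I: "I n V xs"
    and step: "\<And>k V xs. I (Suc k) V xs \<Longrightarrow>
      safe w M V e \<and> val w M V e \<noteq> 0 \<and> wp w M c t V xs (I k)"
    and stop: "\<And>V xs. I 0 V xs \<Longrightarrow> safe w M V e \<and> val w M V e = 0 \<and> Q V xs"
  shows "wp w M (whilec e c) (n * (cost e + t + 1) + (cost e + 1)) V xs Q"
proof -
  have loop: "reaches w M (While 100 (Seq c (code e 100))) s (n * (cost e + t + 1) + 1) Q"
    if "I n V (inp s)" "mem s = M" "\<forall>x<100. regs s x = V x" "regs s 100 = val w M V e" for n V and s :: state
    using that
  proof (induction n arbitrary: V s)
    case 0
    then have "exec w (While 100 (Seq c (code e 100))) s 1 s"
      using stop by (intro exec.While_False) auto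
    with 0 stop show ?case by (metis add.commute le_add1)
  next
    case (Suc n)
    note st = step[OF Suc.prems(1)]
    then obtain t1 s1 V1 where s1: "exec w c s t1 s1" "t1 \<le> t" "mem s1 = M"
      "\<forall>x<100. regs s1 x = V1 x" "I n V1 (inp s1)"
      unfolding wp_def using Suc.prems by blast
    have "safe w M V1 e" using s1(5) step stop by (cases n) auto
    then have "computes w (code e 100) 100 s1 (cost e) (val w M V1 e)"
      using w s1 by (intro computes_code) auto
    then obtain s2 where s2: "exec w (code e 100) s1 (cost e) s2" "mem s2 = mem s1" "inp s2 = inp s1"
     "\<forall>x<100. regs s2 x = regs s1 x" "regs s2 100 = val w M V1 e" by (auto simp: computes_def)
    then have "reaches w M (While 100 (Seq c (code e 100))) s2 (n * (cost e + t + 1) + 1) Q"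
      using s1 by (intro Suc.IH[of V1]) auto
    then obtain t3 s3 V3 where s3: "exec w (While 100 (Seq c (code e 100))) s2 t3 s3"
      "t3 \<le> n * (cost e + t + 1) + 1" "mem s3 = M" "\<forall>x<100. regs s3 x = V3 x" "Q V3 (inp s3)"
      by blast
    have "exec w (While 100 (Seq c (code e 100))) s ((t1 + cost e) + t3 + 1) s3"
      using st Suc.prems(4) by (intro exec.While_True[OF _ exec.Seq[OF s1(1) s2(1)] s3(1)]) simp
    moreover have "(t1 + cost e) + t3 + 1 \<le> Suc n * (cost e + t + 1) + 1"
      using s1(2) s3(2) by simp
    ultimately show ?case using s3 by blast
  qed
  show ?thesis
    unfolding wp_def
  proof (intro allI impI)
    fix s :: state assume s: "holds M V xs s"
    have "safe w M V e" using I step stop by (cases n) auto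
    then have "computes w (code e 100) 100 s (cost e) (val w M V e)"
      using w s by (intro computes_code) auto
    then obtain s1 where s1: "exec w (code e 100) s (cost e) s1" "mem s1 = mem s" "inp s1 = inp s"
      "\<forall>x<100. regs s1 x = regs s x" "regs s1 100 = val w M V e" by (auto simp: computes_def)
    from loop[of n V s1] obtain t2 s2 V2 where s2: "exec w (While 100 (Seq c (code e 100))) s1 t2 s2"
      "t2 \<le> n * (cost e + t + 1) + 1" "mem s2 = M" "\<forall>x<100. regs s2 x = V2 x" "Q V2 (inp s2)"
      using s s1 I by auto
    have "exec w (whilec e c) s (cost e + t2) s2"
      unfolding whilec_def by (rule exec.Seq[OF s1(1) s2(1)])
    moreover have "cost e + t2 \<le> n * (cost e + t + 1) + (cost e + 1)" using s2(2) by simp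
    ultimately show "reaches w M (whilec e c) s (n * (cost e + t + 1) + (cost e + 1)) Q" using s2 by blast
  qed
qed

text \<open>The first \<open>T\<close> words are a directory of base addresses, and offsets inside a
  dictionary are relative to its base, so that dictionaries can be built independently and then
  concatenated.\<close>

definition stores :: "nat \<Rightarrow> nat list \<Rightarrow> nat \<Rightarrow> (nat \<Rightarrow> nat \<Rightarrow> nat) \<Rightarrow> bool" where
  "stores w M T F \<longleftrightarrow> words w M \<and> length M < 2 ^ w \<and> T \<le> length M \<and>
     (\<forall>t<T. \<exists>L. dictionary w (F t) L \<and> M ! t + length L \<le> length M \<and>
        (\<forall>k<length L. M ! (M ! t + k) = L ! k))"

definition bucket_expr :: "nat \<Rightarrow> expr \<Rightarrow> expr" where
  "bucket_expr t e = (let b = Fetch (Num t) in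
     Plus b (Plus (Num 2) (Times (Num 3) (Shift (HashTimes (Fetch b) e) (Fetch (Plus b (Num 1)))))))"

definition slot_expr :: "nat \<Rightarrow> expr \<Rightarrow> expr" where
  "slot_expr t e = (let i = bucket_expr t e in
     Plus (Fetch (Num t)) (Plus (Fetch (Plus i (Num 2)))
       (Times (Num 2) (Shift (HashTimes (Fetch i) e) (Fetch (Plus i (Num 1)))))))"

text \<open>The product with the outcome of the key comparison replaces the conditional in
  \<open>dictionary\<close>: a key that is not found yields 0 without a branch.\<close>

definition look :: "nat \<Rightarrow> expr \<Rightarrow> expr" where
  "look t e = (let p = slot_expr t e in Times (Equal (Fetch p) e) (Fetch (Plus p (Num 1))))"

lemma look:
  assumes st: "stores w M T F" and t: "t < T" and e: "safe w M V e" "val w M V e < 2 ^ w"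
  shows "safe w M V (look t e)" "val w M V (look t e) = F t (val w M V e)"
proof -
  define b q where "b = M ! t" and "q = val w M V e"
  obtain L where L: "dictionary w (F t) L" "b + length L \<le> length M"
    "\<And>k. k < length L \<Longrightarrow> M ! (b + k) = L ! k" using st t unfolding stores_def b_def by blast
  have len: "length M < 2 ^ w" "words w M" "t < length M" using st t by (auto simp: stores_def)
  have d: "2 \<le> length L" "bucket_pos w L q + 2 < length L" "slot_pos w L q + 1 < length L"
    "F t q = (if L ! slot_pos w L q = q then L ! (slot_pos w L q + 1) else 0)"
    using L(1) e(2) by (auto simp: dictionary_def q_def)
  have b: "safe w M V (Fetch (Num t))" "val w M V (Fetch (Num t)) = b"
    using len by (auto simp: b_def)
  \<comment> \<open>The sums formed while computing addresses are bounded by addresses in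
    \<open>M\<close>, which fit in a word; this excludes overflow.\<close>
  have lt: "x < 2 ^ w" if "x \<le> length M" for x using that len by simp
  have "0 < length L" "1 < length L" using d(1) by auto
  from this[THEN L(3)] have M0: "M ! b = L ! 0" "M ! (b + 1) = L ! 1" by simp_all
  have bp: "bucket_pos w L q = 2 + 3 * (L ! 0 * q mod 2 ^ w div 2 ^ (L ! 1))"
    by (simp add: bucket_pos_def ms_def)
  define x where "x = L ! 0 * q mod 2 ^ w div 2 ^ (L ! 1)"
  have x: "safe w M V (Shift (HashTimes (Fetch (Fetch (Num t))) e) (Fetch (Plus (Fetch (Num t)) (Num 1))))"
    "val w M V (Shift (HashTimes (Fetch (Fetch (Num t))) e) (Fetch (Plus (Fetch (Num t)) (Num 1)))) = x"
    using e(1) b d(1) L(2) M0 lt[of "b + 1"] lt[of 1] by (auto simp: x_def simp flip: q_def)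
  have bx: "bucket_pos w L q = 2 + 3 * x" by (simp add: bp x_def)
  have i: "safe w M V (bucket_expr t e)" "val w M V (bucket_expr t e) = b + bucket_pos w L q"
  proof -
    have "b + (2 + 3 * x) \<le> length M" using d(2) L(2) by (simp add: bx)
    then have "b + (2 + 3 * x) < 2 ^ w" "2 + 3 * x < 2 ^ w" "3 * x < 2 ^ w" by (auto intro!: lt)
    moreover have "(3::nat) < 2 ^ w" using d(2) L(2) by (intro lt) (simp add: bx)
    ultimately show "safe w M V (bucket_expr t e)" "val w M V (bucket_expr t e) = b + bucket_pos w L q"
      using x b unfolding bucket_expr_def Let_def bx
      by (simp_all del: val.simps(7) safe.simps(7))
  qed
  have M1: "M ! (b + bucket_pos w L q) = L ! bucket_pos w L q"
    "M ! (b + bucket_pos w L q + 1) = L ! (bucket_pos w L q + 1)"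
    "M ! (b + bucket_pos w L q + 2) = L ! (bucket_pos w L q + 2)"
    using L(3)[of "bucket_pos w L q"] L(3)[of "bucket_pos w L q + 1"]
      L(3)[of "bucket_pos w L q + 2"] d(2) by (auto simp: add.assoc)
  have sp: "slot_pos w L q = L ! (bucket_pos w L q + 2) +
      2 * (L ! bucket_pos w L q * q mod 2 ^ w div 2 ^ (L ! (bucket_pos w L q + 1)))"
    by (simp add: slot_pos_def ms_def Let_def)
  define j where "j = bucket_pos w L q"
  define y where "y = L ! j * q mod 2 ^ w div 2 ^ (L ! (j + 1))"
  have y: "safe w M V (Shift (HashTimes (Fetch (bucket_expr t e)) e) (Fetch (Plus (bucket_expr t e) (Num 1))))"
    "val w M V (Shift (HashTimes (Fetch (bucket_expr t e)) e) (Fetch (Plus (bucket_expr t e) (Num 1)))) = y"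
    using e(1) i M1 d(2) L(2) lt[of "b + j + 1"] lt[of 1]
    by (auto simp: y_def simp flip: q_def j_def)
  have sy: "slot_pos w L q = L ! (j + 2) + 2 * y" by (simp add: sp y_def j_def)
  have f: "safe w M V (Fetch (Plus (bucket_expr t e) (Num 2)))"
    "val w M V (Fetch (Plus (bucket_expr t e) (Num 2))) = L ! (j + 2)"
    using i M1 d(2) L(2) lt[of "b + j + 2"] lt[of 2] by (auto simp: j_def)
  have p: "safe w M V (slot_expr t e)" "val w M V (slot_expr t e) = b + slot_pos w L q"
  proof -
    have "b + (L ! (j + 2) + 2 * y) \<le> length M" using d(3) L(2) by (simp add: sy)
    then have "b + (L ! (j + 2) + 2 * y) < 2 ^ w" "L ! (j + 2) + 2 * y < 2 ^ w" "2 * y < 2 ^ w"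
      by (auto intro!: lt)
    moreover have "(2::nat) < 2 ^ w" using d(2) L(2) by (intro lt) (simp add: bx)
    ultimately show "safe w M V (slot_expr t e)" "val w M V (slot_expr t e) = b + slot_pos w L q"
      using y f b unfolding slot_expr_def Let_def sy
      by (simp_all del: val.simps(7,10) safe.simps(7,10))
  qed
  have M2: "M ! (b + slot_pos w L q) = L ! slot_pos w L q"
    "M ! (b + slot_pos w L q + 1) = L ! (slot_pos w L q + 1)"
    using L(3)[of "slot_pos w L q"] L(3)[of "slot_pos w L q + 1"] d(3) by (auto simp: add.assoc)
  have "M ! (b + slot_pos w L q + 1) < 2 ^ w" using len(2) d(3) L(2) by (auto simp: words_def)
  with M2 have le: "L ! (slot_pos w L q + 1) < 2 ^ w" by simp
  have g: "safe w M V (Fetch (slot_expr t e))" "val w M V (Fetch (slot_expr t e)) = L ! slot_pos w L q"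
    using p M2(1) d(3) L(2) by auto
  have h: "safe w M V (Fetch (Plus (slot_expr t e) (Num 1)))"
    "val w M V (Fetch (Plus (slot_expr t e) (Num 1))) = L ! (slot_pos w L q + 1)"
    using p M2(2) d(3) L(2) lt[of "b + slot_pos w L q + 1"] lt[of 1] by auto
  show "safe w M V (look t e)" "val w M V (look t e) = F t (val w M V e)"
    using e(1) g h le unfolding q_def[symmetric] d(4) look_def Let_def
    by (simp_all del: val.simps(10) safe.simps(10) flip: q_def)
qed

lemma stores_exists:
  fixes F :: "nat \<Rightarrow> nat \<Rightarrow> nat"
  assumes F: "\<And>t. t < T \<Longrightarrow> finite {q. F t q \<noteq> 0}" "\<And>t. t < T \<Longrightarrow> {q. F t q \<noteq> 0} \<subseteq> {..<2 ^ w}"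
      "\<And>t q. t < T \<Longrightarrow> F t q < 2 ^ w"
    and m: "\<And>t. t < T \<Longrightarrow> card {q. F t q \<noteq> 0} \<le> m" and w: "100 * (m + 1)\<^sup>2 < 2 ^ w"
    and w': "T * (100 * (m + 1) + 1) < 2 ^ w"
  obtains M where "stores w M T F" "length M \<le> T * (100 * (m + 1) + 1)"
proof -
  have "\<exists>L. dictionary w (F t) L \<and> words w L \<and> length L \<le> 100 * (m + 1)" if "t < T" for t
    using dictionary_exists[OF F(1,2,3) m w] that by metis
  then obtain L where L: "\<And>t. t < T \<Longrightarrow> dictionary w (F t) (L t)" "\<And>t. t < T \<Longrightarrow> words w (L t)"
    "\<And>t. t < T \<Longrightarrow> length (L t) \<le> 100 * (m + 1)" by metis
  define Z where "Z = concat (map L [0..<T])"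
  define off where "off = (\<lambda>t. length (concat (map L [0..<t])))"
  define M where "M = map (\<lambda>t. T + off t) [0..<T] @ Z"
  have "length Z = (\<Sum>t<T. length (L t))"
    by (simp add: Z_def length_concat comp_def sum_list_distinct_conv_sum_set atLeast0LessThan)
  also have "\<dots> \<le> (\<Sum>t<T. 100 * (m + 1))" by (intro sum_mono L(3)) simp
  finally have len: "length M \<le> T * (100 * (m + 1) + 1)" by (simp add: M_def algebra_simps)
  have off: "T + off t + length (L t) \<le> length M" if "t < T" for t
    using concat_blocks(1)[OF that, of L] by (simp add: M_def Z_def off_def)
  have "stores w M T F"
    unfolding stores_def
  proof (intro conjI allI impI)
    show "length M < 2 ^ w" using len w' by (rule le_less_trans)
    show "T \<le> length M" by (simp add: M_def)
    have "T + off t < 2 ^ w" if "t < T" for t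
      using off[OF that] len w' by (meson add_leD1 le_less_trans)
    then show "words w M" using L(2) by (auto simp: words_def M_def Z_def)
  next
    fix t assume t: "t < T"
    have "M ! t = T + off t" using t by (simp add: M_def nth_append)
    moreover have "M ! (T + off t + k) = L t ! k" if "k < length (L t)" for k
      using concat_blocks(2)[OF t, of k L] that by (simp add: M_def nth_append Z_def off_def)
    ultimately show "\<exists>L. dictionary w (F t) L \<and> M ! t + length L \<le> length M \<and>
        (\<forall>k<length L. M ! (M ! t + k) = L ! k)"
      using L(1)[OF t] off[OF t] by (intro exI[of _ "L t"]) auto
  qed
  with len that show ?thesis by blast
qed

section \<open>Predecessor search\<close>

locale machine =
  fixes w :: nat and M :: "nat list" and F :: "nat \<Rightarrow> nat \<Rightarrow> nat"
  assumes w: "w \<ge> 1" and stores: "stores w M 11 F"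
begin

abbreviation "ev \<equiv> val w M"
abbreviation "ok \<equiv> safe w M"

lemma look_ok [simp]: "t < 11 \<Longrightarrow> ok V e \<Longrightarrow> ev V e < 2 ^ w \<Longrightarrow> ok V (look t e)"
  and look_ev [simp]: "t < 11 \<Longrightarrow> ok V e \<Longrightarrow> ev V e < 2 ^ w \<Longrightarrow> ev V (look t e) = F t (ev V e)"
  using look[OF stores] by blast+

end

text \<open>Dictionary 1 holds the parameters; its entry 0 is the initial step of binary searches.\<close>

definition search :: "expr \<Rightarrow> com" where
  "search e = Seq (assign 10 (Num 0)) (Seq (assign 11 (look 1 (Num 0)))
     (whilec (Var 11) (Seq (ifc e (assign 10 (Plus (Var 10) (Var 11))) Skip)
        (assign 11 (Shift (Var 11) (Num 1))))))"

definition search_time :: "expr \<Rightarrow> nat \<Rightarrow> nat" where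
  "search_time e k = (k + 2) * (cost e + cost (look 1 (Num 0)) + 20)"

context machine begin

text \<open>The answer is built bit by bit from the top: register 10 holds the part accepted so far,
  register 11 the power of two tried next, ending at 0. The test has to be downward closed on
  positive arguments; nothing is assumed about \<open>test 0\<close>, so 0 is the answer if all
  tests fail.\<close>

lemma wp_search:
  assumes step: "F 1 0 = 2 ^ k" and k: "(2::nat) ^ (k + 1) < 2 ^ w"
    and e: "\<And>p s. p + s < 2 ^ (k + 1) \<Longrightarrow> s \<ge> 1 \<Longrightarrow>
      ok (V(10 := p, 11 := s)) e \<and> (ev (V(10 := p, 11 := s)) e \<noteq> 0 \<longleftrightarrow> test (p + s))"
    and mono: "\<And>d d'. test d \<Longrightarrow> 1 \<le> d' \<Longrightarrow> d' \<le> d \<Longrightarrow> d < 2 ^ (k + 1) \<Longrightarrow> test d'"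
    and Q: "\<And>p. p < 2 ^ (k + 1) \<Longrightarrow> p = 0 \<or> test p \<Longrightarrow> (\<And>d. p < d \<Longrightarrow> d < 2 ^ (k + 1) \<Longrightarrow> \<not> test d) \<Longrightarrow>
      Q (V(10 := p, 11 := 0)) xs"
  shows "wp w M (search e) (search_time e k) V xs Q"
proof -
  let ?halve = "assign 11 (Shift (Var 11) (Num 1))" and ?th = "cost (Shift (Var 11) (Num 1)) + 1"
    and ?inc = "assign 10 (Plus (Var 10) (Var 11))" and ?ti = "cost (Plus (Var 10) (Var 11)) + 1"
  let ?body = "Seq (ifc e ?inc Skip) ?halve" and ?tb = "(cost e + (?ti + 1)) + ?th"
  let ?loop = "whilec (Var 11) ?body" and ?tl = "(k + 1) * (cost (Var 11) + ?tb + 1) + (cost (Var 11) + 1)"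
  define I where "I = (\<lambda>(j::nat) V' xs'. xs' = xs \<and> (\<exists>p. V' = V(10 := p, 11 := (if j = 0 then 0 else 2 ^ (j - 1))) \<and>
     p + 2 ^ j \<le> 2 ^ (k + 1) \<and> (p = 0 \<or> test p) \<and> (\<forall>d. p + 2 ^ j \<le> d \<and> d < 2 ^ (k + 1) \<longrightarrow> \<not> test d)))"
  have loop: "wp w M ?loop (?tl)
        (V(10 := 0, 11 := 2 ^ k)) xs Q"
  proof (rule wp_whilec[OF w, where I = I])
    show "I (k + 1) (V(10 := 0, 11 := 2 ^ k)) xs" by (auto simp: I_def)
  next
    fix j V1 xs1 assume "I (Suc j) V1 xs1"
    then obtain p where p: "xs1 = xs" "V1 = V(10 := p, 11 := 2 ^ j)" "p + 2 * 2 ^ j \<le> 2 ^ (k + 1)"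
      "p = 0 \<or> test p" "\<And>d. p + 2 * 2 ^ j \<le> d \<Longrightarrow> d < 2 ^ (k + 1) \<Longrightarrow> \<not> test d"
      unfolding I_def by auto
    have pos: "(1::nat) \<le> 2 ^ j" by simp
    then have pj: "p + 2 ^ j < 2 ^ (k + 1)" using p(3) by linarith
    have ee: "ok V1 e" "ev V1 e \<noteq> 0 \<longleftrightarrow> test (p + 2 ^ j)" using e[OF pj pos] p(2) by auto
    have last: "wp w M ?halve ?th (V(10 := p', 11 := 2 ^ j)) xs (I j)"
      if "p' + 2 ^ j \<le> 2 ^ (k + 1)" "p' = 0 \<or> test p'" "\<And>d. p' + 2 ^ j \<le> d \<Longrightarrow> d < 2 ^ (k + 1) \<Longrightarrow> \<not> test d" for p'
    proof (rule wp_assign[OF w])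
      show "ok (V(10 := p', 11 := 2 ^ j)) (Shift (Var 11) (Num 1))"
        using w power_increasing[of 1 w "2::nat"] by simp
      have "ev (V(10 := p', 11 := 2 ^ j)) (Shift (Var 11) (Num 1)) = (if j = 0 then 0 else 2 ^ (j - 1))"
        by (cases j) auto
      then show "I j ((V(10 := p', 11 := 2 ^ j))(11 := ev (V(10 := p', 11 := 2 ^ j)) (Shift (Var 11) (Num 1)))) xs"
        unfolding I_def using that by auto
    qed simp
    have "wp w M ?body
       ?tb V1 xs1 (I j)"
      unfolding p(1)
    proof (intro wp_seq wp_ifc w ee(1))
      assume "ev V1 e \<noteq> 0"
      then have t: "test (p + 2 ^ j)" using ee(2) by simp
      show "wp w M ?inc ?ti V1 xs
        (\<lambda>V' xs'. wp w M ?halve ?th V' xs' (I j))"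
      proof (rule wp_assign[OF w])
        show "ok V1 (Plus (Var 10) (Var 11))" using pj k by (simp add: p(2))
        have "V1(10 := ev V1 (Plus (Var 10) (Var 11))) = V(10 := p + 2 ^ j, 11 := 2 ^ j)"
          by (auto simp: p(2))
        then show "wp w M ?halve ?th
            (V1(10 := ev V1 (Plus (Var 10) (Var 11)))) xs (I j)"
          using last[of "p + 2 ^ j"] p(3,5) t by simp
      qed simp
    next
      assume "ev V1 e = 0"
      then have t: "\<not> test (p + 2 ^ j)" using ee(2) by simp
      have "\<not> test d" if "p + 2 ^ j \<le> d" "d < 2 ^ (k + 1)" for d
        using mono[of d "p + 2 ^ j"] t that pos by auto
      with p(4) pj have "wp w M ?halve ?th V1 xs (I j)"
        unfolding p(2) by (intro last) auto
      then show "wp w M Skip ?ti V1 xs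
        (\<lambda>V' xs'. wp w M ?halve ?th V' xs' (I j))"
        by (intro wp_mono[OF wp_skip]) auto
    qed
    then show "ok V1 (Var 11) \<and> ev V1 (Var 11) \<noteq> 0 \<and>
      wp w M ?body
       ?tb V1 xs1 (I j)"
      by (simp add: p(2))
  next
    fix V1 xs1 assume "I 0 V1 xs1"
    then obtain p where p: "xs1 = xs" "V1 = V(10 := p, 11 := 0)" "p + 1 \<le> 2 ^ (k + 1)"
      "p = 0 \<or> test p" "\<And>d. p + 1 \<le> d \<Longrightarrow> d < 2 ^ (k + 1) \<Longrightarrow> \<not> test d"
      unfolding I_def by auto
    then show "ok V1 (Var 11) \<and> ev V1 (Var 11) = 0 \<and> Q V1 xs1" using Q[of p] by auto
  qed
  have "wp w M (search e) ((cost (Num 0) + 1) + ((cost (look 1 (Num 0)) + 1) + ?tl)) V xs Q"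
    unfolding search_def
  proof (rule wp_seq, rule wp_assign[OF w], simp, simp, rule wp_seq, rule wp_assign[OF w])
    show "wp w M ?loop (?tl)
        (V(10 := ev V (Num 0), 11 := ev (V(10 := ev V (Num 0))) (look 1 (Num 0)))) xs Q"
      using loop step by simp
  qed simp_all
  then show ?thesis by (rule wp_mono) (auto simp: search_time_def algebra_simps)
qed

end

text \<open>Register 12 holds the query \<open>q\<close>, but the prefix is taken of
  \<open>q + 1\<close>: the representatives below \<open>q + 1\<close> are those that are at most
  \<open>q\<close>. Entry 1 of the parameters is \<open>2 ^ u\<close>.\<close>

definition trie_key :: "expr \<Rightarrow> expr" where
  "trie_key h = Plus (Times h (look 1 (Num 1))) (Shift (Plus (Var 12) (Num 1)) h)"

text \<open>True if the prefix is absent from the trie. Presence is inherited by larger heights, so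
  the search returns the largest height without a matching node (or 0), directly below the lowest
  ancestor that exists.\<close>

definition trie_test :: expr where
  "trie_test = Equal (look 2 (trie_key (Plus (Var 10) (Var 11)))) (Num 0)"

text \<open>Dictionary 4 stores keys plus 1, hence 0 past the last index. The two comparisons say
  that the index is valid and that its key is at most \<open>q\<close>.\<close>

definition bucket_test :: expr where
  "bucket_test = (let a = look 4 (Plus (Var 13) (Plus (Var 10) (Var 11))) in
     Times (Less (Num 0) a) (Less a (Plus (Var 12) (Num 2))))"

definition bucket_start :: expr where
  "bucket_start = Times (look 3 (trie_key (Var 10))) (Plus (look 1 (Num 0)) (look 1 (Num 0)))"

definition found_key :: expr where
  "found_key = Minus (look 4 (Plus (Var 13) (Var 10))) (Num 1)"

definition predecessor :: com where
  "predecessor = Seq (search trie_test) (Seq (assign 13 bucket_start)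
     (Seq (search bucket_test) (assign 14 found_key)))"

definition predecessor_time :: "nat \<Rightarrow> nat" where
  "predecessor_time k = search_time trie_test k + ((cost bucket_start + 1) +
     (search_time bucket_test k + (cost found_key + 1)))"

text \<open>The first keys of all blocks except block 0, which needs none: the number of
  representatives up to the query is then the index of the block to be searched.\<close>

definition reps :: "nat \<Rightarrow> (nat \<Rightarrow> nat) \<Rightarrow> nat \<Rightarrow> nat set" where
  "reps g s m = {s (j * g) | j. 1 \<le> j \<and> j * g < m}"

definition node :: "nat set \<Rightarrow> nat \<Rightarrow> nat \<Rightarrow> bool" where
  "node Y h z \<longleftrightarrow> (\<exists>y\<in>Y. y div 2 ^ h = z)"

text \<open>
  A y-fast trie. The keys \<open>s 0 < \<dots> < s (m - 1)\<close> are cut into blocks of \<open>2 ^ (k + 1) = u + 1\<close> keys.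
  The pair of a height \<open>h\<close> and a prefix \<open>z\<close> is encoded as \<open>h * 2 ^ u + z\<close>.
\<close>

locale predecessor_structure = machine +
  fixes k u m :: nat and s :: "nat \<Rightarrow> nat"
  assumes u: "u + 1 = 2 ^ (k + 1)" and uw: "2 * u + 2 \<le> w"
    and s: "strict_mono_on {..<m} s" and s0: "s 0 = 0" and m0: "m > 0" and mu: "m < 2 ^ u"
    and su: "\<And>i. i < m \<Longrightarrow> s i < 2 ^ u"
    and p0: "F 1 0 = 2 ^ k" and p1: "F 1 1 = 2 ^ u"
    and nodes: "\<And>h z. h \<le> u \<Longrightarrow> z < 2 ^ u \<Longrightarrow> F 2 (h * 2 ^ u + z) = of_bool (node (reps (u + 1) s m) h z)"
    and ranks: "\<And>h z. h \<le> u \<Longrightarrow> z < 2 ^ u \<Longrightarrow> F 3 (h * 2 ^ u + z) =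
       (if node (reps (u + 1) s m) (h + 1) (z div 2) then card {y \<in> reps (u + 1) s m. y div 2 ^ h < z} else 0)"
    and keys: "\<And>i. F 4 i = (if i < m then s i + 1 else 0)"
begin

lemma s_less_iff: "i < m \<Longrightarrow> j < m \<Longrightarrow> s i < s j \<longleftrightarrow> i < j"
  using strict_mono_on_less[OF s] by auto

lemma s_le_iff: "i < m \<Longrightarrow> j < m \<Longrightarrow> s i \<le> s j \<longleftrightarrow> i \<le> j"
  using strict_mono_on_less_eq[OF s] by auto

lemma pow_bounds: "(2::nat) ^ (k + 1) < 2 ^ w" "(4::nat) \<le> 2 ^ w" "u \<ge> 1" "h \<le> u \<Longrightarrow> h < 2 ^ w"
  "h \<le> u \<Longrightarrow> z < 2 ^ u \<Longrightarrow> h * 2 ^ u + z < 2 ^ w" "m + u + 1 < 2 ^ w" "(2::nat) ^ u < 2 ^ w" "h \<le> u \<Longrightarrow> h * 2 ^ u < 2 ^ w"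
proof -
  have lt: "u < 2 ^ u" by (rule less_exp)
  show u1: "u \<ge> 1" using u by (cases u) auto
  have "(2::nat) ^ 2 \<le> 2 ^ w" using uw by (intro power_increasing) auto
  then show "(4::nat) \<le> 2 ^ w" by simp
  have *: "(2::nat) ^ (2 * u + 2) \<le> 2 ^ w" using uw by (intro power_increasing) auto
  have "(2::nat) ^ (u + 2) \<le> 2 ^ w" using uw by (intro power_increasing) auto
  then have 4: "4 * (2::nat) ^ u \<le> 2 ^ w" by simp
  show 1: "(2::nat) ^ u < 2 ^ w" using uw by (intro power_strict_increasing) auto
  show "(2::nat) ^ (k + 1) < 2 ^ w" using lt 4 unfolding u[symmetric] by linarith
  show "m + u + 1 < 2 ^ w" using lt 4 mu by linarith
  show "h \<le> u \<Longrightarrow> h < 2 ^ w" using lt 4 by linarith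
  show kz: "h * 2 ^ u + z < 2 ^ w" if "h \<le> u" "z < 2 ^ u" for z
  proof -
    have "h * 2 ^ u + z < (h + 1) * 2 ^ u" using that by simp
    also have "h + 1 \<le> 2 ^ u" using that lt by linarith
    then have "(h + 1) * 2 ^ u \<le> 2 ^ u * 2 ^ u" by (rule mult_le_mono1)
    also have "\<dots> \<le> 2 ^ (2 * u + 2)" by (simp flip: power_add add: mult_2)
    finally show ?thesis using * by linarith
  qed
  from kz[of 0] show "h \<le> u \<Longrightarrow> h * 2 ^ u < 2 ^ w" by simp
qed

text \<open>If the prefix of \<open>q + 1\<close> at height \<open>p\<close> is missing, no
  representative agrees with \<open>q + 1\<close> there, so comparing prefixes of height
  \<open>p\<close> amounts to comparing the numbers. Hence the rank stored at this child of an
  existing node is the number of representatives up to \<open>q\<close>, which names the block; the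
  second search finds the predecessor inside it.\<close>

lemma wp_predecessor:
  assumes q: "V 12 = q" "q + 1 < 2 ^ u"
    and Q: "\<And>a b c y. y \<in> s ` {..<m} \<Longrightarrow> y \<le> q \<Longrightarrow> (\<And>x. x \<in> s ` {..<m} \<Longrightarrow> x \<le> q \<Longrightarrow> x \<le> y) \<Longrightarrow>
      Q (V(10 := a, 11 := b, 13 := c, 14 := y)) xs"
  shows "wp w M predecessor (predecessor_time k) V xs Q"
proof -
  define g Y where "g = u + 1" and "Y = reps g s m"
  note b = pow_bounds
  have qu: "(q + 1) div 2 ^ h < 2 ^ u" for h
    using q(2) by (meson div_le_dividend le_less_trans)
  have qw: "q + 2 < 2 ^ w" using q(2) b(6) mu b(7) by linarith
  have key: "ok V' (trie_key e)" "ev V' (trie_key e) = ev V' e * 2 ^ u + (q + 1) div 2 ^ ev V' e"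
    if "ok V' e" "ev V' e \<le> u" "V' 12 = q" for V' e
    unfolding trie_key_def using that b(2,7) b(5,8)[OF that(2)] qu[of "ev V' e"] qw
    by (simp_all add: p1[unfolded One_nat_def])
  define test1 where "test1 = (\<lambda>d. \<not> node Y d ((q + 1) div 2 ^ d))"
  define cnt where "cnt = card {y \<in> Y. y < q + 1}"
  have gpos: "g > 0" by (simp add: g_def)
  have rank_ok: "F 3 (p * 2 ^ u + (q + 1) div 2 ^ p) = cnt"
    if p: "p < 2 ^ (k + 1)" "p = 0 \<or> test1 p" "\<And>d. p < d \<Longrightarrow> d < 2 ^ (k + 1) \<Longrightarrow> \<not> test1 d" for p
  proof -
    have pu: "p \<le> u" using p(1) u by simp
    have "{y \<in> Y. y div 2 ^ p < (q + 1) div 2 ^ p} = {y \<in> Y. y < q + 1}"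
    proof (cases "p = 0")
      case False
      then have ne: "y div 2 ^ p \<noteq> (q + 1) div 2 ^ p" if "y \<in> Y" for y
        using p(2) that by (auto simp: test1_def node_def)
      have "y div 2 ^ p < (q + 1) div 2 ^ p \<longleftrightarrow> y < q + 1" if "y \<in> Y" for y
        using ne[OF that] div_le_mono[of y "q + 1" "2 ^ p"] div_le_mono[of "q + 1" y "2 ^ p"] by linarith
      then show ?thesis by blast
    qed simp
    then have c: "card {y \<in> Y. y div 2 ^ p < (q + 1) div 2 ^ p} = cnt" by (simp add: cnt_def)
    show ?thesis
    proof (cases "p = u")
      case True
      \<comment> \<open>At height \<open>u\<close> all prefixes are 0, so a missing one means that
        there are no representatives at all. No node above can vouch for the entry then, and the
        default 0 of the table is the right rank.\<close>
      have "Y = {}"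
      proof (rule ccontr)
        assume "Y \<noteq> {}"
        then obtain y where y: "y \<in> Y" by blast
        then have "y < 2 ^ u" using su by (auto simp: Y_def reps_def)
        moreover have "test1 u" using p(2) True b(3) by auto
        ultimately show False using y q(2) by (auto simp: test1_def node_def)
      qed
      then show ?thesis using ranks[OF pu qu[of p]] by (simp add: node_def cnt_def Y_def g_def)
    next
      case False
      then have "p + 1 < 2 ^ (k + 1)" using pu u by simp
      then have "\<not> test1 (p + 1)" using p(3) by simp
      moreover have "(q + 1) div 2 ^ (p + 1) = (q + 1) div 2 ^ p div 2"
        by (simp only: Suc_eq_plus1[symmetric] power_Suc2 div_mult2_eq)
      ultimately have "node Y (p + 1) ((q + 1) div 2 ^ p div 2)" by (simp add: test1_def)
      then show ?thesis using ranks[OF pu qu[of p]] c by (simp add: Y_def g_def)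
    qed
  qed
  define J where "J = {j. 1 \<le> j \<and> j * g < m \<and> s (j * g) < q + 1}"
  have "J \<subseteq> {..<m}" using gpos by (auto simp: J_def intro: le_less_trans[rotated])
  then have finJ: "finite J" by (rule finite_subset) simp
  have "cnt = card J"
  proof -
    have "{y \<in> Y. y < q + 1} = (\<lambda>j. s (j * g)) ` J" by (auto simp: Y_def reps_def J_def)
    moreover have "inj_on (\<lambda>j. s (j * g)) J"
    proof (rule inj_onI)
      fix i j assume "i \<in> J" "j \<in> J" "s (i * g) = s (j * g)"
      then have "i * g = j * g" using s_less_iff[of "i * g" "j * g"] s_less_iff[of "j * g" "i * g"]
        by (auto simp: J_def)
      then show "i = j" using gpos by simp
    qed
    ultimately show ?thesis by (simp add: cnt_def card_image)
  qed
  have down: "i \<in> J" if "j \<in> J" "1 \<le> i" "i \<le> j" for i j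
  proof -
    have "i * g \<le> j * g" "j * g < m" using that by (auto simp: J_def)
    moreover from this have "i * g < m" by (rule le_less_trans)
    ultimately have "i * g < m" "s (i * g) \<le> s (j * g)" using s_le_iff[of "i * g" "j * g"] by blast+
    then show ?thesis using that by (auto simp: J_def)
  qed
  \<comment> \<open>\<open>J\<close> is an initial segment, so its size is its largest element:
    \<open>cnt\<close> is the index of the last block that starts at or below
    \<open>q\<close>.\<close>
  have J: "J = {1..cnt}"
  proof (cases "J = {}")
    case False
    then have "Max J \<in> J" using finJ by simp
    then have "{1..Max J} \<subseteq> J" using down by auto
    moreover have "J \<subseteq> {1..Max J}" using finJ by (auto simp: J_def)
    ultimately have "J = {1..Max J}" by blast
    then show ?thesis using \<open>cnt = card J\<close> by (metis card_atLeastAtMost diff_Suc_1)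
  qed (simp add: \<open>cnt = card J\<close>)
  \<comment> \<open>For \<open>cnt = 0\<close> the block starts with the key \<open>s 0 = 0\<close>,
    which is below every query; thus a predecessor always exists.\<close>
  define base where "base = cnt * g"
  have base: "base < m" "s base \<le> q"
  proof -
    have "base < m \<and> s base \<le> q"
    proof (cases "cnt = 0")
      case False
      then have "cnt \<in> J" using J by simp
      then show ?thesis by (simp add: J_def base_def)
    qed (simp add: base_def m0 s0)
    then show "base < m" "s base \<le> q" by auto
  qed
  have next_block: "\<not> (base + g < m \<and> s (base + g) \<le> q)"
  proof
    assume "base + g < m \<and> s (base + g) \<le> q"
    then have "cnt + 1 \<in> J" by (simp add: J_def base_def algebra_simps)
    then show False using J by simp
  qed
  define test2 where "test2 = (\<lambda>d. base + d < m \<and> s (base + d) \<le> q)"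
  show ?thesis
    unfolding predecessor_def predecessor_time_def
  proof (rule wp_seq, rule wp_search[where k = k and test = test1], rule p0, rule b(1))
    fix p st :: nat assume ps: "p + st < 2 ^ (k + 1)" "st \<ge> 1"
    let ?V = "V(10 := p, 11 := st)"
    have pu: "p + st \<le> u" using ps u by simp
    have "ok ?V (Plus (Var 10) (Var 11))" "ev ?V (Plus (Var 10) (Var 11)) = p + st"
      using b(4)[OF pu] by auto
    from key[OF this(1)] this(2) pu q(1) have "ok ?V (trie_key (Plus (Var 10) (Var 11)))"
      "ev ?V (trie_key (Plus (Var 10) (Var 11))) = (p + st) * 2 ^ u + (q + 1) div 2 ^ (p + st)" by auto
    then show "ok ?V trie_test \<and> (ev ?V trie_test \<noteq> 0 \<longleftrightarrow> test1 (p + st))"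
      using b(5)[OF pu qu] nodes[OF pu qu] unfolding trie_test_def
      by (simp add: test1_def Y_def g_def)
  next
    fix d d' assume d: "test1 d" "1 \<le> d'" "d' \<le> d" "d < 2 ^ (k + 1)"
    have "y div 2 ^ d' \<noteq> (q + 1) div 2 ^ d'" if "y \<in> Y" for y
    proof
      assume "y div 2 ^ d' = (q + 1) div 2 ^ d'"
      then have "y div 2 ^ d' div 2 ^ (d - d') = (q + 1) div 2 ^ d' div 2 ^ (d - d')" by simp
      then have "y div 2 ^ d = (q + 1) div 2 ^ d" using d(3) by (simp flip: div_mult2_eq power_add)
      with d(1) that show False by (auto simp: test1_def node_def)
    qed
    then show "test1 d'" by (auto simp: test1_def node_def)
  next
    fix p assume p: "p < 2 ^ (k + 1)" "p = 0 \<or> test1 p" "\<And>d. p < d \<Longrightarrow> d < 2 ^ (k + 1) \<Longrightarrow> \<not> test1 d"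
    let ?V = "V(10 := p, 11 := 0)"
    have pu: "p \<le> u" using p(1) u by simp
    have "ok ?V (trie_key (Var 10))" "ev ?V (trie_key (Var 10)) = p * 2 ^ u + (q + 1) div 2 ^ p"
      using key[of ?V "Var 10"] pu q(1) by auto
    moreover have g: "2 ^ k + 2 ^ k = g" using u by (simp add: g_def)
    moreover have "cnt * g < 2 ^ w" using base(1) b(6) by (simp add: base_def del: mult_Suc_right)
    moreover have "g < 2 ^ w" using b(6) by (simp add: g_def)
    ultimately have bs: "ok ?V bucket_start" "ev ?V bucket_start = base"
      using b(2) b(5)[OF pu qu] rank_ok[OF p] unfolding bucket_start_def
      by (simp_all add: p0[unfolded One_nat_def] base_def)
    show "wp w M (Seq (assign 13 bucket_start) (Seq (search bucket_test) (assign 14 found_key)))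
     (cost bucket_start + 1 + (search_time bucket_test k + (cost found_key + 1))) ?V xs Q"
    proof (rule wp_seq, rule wp_assign[OF w bs(1)], simp, unfold bs(2), rule wp_seq,
        rule wp_search[where k = k and test = test2], rule p0, rule b(1))
      fix p' st :: nat assume ps: "p' + st < 2 ^ (k + 1)" "1 \<le> st"
      let ?V' = "V(10 := p, 11 := 0, 13 := base, 10 := p', 11 := st)"
      have "base + (p' + st) < 2 ^ w" using base(1) b(6) ps u by simp
      then have a: "ok ?V' (look 4 (Plus (Var 13) (Plus (Var 10) (Var 11))))"
        "ev ?V' (look 4 (Plus (Var 13) (Plus (Var 10) (Var 11)))) = F 4 (base + (p' + st))"
        by simp_all
      show "ok ?V' bucket_test \<and> (ev ?V' bucket_test \<noteq> 0 \<longleftrightarrow> test2 (p' + st))"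
        unfolding bucket_test_def Let_def using a b(2) qw q(1) keys[of "base + (p' + st)"]
        by (simp add: test2_def less_Suc_eq_le)
    next
      fix d d' assume d: "test2 d" "1 \<le> d'" "d' \<le> d" "d < 2 ^ (k + 1)"
      then show "test2 d'" using s_le_iff[of "base + d'" "base + d"] by (auto simp: test2_def)
    next
      fix p' :: nat assume p': "p' < 2 ^ (k + 1)" "p' = 0 \<or> test2 p'" "\<And>d. p' < d \<Longrightarrow> d < 2 ^ (k + 1) \<Longrightarrow> \<not> test2 d"
      let ?V' = "V(10 := p, 11 := 0, 13 := base, 10 := p', 11 := 0)"
      have ix: "base + p' < m" "s (base + p') \<le> q" using p'(2) base by (auto simp: test2_def)
      have nx: "\<not> (base + p' + 1 < m \<and> s (base + p' + 1) \<le> q)"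
      proof (cases "p' + 1 < 2 ^ (k + 1)")
        case True
        then show ?thesis using p'(3)[of "p' + 1"] by (simp add: test2_def)
      next
        case False
        \<comment> \<open>At the last offset of the block the next key, if there is one, is the
          first key of the next block, which exceeds \<open>q\<close>.\<close>
        then have "p' + 1 = g" using p'(1) u g_def by simp
        then have "base + p' + 1 = base + g" by simp
        then show ?thesis using next_block by metis
      qed
      have "base + p' < 2 ^ w" using ix(1) b(6) by linarith
      moreover have "s (base + p') + 1 < 2 ^ w" using b(7) su[OF ix(1)] by linarith
      ultimately have fk: "ok ?V' found_key" "ev ?V' found_key = s (base + p')"
        unfolding found_key_def using b(2) ix(1) by (simp_all add: keys)
      show "wp w M (assign 14 found_key) (cost found_key + 1) ?V' xs Q"
      proof (rule wp_assign[OF w fk(1)], simp, unfold fk(2))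
        have "x \<le> s (base + p')" if x: "x \<in> s ` {..<m}" "x \<le> q" for x
        proof -
          obtain i where i: "i < m" "x = s i" using x(1) by blast
          have "i \<le> base + p'"
          proof (rule ccontr)
            assume "\<not> i \<le> base + p'"
            then have "s (base + p' + 1) \<le> s i" "base + p' + 1 < m" using i s_le_iff[of "base + p' + 1" i] by auto
            then show False using nx x(2) i(2) by simp
          qed
          then show ?thesis using s_le_iff[OF i(1) ix(1)] i(2) by simp
        qed
        from Q[OF _ ix(2) this, of p' 0 base] ix(1)
        show "Q (?V'(14 := s (base + p'))) xs" by (simp add: fun_upd_twist)
      qed
    qed
  qed
qed

end

section \<open>Intervals of ranks\<close>

text \<open>
  The vertices are represented by their ranks, the arcs leave \<open>t\<close> and enter \<open>h\<close>, \<open>Z\<close> contains the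
  endpoints of the paths of the decomposition.
\<close>

locale ranked_graph =
  fixes E :: "'e set" and t h :: "'e \<Rightarrow> nat" and lab :: "'e \<Rightarrow> 'a :: linorder"
    and n :: nat and Z :: "nat set" and es :: "'e list"
  assumes finE: "finite E" and tn: "e \<in> E \<Longrightarrow> t e < n" and hn: "e \<in> E \<Longrightarrow> h e < n"
    and W1: "e \<in> E \<Longrightarrow> e' \<in> E \<Longrightarrow> lab e < lab e' \<Longrightarrow> h e < h e'"
    and W2: "e \<in> E \<Longrightarrow> e' \<in> E \<Longrightarrow> lab e = lab e' \<Longrightarrow> t e < t e' \<Longrightarrow> h e \<le> h e'"
    and W3: "e \<in> E \<Longrightarrow> h e < v \<Longrightarrow> v < n \<Longrightarrow> \<exists>e'\<in>E. h e' = v"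
    and es: "distinct es" "set es = E"
      "sorted_wrt (\<lambda>e e'. t e < t e' \<or> t e = t e' \<and> h e \<le> h e') es"
    and Zn: "Z \<subseteq> {..<n}"
    and Z_in: "v < n \<Longrightarrow> v \<notin> Z \<Longrightarrow> \<exists>!e. e \<in> E \<and> h e = v"
    and Z_out: "v < n \<Longrightarrow> v \<notin> Z \<Longrightarrow> \<exists>!e. e \<in> E \<and> t e = v"
begin

lemma in_unique: "e \<in> E \<Longrightarrow> f \<in> E \<Longrightarrow> h e = h f \<Longrightarrow> h e \<notin> Z \<Longrightarrow> e = f"
  using Z_in hn by metis

lemma out_unique: "e \<in> E \<Longrightarrow> f \<in> E \<Longrightarrow> t e = t f \<Longrightarrow> t e \<notin> Z \<Longrightarrow> e = f"
  using Z_out tn by metis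

section \<open>One step from an interval of ranks\<close>

definition act :: "'a \<Rightarrow> nat \<Rightarrow> bool" where
  "act c i \<longleftrightarrow> (\<exists>e\<in>E. lab e = c \<and> t e = i)"

text \<open>The defaults \<open>n\<close> and 0 apply if no arc qualifies. Comparing
  \<open>nxt c a\<close> with \<open>b\<close> tells whether an arc labelled \<open>c\<close> leaves
  \<open>{a..b}\<close>; \<open>lo\<close> and \<open>hi\<close> serve as ends of the new interval
  only in that case.\<close>

definition nxt :: "'a \<Rightarrow> nat \<Rightarrow> nat" where
  "nxt c i = Min (insert n (t ` {e \<in> E. lab e = c \<and> i \<le> t e}))"

definition lo :: "'a \<Rightarrow> nat \<Rightarrow> nat" where
  "lo c i = Min (insert n (h ` {e \<in> E. lab e = c \<and> i \<le> t e}))"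

definition hi :: "'a \<Rightarrow> nat \<Rightarrow> nat" where
  "hi c i = Max (insert 0 (h ` {e \<in> E. lab e = c \<and> t e \<le> i}))"

lemma nxt_le: "nxt c i \<le> n" and lo_le: "lo c i \<le> n" and hi_le: "hi c i \<le> n"
  using finE hn by (auto simp: nxt_def lo_def hi_def Min_le_iff intro: less_imp_le)

lemma hi_upper: "e \<in> E \<Longrightarrow> lab e = c \<Longrightarrow> t e \<le> i \<Longrightarrow> h e \<le> hi c i"
  using finE by (auto simp: hi_def intro!: Max_ge)

lemma lo_eqI: "e \<in> E \<Longrightarrow> lab e = c \<Longrightarrow> i \<le> t e \<Longrightarrow>
    (\<And>f. f \<in> E \<Longrightarrow> lab f = c \<Longrightarrow> i \<le> t f \<Longrightarrow> h e \<le> h f) \<Longrightarrow> lo c i = h e"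
  using finE hn[of e] by (auto simp: lo_def intro!: Min_eqI)

lemma hi_eqI: "e \<in> E \<Longrightarrow> lab e = c \<Longrightarrow> t e \<le> i \<Longrightarrow>
    (\<And>f. f \<in> E \<Longrightarrow> lab f = c \<Longrightarrow> t f \<le> i \<Longrightarrow> h f \<le> h e) \<Longrightarrow> hi c i = h e"
  using finE by (auto simp: hi_def intro!: Max_eqI)

lemma nxt_act: "act c i \<Longrightarrow> nxt c i = i"
  unfolding nxt_def using finE tn by (intro Min_eqI) (auto simp: act_def intro: less_imp_le)

lemma nxt_le_iff: "b < n \<Longrightarrow> nxt c a \<le> b \<longleftrightarrow> (\<exists>e\<in>E. lab e = c \<and> a \<le> t e \<and> t e \<le> b)"
  unfolding nxt_def using finE by (subst Min_le_iff) auto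

lemma lo_hi_unique:
  assumes "e \<in> E" "t e \<notin> Z"
  shows "lo (lab e) (t e) = h e" "hi (lab e) (t e) = h e"
proof -
  have "h e \<le> h f" if "f \<in> E" "lab f = lab e" "t e \<le> t f" for f
    using W2[of e f] out_unique[of e f] assms that by (cases "t e = t f") auto
  then show "lo (lab e) (t e) = h e" using assms by (intro lo_eqI) auto
  have "h f \<le> h e" if "f \<in> E" "lab f = lab e" "t f \<le> t e" for f
    using W2[of f e] out_unique[of e f] assms that by (cases "t e = t f") auto
  then show "hi (lab e) (t e) = h e" using assms by (intro hi_eqI) auto
qed

definition step :: "'a \<Rightarrow> nat set \<Rightarrow> nat set" where
  "step c S = h ` {e \<in> E. lab e = c \<and> t e \<in> S}"

text \<open>Heads of equally labelled arcs grow weakly with their tails, so arcs beyond the interval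
  cannot improve on the extreme heads, although \<open>lo\<close> and \<open>hi\<close> range over
  these arcs as well. There is no gap: a vertex strictly between two heads has an in-arc by
  \<open>W3\<close>, its label is \<open>c\<close> by \<open>W1\<close>, and its tail lies in the
  interval by \<open>W2\<close>.\<close>

lemma step_interval:
  assumes b: "b < n"
  shows "step c {a..b} = (if nxt c a \<le> b then {lo c a..hi c b} else {})"
    and "nxt c a \<le> b \<Longrightarrow> lo c a \<le> hi c b \<and> hi c b < n"
proof -
  have "step c {a..b} = {lo c a..hi c b} \<and> lo c a \<le> hi c b \<and> hi c b < n" if "nxt c a \<le> b"
  proof -
    from that obtain e0 where e0: "e0 \<in> E" "lab e0 = c" "a \<le> t e0" "t e0 \<le> b"
      using nxt_le_iff[OF b] by blast
    let ?S = "{e \<in> E. lab e = c \<and> t e \<in> {a..b}}"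
    have S: "finite ?S" "?S \<noteq> {}" using finE e0 by auto
    obtain p where p: "p \<in> ?S" "\<And>f. f \<in> ?S \<Longrightarrow> h p \<le> h f"
    proof -
      have "Min (h ` ?S) \<in> h ` ?S" using S by (intro Min_in) auto
      then obtain p where "p \<in> ?S" "h p = Min (h ` ?S)" by auto
      then show ?thesis using S that[of p] by auto
    qed
    obtain q where q: "q \<in> ?S" "\<And>f. f \<in> ?S \<Longrightarrow> h f \<le> h q"
    proof -
      have "Max (h ` ?S) \<in> h ` ?S" using S by (intro Max_in) auto
      then obtain q where "q \<in> ?S" "h q = Max (h ` ?S)" by auto
      then show ?thesis using S that[of q] by auto
    qed
    have lo: "lo c a = h p"
    proof (rule lo_eqI)
      fix f assume f: "f \<in> E" "lab f = c" "a \<le> t f"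
      show "h p \<le> h f"
      proof (cases "t f \<le> b")
        case False
        then show ?thesis using W2[of p f] p(1) f by auto
      qed (use p(2) f in auto)
    qed (use p(1) in auto)
    have hi: "hi c b = h q"
    proof (rule hi_eqI)
      fix f assume f: "f \<in> E" "lab f = c" "t f \<le> b"
      show "h f \<le> h q"
      proof (cases "a \<le> t f")
        case False
        then show ?thesis using W2[of f q] q(1) f by auto
      qed (use q(2) f in auto)
    qed (use q(1) in auto)
    have "v \<in> step c {a..b}" if v: "h p \<le> v" "v \<le> h q" for v
    proof (cases "v = h p \<or> v = h q")
      case True
      then show ?thesis using p q by (auto simp: step_def)
    next
      case False
      then have v': "h p < v" "v < h q" using v by auto
      then obtain f where f: "f \<in> E" "h f = v" using W3[of p v] p(1) q(1) hn[of q] by auto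
      have c: "lab f = c"
        using W1[of f p] W1[of q f] p(1) q(1) f v' by (cases "lab f" c rule: linorder_cases) auto
      have "a \<le> t f" using W2[of f p] p(1) f v' c by (rule_tac ccontr) auto
      moreover have "t f \<le> b" using W2[of q f] q(1) f v' c by (rule_tac ccontr) auto
      ultimately show ?thesis using f c by (auto simp: step_def)
    qed
    then have "{h p..h q} \<subseteq> step c {a..b}" by (simp add: subset_iff)
    moreover have "step c {a..b} \<subseteq> {h p..h q}"
    proof
      fix v assume "v \<in> step c {a..b}"
      then obtain f where "f \<in> ?S" "v = h f" by (auto simp: step_def)
      then show "v \<in> {h p..h q}" using p(2)[of f] q(2)[of f] by simp
    qed
    ultimately have "step c {a..b} = {h p..h q}" by (rule equalityI[rotated])
    moreover have "h p \<le> h q" using q(2)[OF p(1)] .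
    moreover have "h q < n" using q(1) hn by simp
    ultimately show ?thesis unfolding lo hi by simp
  qed
  moreover have "step c {a..b} = {}" if "\<not> nxt c a \<le> b"
    using that nxt_le_iff[OF b, of c a] by (auto simp: step_def)
  ultimately show "step c {a..b} = (if nxt c a \<le> b then {lo c a..hi c b} else {})"
    "nxt c a \<le> b \<Longrightarrow> lo c a \<le> hi c b \<and> hi c b < n" by auto
qed

text \<open>
  As functions of \<open>i\<close>, \<open>nxt c i\<close>, \<open>lo c i\<close> and \<open>hi c i\<close> are piecewise linear with slope 0 or 1;
  the pieces start at the pairs in \<open>breaks\<close>.
\<close>

definition regular :: "'a \<Rightarrow> nat \<Rightarrow> bool" where
  "regular c i \<longleftrightarrow> act c (i - 1) = act c i \<and>
     (act c i \<longrightarrow> nxt c i = nxt c (i - 1) + 1 \<and> lo c i = lo c (i - 1) + 1 \<and> hi c i = hi c (i - 1) + 1)"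

definition breaks :: "('a \<times> nat) set" where
  "breaks = {(c, i). c \<in> lab ` E \<and> i < n \<and> (i = 0 \<or> \<not> regular c i)}"

text \<open>While no arc labelled \<open>c\<close> leaves, passing to the next rank does not change
  the sets of arcs behind \<open>nxt\<close>, \<open>lo\<close> and \<open>hi\<close>; while one
  leaves, \<open>regular\<close> makes all three grow by 1. So the values at the start of a piece
  and one bit for the slope suffice.\<close>

lemma piece:
  assumes "i0 \<le> i" "i < n" "c \<in> lab ` E" "\<And>j. i0 < j \<Longrightarrow> j \<le> i \<Longrightarrow> (c, j) \<notin> breaks"
  shows "act c i = act c i0 \<and> nxt c i = nxt c i0 + of_bool (act c i0) * (i - i0) \<and>
    lo c i = lo c i0 + of_bool (act c i0) * (i - i0) \<and> hi c i = hi c i0 + of_bool (act c i0) * (i - i0)"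
  using assms
proof (induction i rule: dec_induct)
  case (step j)
  have IH: "act c j = act c i0 \<and> nxt c j = nxt c i0 + of_bool (act c i0) * (j - i0) \<and>
    lo c j = lo c i0 + of_bool (act c i0) * (j - i0) \<and> hi c j = hi c i0 + of_bool (act c i0) * (j - i0)"
    using step by simp
  have r: "regular c (Suc j)" using step.prems(3)[of "Suc j"] step.prems step.hyps by (auto simp: breaks_def)
  show ?case
  proof (cases "act c j")
    case True
    then show ?thesis using r IH step.hyps by (auto simp: regular_def)
  next
    case False
    then have f: "\<not> act c (Suc j)" using r by (simp add: regular_def)
    have "e \<in> E \<and> lab e = c \<and> Suc j \<le> t e \<longleftrightarrow> e \<in> E \<and> lab e = c \<and> j \<le> t e" for e
      using False by (auto simp: act_def Suc_le_eq order_less_le)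
    then have "nxt c (Suc j) = nxt c j" "lo c (Suc j) = lo c j" by (simp_all add: nxt_def lo_def)
    moreover have "e \<in> E \<and> lab e = c \<and> t e \<le> Suc j \<longleftrightarrow> e \<in> E \<and> lab e = c \<and> t e \<le> j" for e
      using f by (auto simp: act_def le_Suc_eq)
    then have "hi c (Suc j) = hi c j" by (simp add: hi_def)
    ultimately show ?thesis using IH False f by auto
  qed
qed simp

text \<open>A vertex strictly between the two heads would have an in-arc with the same label, whose
  tail is squeezed between two consecutive ranks. These have a single out-arc each, so it would be
  one of the two given arcs. Hence the heads are consecutive, too.\<close>

lemma regularI:
  assumes e: "e1 \<in> E" "e2 \<in> E" "lab e2 = lab e1" "t e2 = t e1 + 1"
    and Z: "t e1 \<notin> Z" "t e2 \<notin> Z" "h e1 \<notin> Z" "h e2 \<notin> Z"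
  shows "regular (lab e1) (t e2)"
proof -
  have "h e1 \<le> h e2" using W2[of e1 e2] e by simp
  moreover have "h e1 \<noteq> h e2" using in_unique[of e1 e2] e Z by auto
  moreover have "\<not> h e1 + 1 < h e2"
  proof
    assume lt: "h e1 + 1 < h e2"
    then obtain f where f: "f \<in> E" "h f = h e1 + 1" using W3[of e1 "h e1 + 1"] hn[of e2] e by auto
    have c: "lab f = lab e1"
      using W1[of f e1] W1[of e2 f] e f lt by (cases "lab f" "lab e1" rule: linorder_cases) auto
    consider "t f < t e1" | "t f = t e1" | "t f = t e2" | "t e2 < t f" using e(4) by linarith
    then show False
    proof cases
      case 1
      then show False using W2[of f e1] e f c by simp
    next
      case 2
      then show False using out_unique[of f e1] e f Z by simp
    next
      case 3
      then show False using out_unique[of f e2] e f Z lt by simp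
    next
      case 4
      then show False using W2[of e2 f] e f c lt by simp
    qed
  qed
  ultimately have "h e2 = h e1 + 1" by linarith
  moreover have "act (lab e1) (t e1)" "act (lab e1) (t e2)" using e by (auto simp: act_def)
  ultimately show ?thesis using lo_hi_unique[of e1] lo_hi_unique[of e2] e Z
    by (auto simp: regular_def nxt_act)
qed

section \<open>Charging breaks to ends of runs and to endpoints\<close>

definition ends :: "nat set" where
  "ends = {p. p < length es \<and> (p + 1 = length es \<or> lab (es ! p) \<noteq> lab (es ! (p + 1)))}"

lemma fin_ends: "finite ends" by (simp add: ends_def)

lemma labels_ends: "lab ` E \<subseteq> (\<lambda>p. lab (es ! p)) ` ends"
proof
  fix c assume "c \<in> lab ` E"
  then obtain p0 where p0: "p0 < length es" "lab (es ! p0) = c" using es(2) by (auto simp: in_set_conv_nth)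
  define p where "p = Max {p. p < length es \<and> lab (es ! p) = c}"
  have p: "p \<in> {p. p < length es \<and> lab (es ! p) = c}" unfolding p_def using p0 by (intro Max_in) auto
  have "p + 1 = length es \<or> lab (es ! (p + 1)) \<noteq> c"
  proof (rule ccontr)
    assume "\<not> ?thesis"
    then have "p + 1 \<in> {p. p < length es \<and> lab (es ! p) = c}" using p by auto
    then have "p + 1 \<le> p" unfolding p_def by (intro Max_ge) auto
    then show False by simp
  qed
  with p show "c \<in> (\<lambda>p. lab (es ! p)) ` ends" by (auto simp: ends_def intro!: image_eqI[of _ _ p])
qed

text \<open>Two consecutive ranks with one out-arc each contribute neighbouring entries of the
  transform; a change of label between them is therefore the end of a run.\<close>

lemma adjacent:
  assumes e: "e1 \<in> E" "e2 \<in> E" "t e2 = t e1 + 1" and Z: "t e1 \<notin> Z" "t e2 \<notin> Z"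
  obtains p where "p + 1 < length es" "es ! p = e1" "es ! (p + 1) = e2"
proof -
  obtain p where p: "p < length es" "es ! p = e1" using e es(2) by (auto simp: in_set_conv_nth)
  obtain q where q: "q < length es" "es ! q = e2" using e es(2) by (auto simp: in_set_conv_nth)
  note srt = sorted_wrt_nth_less[OF es(3)]
  have pq: "p < q" using srt[of q p] p q e by (cases p q rule: linorder_cases) auto
  have "\<not> p + 1 < q"
  proof
    assume lt: "p + 1 < q"
    define f where "f = es ! (p + 1)"
    have f: "f \<in> E" "f \<noteq> e1" "f \<noteq> e2" using lt p q es(1,2) nth_eq_iff_index_eq[OF es(1)]
      by (auto simp: f_def)
    have "t e1 \<le> t f" "t f \<le> t e2"
      using srt[of p "p + 1"] srt[of "p + 1" q] p q lt by (auto simp: f_def)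
    then have "t f = t e1 \<or> t f = t e2" using e(3) by auto
    then show False using f e Z out_unique[of f e1] out_unique[of f e2] by auto
  qed
  with pq p q that show ?thesis by (metis Suc_eq_plus1 Suc_lessI)
qed

definition out_arc :: "nat \<Rightarrow> 'e" where
  "out_arc v = (THE e. e \<in> E \<and> t e = v)"

lemma out_arc_eq: "e \<in> E \<Longrightarrow> t e \<notin> Z \<Longrightarrow> out_arc (t e) = e"
  unfolding out_arc_def using out_unique by (intro the_equality) auto

text \<open>A break at \<open>i > 0\<close> has one of four causes: an arc that leaves an endpoint
  at \<open>i - 1\<close> or \<open>i\<close>; an endpoint there while the label is that of the only
  out-arc of the other rank; a run that ends between the two ranks; or, with equal labels, an arc
  that enters an endpoint. Each cause yields at most two breaks, and the first set accounts for
  \<open>i = 0\<close>.\<close>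

lemma breaks_subset:
  "breaks \<subseteq> (\<lambda>c. (c, 0)) ` lab ` E
     \<union> ((\<lambda>e. (lab e, t e + 1)) ` {e \<in> E. t e \<in> Z} \<union> (\<lambda>e. (lab e, t e)) ` {e \<in> E. t e \<in> Z})
     \<union> ((\<lambda>i. (lab (out_arc (i - 1)), i)) ` Z \<union> (\<lambda>i. (lab (out_arc (i + 1)), i + 1)) ` Z)
     \<union> ((\<lambda>p. (lab (es ! p), t (es ! p) + 1)) ` ends \<union> (\<lambda>p. (lab (es ! (p + 1)), t (es ! p) + 1)) ` ends)
     \<union> ((\<lambda>e. (lab e, t e + 1)) ` {e \<in> E. h e \<in> Z} \<union> (\<lambda>e. (lab e, t e)) ` {e \<in> E. h e \<in> Z})"
  (is "_ \<subseteq> ?A \<union> (?B1 \<union> ?B2) \<union> (?C1 \<union> ?C2) \<union> (?D1 \<union> ?D2) \<union> (?F1 \<union> ?F2)")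
proof
  fix x assume x: "x \<in> breaks"
  then obtain c i where ci: "x = (c, i)" "c \<in> lab ` E" "i < n" "i = 0 \<or> \<not> regular c i"
    by (auto simp: breaks_def)
  show "x \<in> ?A \<union> (?B1 \<union> ?B2) \<union> (?C1 \<union> ?C2) \<union> (?D1 \<union> ?D2) \<union> (?F1 \<union> ?F2)"
  proof (cases "i = 0")
    case True
    then show ?thesis using ci by auto
  next
    case False
    then have nr: "\<not> regular c i" using ci by simp
    then have a: "act c (i - 1) \<or> act c i" by (auto simp: regular_def)
    show ?thesis
    proof (cases "i - 1 \<in> Z \<or> i \<in> Z")
      case Z: True
      show ?thesis using a
      proof
        assume "act c (i - 1)"
        then obtain e where e: "e \<in> E" "lab e = c" "t e = i - 1" by (auto simp: act_def)
        show ?thesis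
        proof (cases "i - 1 \<in> Z")
          case True
          then have "x \<in> ?B1" using e ci False by (auto intro!: image_eqI[of _ _ e])
          then show ?thesis by blast
        next
          case nZ: False
          then have "x \<in> ?C1" using e ci Z out_arc_eq[OF e(1)] by (auto intro!: image_eqI[of _ _ i])
          then show ?thesis by blast
        qed
      next
        assume "act c i"
        then obtain e where e: "e \<in> E" "lab e = c" "t e = i" by (auto simp: act_def)
        show ?thesis
        proof (cases "i \<in> Z")
          case True
          then have "x \<in> ?B2" using e ci False by (auto intro!: image_eqI[of _ _ e])
          then show ?thesis by blast
        next
          case nZ: False
          then have "x \<in> ?C2" using e ci Z out_arc_eq[OF e(1)] False by (auto intro!: image_eqI[of _ _ "i - 1"])
          then show ?thesis by blast
        qed
      qed
    next
      case nZ: False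
      have "i - 1 < n" using ci by simp
      then obtain e1 where e1: "e1 \<in> E" "t e1 = i - 1" using Z_out[of "i - 1"] nZ by blast
      obtain e2 where e2: "e2 \<in> E" "t e2 = i" using Z_out[of i] nZ ci by blast
      have c: "c = lab e1 \<or> c = lab e2"
        using a
      proof
        assume "act c (i - 1)"
        then obtain e where "e \<in> E" "lab e = c" "t e = i - 1" by (auto simp: act_def)
        then show ?thesis using out_unique[of e e1] e1 nZ by auto
      next
        assume "act c i"
        then obtain e where "e \<in> E" "lab e = c" "t e = i" by (auto simp: act_def)
        then show ?thesis using out_unique[of e e2] e2 nZ by auto
      qed
      show ?thesis
      proof (cases "lab e1 = lab e2")
        case True
        then have "h e1 \<in> Z \<or> h e2 \<in> Z"
          using regularI[OF e1(1) e2(1)] e1 e2 nZ nr False c by auto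
        then show ?thesis
        proof
          assume "h e1 \<in> Z"
          then have "x \<in> ?F1" using c True ci False e1 by (auto intro!: image_eqI[of _ _ e1])
          then show ?thesis by blast
        next
          assume "h e2 \<in> Z"
          then have "x \<in> ?F2" using c True ci False e2 by (auto intro!: image_eqI[of _ _ e2])
          then show ?thesis by blast
        qed
      next
        case ne: False
        obtain p where p: "p + 1 < length es" "es ! p = e1" "es ! (p + 1) = e2"
          using adjacent[OF e1(1) e2(1)] e1 e2 nZ False by auto
        then have "p \<in> ends" using ne by (simp add: ends_def)
        then have "x \<in> ?D1 \<or> x \<in> ?D2"
        proof -
          have "x = (lab (es ! p), t (es ! p) + 1) \<or> x = (lab (es ! (p + 1)), t (es ! p) + 1)"
            using c ci(1) p e1(2) False by (elim disjE) simp_all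
          with \<open>p \<in> ends\<close> show ?thesis by blast
        qed
        then show ?thesis by blast
      qed
    qed
  qed
qed

lemma fin_Z: "finite Z" using Zn finite_subset by blast

lemma card_breaks:
  assumes "card ends \<le> r" "card Z \<le> 2 * d" "card {e \<in> E. t e \<in> Z} \<le> d" "card {e \<in> E. h e \<in> Z} \<le> d"
  shows "finite breaks" "card breaks \<le> 3 * r + 8 * d" "card (lab ` E) \<le> r"
proof -
  show "card (lab ` E) \<le> r"
    by (rule order.trans[OF card_mono[OF finite_imageI[OF fin_ends] labels_ends]
          order.trans[OF card_image_le[OF fin_ends] assms(1)]])
  have fins: "finite {e \<in> E. t e \<in> Z}" "finite {e \<in> E. h e \<in> Z}" using finE by auto
  have lab0: "card ((\<lambda>c. (c, 0::nat)) ` lab ` E) \<le> r"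
    by (rule order.trans[OF card_image_le[OF finite_imageI[OF finE]] \<open>card (lab ` E) \<le> r\<close>])
  have U: "card (f ` A \<union> g ` A) \<le> 2 * k" if "finite A" "card A \<le> k" for f g :: "'b \<Rightarrow> 'c" and A k
    using card_Un_le[of "f ` A" "g ` A"] card_image_le[OF that(1), of f] card_image_le[OF that(1), of g] that(2)
    by linarith
  show "finite breaks"
    by (rule finite_subset[OF breaks_subset]) (use finE fin_Z fin_ends in auto)
  have "card breaks \<le> r + 2 * d + 2 * (2 * d) + 2 * r + 2 * d"
  proof (rule order.trans[OF card_mono[OF _ breaks_subset]])
    show "card ((\<lambda>c. (c, 0)) ` lab ` E
     \<union> ((\<lambda>e. (lab e, t e + 1)) ` {e \<in> E. t e \<in> Z} \<union> (\<lambda>e. (lab e, t e)) ` {e \<in> E. t e \<in> Z})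
     \<union> ((\<lambda>i. (lab (out_arc (i - 1)), i)) ` Z \<union> (\<lambda>i. (lab (out_arc (i + 1)), i + 1)) ` Z)
     \<union> ((\<lambda>p. (lab (es ! p), t (es ! p) + 1)) ` ends \<union> (\<lambda>p. (lab (es ! (p + 1)), t (es ! p) + 1)) ` ends)
     \<union> ((\<lambda>e. (lab e, t e + 1)) ` {e \<in> E. h e \<in> Z} \<union> (\<lambda>e. (lab e, t e)) ` {e \<in> E. h e \<in> Z}))
      \<le> r + 2 * d + 2 * (2 * d) + 2 * r + 2 * d"
      by (intro order.trans[OF card_Un_le] add_mono lab0 U[OF fins(1) assms(3)] U[OF fin_Z assms(2)]
          U[OF fin_ends assms(1)] U[OF fins(2) assms(4)])
  qed (use finE fin_Z fin_ends in auto)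
  then show "card breaks \<le> 3 * r + 8 * d" by simp
qed

text \<open>Here the vertices of ranks \<open>j - 1\<close> and \<open>j\<close> are reached in one
  step, away from endpoints, from two vertices that are neighbours, too. Identifiers then grow by 1
  along both arcs, which is what lets \<open>prev\<close> and the identifier of the last vertex do
  without a sample.\<close>

definition good :: "nat \<Rightarrow> bool" where
  "good j \<longleftrightarrow> (\<exists>e\<in>E. \<exists>e'\<in>E. lab e = lab e' \<and> h e = j \<and> j = h e' + 1 \<and> t e = t e' + 1 \<and>
     t e \<notin> Z \<and> t e' \<notin> Z \<and> h e \<notin> Z \<and> h e' \<notin> Z)"

text \<open>Away from endpoints, \<open>j - 1\<close> and \<open>j\<close> have unique in-arcs. If
  their labels differ, \<open>j\<close> is the first head with its label, \<open>lo c 0\<close>. If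
  they agree but the tails are not consecutive, the label pauses right after the smaller tail, which
  is a break, and \<open>lo\<close> is \<open>j\<close> there. In this way the breaks also pay for
  the exceptions.\<close>

lemma bad_subset:
  "{j. j < n \<and> \<not> good j} \<subseteq> {0} \<union> Z \<union> Suc ` Z \<union> h ` {e \<in> E. t e \<in> Z} \<union> Suc ` h ` {e \<in> E. t e \<in> Z}
     \<union> (\<lambda>(c, i). lo c i) ` breaks"
proof
  fix j assume j: "j \<in> {j. j < n \<and> \<not> good j}"
  show "j \<in> {0} \<union> Z \<union> Suc ` Z \<union> h ` {e \<in> E. t e \<in> Z} \<union> Suc ` h ` {e \<in> E. t e \<in> Z} \<union> (\<lambda>(c, i). lo c i) ` breaks"
  proof (rule ccontr)
    assume not: "\<not> ?thesis"
    then have "j \<noteq> 0" by simp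
    then have j1: "Suc (j - 1) = j" by simp
    have "j \<notin> Z" "j \<notin> Suc ` Z" using not by blast+
    moreover from this(2) have "j - 1 \<notin> Z" using j1 by (metis imageI)
    ultimately have jZ: "j \<notin> Z" "j - 1 \<notin> Z" by blast+
    obtain e where e: "e \<in> E" "h e = j" using Z_in[of j] jZ j by auto
    have "j - 1 < n" using j by auto
    then obtain e' where e': "e' \<in> E" "h e' = j - 1" using Z_in[of "j - 1"] jZ by blast
    have tZ: "t e \<notin> Z" using not e by blast
    have tZ': "t e' \<notin> Z"
    proof
      assume "t e' \<in> Z"
      then have "Suc (h e') \<in> Suc ` h ` {e \<in> E. t e \<in> Z}" using e'(1) by blast
      then show False using not e'(2) j1 by simp
    qed
    have lo_not: "lo c i \<noteq> j" if "(c, i) \<in> breaks" for c i using that not by force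
    show False
    proof (cases "lab e = lab e'")
      case False
      then have lt: "lab e' < lab e" using W1[of e e'] e e' j1 by (cases "lab e" "lab e'" rule: linorder_cases) auto
      have "lo (lab e) 0 = h e"
      proof (rule lo_eqI)
        fix f assume f: "f \<in> E" "lab f = lab e"
        then have "h e' < h f" using W1[of e' f] e' lt by simp
        then show "h e \<le> h f" using e e' by simp
      qed (use e in auto)
      moreover have "(lab e, 0) \<in> breaks" using e j by (auto simp: breaks_def)
      ultimately show False using lo_not e by auto
    next
      case True
      have "t e' < t e"
        using W2[of e e'] out_unique[of e e'] True e e' tZ j1
        by (cases "t e" "t e'" rule: linorder_cases) auto
      moreover have "t e \<noteq> t e' + 1"
      proof
        assume "t e = t e' + 1"
        then have "good j" using e e' tZ tZ' jZ True j1 unfolding good_def by force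
        then show False using j by simp
      qed
      ultimately have lt: "t e' + 1 < t e" by simp
      \<comment> \<open>An arc from the skipped rank would enter \<open>j - 1\<close> or
        \<open>j\<close> by monotonicity, against the uniqueness of their in-arcs.\<close>
      have na: "\<not> act (lab e) (t e' + 1)"
      proof
        assume "act (lab e) (t e' + 1)"
        then obtain f where f: "f \<in> E" "lab f = lab e" "t f = t e' + 1" by (auto simp: act_def)
        then have "h e' \<le> h f" "h f \<le> h e" using W2[of e' f] W2[of f e] lt e e' True by auto
        then have "h f = h e \<or> h f = h e'" using e e' by linarith
        then have "f = e \<or> f = e'" using in_unique[of f e] in_unique[of f e'] f e e' jZ by auto
        then show False using f lt by auto
      qed
      have "act (lab e) (t e')" using e' True by (auto simp: act_def)
      then have "(lab e, t e' + 1) \<in> breaks" using na lt tn[OF e(1)] e(1) by (auto simp: breaks_def regular_def)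
      moreover have "lo (lab e) (t e' + 1) = h e"
      proof (rule lo_eqI)
        fix f assume f: "f \<in> E" "lab f = lab e" "t e' + 1 \<le> t f"
        then have "h e' \<le> h f" using W2[of e' f] e' True by simp
        moreover have "h f \<noteq> h e'" using in_unique[of f e'] f e' jZ by auto
        ultimately show "h e \<le> h f" using e e' by simp
      qed (use e lt in auto)
      ultimately show False using lo_not e by auto
    qed
  qed
qed

lemma card_bad:
  assumes "card ends \<le> r" "card Z \<le> 2 * d" "card {e \<in> E. t e \<in> Z} \<le> d" "card {e \<in> E. h e \<in> Z} \<le> d"
  shows "card {j. j < n \<and> \<not> good j} \<le> 1 + 3 * r + 14 * d"
proof -
  note br = card_breaks[OF assms]
  have fins: "finite {e \<in> E. t e \<in> Z}" using finE by auto
  note le = order.trans[OF card_image_le]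
  have "card {j. j < n \<and> \<not> good j} \<le> 1 + 2 * d + 2 * d + d + d + (3 * r + 8 * d)"
  proof (rule order.trans[OF card_mono[OF _ bad_subset]])
    show "card ({0} \<union> Z \<union> Suc ` Z \<union> h ` {e \<in> E. t e \<in> Z} \<union> Suc ` h ` {e \<in> E. t e \<in> Z}
     \<union> (\<lambda>(c, i). lo c i) ` breaks) \<le> 1 + 2 * d + 2 * d + d + d + (3 * r + 8 * d)"
    proof (intro order.trans[OF card_Un_le] add_mono)
      show "card (Suc ` h ` {e \<in> E. t e \<in> Z}) \<le> d" unfolding image_image using fins assms(3) by (intro le) auto
    qed (use assms fins fin_Z br in \<open>auto intro: le\<close>)
  qed (use finE fin_Z br(1) in auto)
  then show ?thesis by simp
qed

end

locale identified_graph = ranked_graph +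
  fixes idr :: "nat \<Rightarrow> nat"
  assumes idr: "bij_betw idr {..<n} {..<n}"
    and compat: "e \<in> E \<Longrightarrow> t e \<notin> Z \<Longrightarrow> h e \<notin> Z \<Longrightarrow> idr (h e) = idr (t e) + 1"
begin

text \<open>Otherwise the arc from \<open>b + 1\<close> that enters the successor of \<open>hi c b\<close> would not start after \<open>b\<close>.\<close>

lemma toehold:
  assumes b: "b < n" and ne: "nxt c a \<le> b" and g: "good (hi c b + 1)"
  shows "idr (hi c b) = idr b + 1"
proof -
  obtain e e' where e: "e \<in> E" "e' \<in> E" "lab e = lab e'" "h e = hi c b + 1" "h e' = hi c b"
    "t e = t e' + 1" "t e' \<notin> Z" "h e' \<notin> Z" using g by (auto simp: good_def)
  have "hi c b \<in> step c {a..b}" using step_interval[OF b] ne by simp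
  then obtain f where f: "f \<in> E" "lab f = c" "t f \<le> b" "h f = hi c b" by (auto simp: step_def)
  then have "f = e'" using in_unique[of e' f] e by auto
  have "\<not> t e' < b"
  proof
    assume "t e' < b"
    then have "h e \<le> hi c b" using hi_upper[of e c b] e f \<open>f = e'\<close> by auto
    then show False using e by simp
  qed
  then have "t e' = b" using f \<open>f = e'\<close> by simp
  then show ?thesis using compat[OF e(2,7,8)] e(5) by simp
qed

definition rk :: "nat \<Rightarrow> nat" where
  "rk = inv_into {..<n} idr"

definition prev :: "nat \<Rightarrow> nat" where
  "prev x = idr (rk x - 1)"

lemma rk_idr: "j < n \<Longrightarrow> rk (idr j) = j"
  using idr by (auto simp: rk_def bij_betw_def)

lemma rk_less: "x < n \<Longrightarrow> rk x < n" and idr_rk: "x < n \<Longrightarrow> idr (rk x) = x"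
proof -
  assume "x < n"
  then have "x \<in> idr ` {..<n}" using idr by (simp add: bij_betw_def)
  then obtain j where "j < n" "x = idr j" by blast
  then show "rk x < n" "idr (rk x) = x" using rk_idr by simp_all
qed

text \<open>If the rank of identifier \<open>x + 1\<close> is good, the arcs into that vertex and
  into its predecessor leave neighbours, the first of which has identifier \<open>x\<close> by
  \<open>compat\<close>. So an arc also joins the predecessors of \<open>x\<close> and
  \<open>x + 1\<close>, and identifiers grow by 1 along it.\<close>

lemma prev_piece:
  assumes "y \<le> x" "x < n" "\<And>z. y < z \<Longrightarrow> z \<le> x \<Longrightarrow> good (rk z)"
  shows "prev x = prev y + (x - y)"
  using assms
proof (induction x rule: dec_induct)
  case (step x)
  obtain e e' where e: "e \<in> E" "e' \<in> E" "h e = rk (Suc x)" "rk (Suc x) = h e' + 1" "t e = t e' + 1"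
     "t e \<notin> Z" "t e' \<notin> Z" "h e \<notin> Z" "h e' \<notin> Z"
    using step.prems(2)[of "Suc x"] step.hyps by (auto simp: good_def)
  have "idr (t e) + 1 = idr (rk (Suc x))" using compat[OF e(1,6,8)] e(3) by simp
  also have "\<dots> = Suc x" using idr_rk step.prems by simp
  finally have "rk x = t e" using rk_idr[OF tn[OF e(1)]] by simp
  then have "prev x = idr (t e')" using e(5) by (simp add: prev_def)
  moreover have "prev (Suc x) = idr (t e') + 1" using compat[OF e(2,7,9)] e(4) by (simp add: prev_def)
  ultimately show ?case using step by (simp add: Suc_diff_le)
qed simp

end

section \<open>Ranks, runs and paths\<close>

definition rank_in :: "'v set \<Rightarrow> 'v rel \<Rightarrow> 'v \<Rightarrow> nat" where
  "rank_in A \<pi> v = card {u \<in> A. (u, v) \<in> \<pi> \<and> u \<noteq> v}"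

context
  fixes A :: "'v set" and \<pi> :: "'v rel"
  assumes lin: "linear_order_on A \<pi>" and fin: "finite A"
begin

lemma rank_in_mono:
  assumes "(u, v) \<in> \<pi>" "u \<noteq> v" "u \<in> A" "v \<in> A"
  shows "rank_in A \<pi> u < rank_in A \<pi> v"
  unfolding rank_in_def
proof (rule psubset_card_mono)
  have tr: "trans \<pi>" and an: "antisym \<pi>"
    using lin by (auto simp: linear_order_on_def partial_order_on_def preorder_on_def)
  have "x \<in> {u \<in> A. (u, v) \<in> \<pi> \<and> u \<noteq> v}" if "x \<in> {x \<in> A. (x, u) \<in> \<pi> \<and> x \<noteq> u}" for x
    using that assms transD[OF tr, of x u v] antisymD[OF an, of u v] by blast
  then show "{x \<in> A. (x, u) \<in> \<pi> \<and> x \<noteq> u} \<subset> {u \<in> A. (u, v) \<in> \<pi> \<and> u \<noteq> v}"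
    using assms by blast
qed (use fin in simp)

lemma rank_in_less_iff:
  assumes "u \<in> A" "v \<in> A"
  shows "rank_in A \<pi> u < rank_in A \<pi> v \<longleftrightarrow> (u, v) \<in> \<pi> \<and> u \<noteq> v"
proof -
  have "(u, v) \<in> \<pi> \<or> (v, u) \<in> \<pi> \<or> u = v"
    using lin assms by (auto simp: linear_order_on_def total_on_def)
  then show ?thesis using rank_in_mono[of u v] rank_in_mono[of v u] assms by force
qed

lemma rank_in_bij: "bij_betw (rank_in A \<pi>) A {..<card A}"
proof -
  have inj: "inj_on (rank_in A \<pi>) A"
  proof (rule inj_onI)
    fix u v assume uv: "u \<in> A" "v \<in> A" "rank_in A \<pi> u = rank_in A \<pi> v"
    have "(u, v) \<in> \<pi> \<or> (v, u) \<in> \<pi> \<or> u = v"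
      using lin uv by (auto simp: linear_order_on_def total_on_def)
    then show "u = v" using rank_in_less_iff[of u v] rank_in_less_iff[of v u] uv by auto
  qed
  have "rank_in A \<pi> v < card A" if "v \<in> A" for v
    unfolding rank_in_def using fin that by (intro psubset_card_mono) auto
  then have "rank_in A \<pi> ` A \<subseteq> {..<card A}" by auto
  then have "rank_in A \<pi> ` A = {..<card A}"
    using inj by (intro card_subset_eq) (auto simp: card_image)
  with inj show ?thesis by (simp add: bij_betw_def)
qed

end

text \<open>The run that ends at position \<open>p\<close> starts at the least \<open>i\<close> for
  which the substring from \<open>i\<close> to \<open>p\<close> is constant. Different last
  positions give different runs, as a run determines its end.\<close>

lemma card_run_ends:
  "card {p. p < length B \<and> (p + 1 = length B \<or> B ! p \<noteq> B ! (p + 1))} \<le> card (runs B)"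
proof -
  let ?S = "{p. p < length B \<and> (p + 1 = length B \<or> B ! p \<noteq> B ! (p + 1))}"
  define st where "st = (\<lambda>p. LEAST i. const_substring B i (p + 1))"
  have "(st p, p + 1) \<in> runs B" if p: "p \<in> ?S" for p
  proof -
    have "const_substring B p (p + 1)" using p by (auto simp: const_substring_def)
    then have c: "const_substring B (st p) (p + 1)" unfolding st_def by (rule LeastI)
    have "i' = st p \<and> p + 1 = j'" if i': "const_substring B i' j'" "i' \<le> st p" "p + 1 \<le> j'" for i' j'
    proof -
      have "st p \<le> p" using c by (simp add: const_substring_def)
      obtain x where x: "\<And>l. l \<in> {i'..<j'} \<Longrightarrow> B ! l = x" "j' \<le> length B"
        using i'(1) by (auto simp: const_substring_def)
      have "\<not> p + 1 < j'"
      proof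
        assume lt: "p + 1 < j'"
        then have "B ! p = x" "B ! (p + 1) = x" using x(1) i'(2) \<open>st p \<le> p\<close> by auto
        then show False using p lt x(2) by auto
      qed
      then have "j' = p + 1" using i'(3) by simp
      moreover from this have "st p \<le> i'" unfolding st_def using i'(1) by (intro Least_le) simp
      ultimately show ?thesis using i'(2) by simp
    qed
    then show ?thesis using c by (auto simp: runs_def)
  qed
  then have "(\<lambda>p. (st p, p + 1)) ` ?S \<subseteq> runs B" by blast
  moreover have "finite (runs B)"
    by (rule finite_subset[of _ "{..length B} \<times> {..length B}"])
      (auto simp: runs_def const_substring_def)
  ultimately have "card ((\<lambda>p. (st p, p + 1)) ` ?S) \<le> card (runs B)" by (rule card_mono[rotated])
  moreover have "inj_on (\<lambda>p. (st p, p + 1)) ?S" by (auto simp: inj_on_def)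
  ultimately show ?thesis by (simp add: card_image)
qed

lemma inner_nth: "1 \<le> i \<Longrightarrow> i + 1 < length xs \<Longrightarrow> xs ! i \<in> set (butlast (tl xs))"
proof -
  assume i: "1 \<le> i" "i + 1 < length xs"
  then have "butlast (tl xs) ! (i - 1) = xs ! i" by (simp add: nth_butlast nth_tl)
  moreover have "i - 1 < length (butlast (tl xs))" using i by simp
  ultimately show ?thesis by (metis nth_mem)
qed

section \<open>Path decompositions and the arcs at their endpoints\<close>

locale decomposed_graph = fin_digraph G for G :: "('v, 'e) pre_digraph" +
  fixes D :: "('v \<times> 'e list) set"
  assumes D: "path_decomposition G D"
begin

lemma path_awalk: "(u, p) \<in> D \<Longrightarrow> \<exists>v. awalk u p v"
  using D by (force simp: path_decomposition_def dpath_def apath_def)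

lemma path_arcs: "(u, p) \<in> D \<Longrightarrow> set p \<subseteq> arcs G"
  using path_awalk by (auto simp: awalk_def)

lemma path_cas: "(u, p) \<in> D \<Longrightarrow> \<exists>v. cas u p v"
  using path_awalk by (auto simp: awalk_def)

lemma path_distinct: "(u, p) \<in> D \<Longrightarrow> distinct p"
proof -
  assume up: "(u, p) \<in> D"
  then have "(\<exists>v. apath u p v) \<or> awalk u p u \<and> p \<noteq> [] \<and> distinct (tl (awalk_verts u p))"
    using D by (force simp: path_decomposition_def dpath_def)
  moreover obtain v where "cas u p v" using path_cas[OF up] by blast
  ultimately have "distinct (tl (awalk_verts u p))" by (auto simp: apath_def distinct_tl)
  then show ?thesis using \<open>cas u p v\<close> by (auto simp: awalk_verts_conv' distinct_map split: if_splits)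
qed

lemma path_unique: "(u, p) \<in> D \<Longrightarrow> (u', p') \<in> D \<Longrightarrow> e \<in> set p \<Longrightarrow> e \<in> set p' \<Longrightarrow> (u, p) = (u', p')"
proof -
  assume a: "(u, p) \<in> D" "(u', p') \<in> D" "e \<in> set p" "e \<in> set p'"
  then have "e \<in> arcs G" using path_arcs by blast
  then have "\<exists>!q. q \<in> D \<and> e \<in> set (snd q)" using D by (simp add: path_decomposition_def)
  then show ?thesis using a by (metis snd_conv)
qed

lemma path_cover: "e \<in> arcs G \<Longrightarrow> \<exists>u p. (u, p) \<in> D \<and> e \<in> set p"
proof -
  assume "e \<in> arcs G"
  then have "\<exists>!q. q \<in> D \<and> e \<in> set (snd q)" using D by (simp add: path_decomposition_def)
  then show ?thesis by (metis prod.collapse)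
qed

lemma one_in: "in_degree G v = 1 \<Longrightarrow> \<exists>!e. e \<in> arcs G \<and> head G e = v"
proof -
  assume "in_degree G v = 1"
  then have "card (in_arcs G v) = 1" by (simp add: in_degree_def)
  then obtain e where "in_arcs G v = {e}" by (rule card_1_singletonE)
  then have "e' \<in> arcs G \<and> head G e' = v \<longleftrightarrow> e' = e" for e' by (auto simp: in_arcs_def)
  then show ?thesis by simp
qed

lemma one_out: "out_degree G v = 1 \<Longrightarrow> \<exists>!e. e \<in> arcs G \<and> tail G e = v"
proof -
  assume "out_degree G v = 1"
  then have "card (out_arcs G v) = 1" by (simp add: out_degree_def)
  then obtain e where "out_arcs G v = {e}" by (rule card_1_singletonE)
  then have "e' \<in> arcs G \<and> tail G e' = v \<longleftrightarrow> e' = e" for e' by (auto simp: out_arcs_def)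
  then show ?thesis by simp
qed

lemma inner_degree:
  assumes "(u, p) \<in> D" "v \<in> set (butlast (tl (awalk_verts u p)))"
  shows "in_degree G v = 1" "out_degree G v = 1"
  using D assms by (force simp: path_decomposition_def path_verts_def)+

lemma inner_vertex:
  assumes up: "(u, p) \<in> D" and i: "1 \<le> i" "i < length p"
  shows "tail G (p ! i) = head G (p ! (i - 1))" "in_degree G (tail G (p ! i)) = 1"
    "out_degree G (tail G (p ! i)) = 1"
proof -
  obtain v where c: "cas u p v" using path_cas[OF up] by blast
  have ne: "p \<noteq> []" using i by auto
  have 1: "awalk_verts u p ! i = tail G (p ! i)"
    using i by (simp add: awalk_verts_conv ne nth_append)
  have 2: "awalk_verts u p ! i = head G (p ! (i - 1))"
    using i ne by (simp add: awalk_verts_conv'[OF c] nth_Cons')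
  show "tail G (p ! i) = head G (p ! (i - 1))" using 1 2 by simp
  have "tail G (p ! i) \<in> set (butlast (tl (awalk_verts u p)))"
    using inner_nth[of i "awalk_verts u p"] i 1 by (simp add: length_awalk_verts)
  then show "in_degree G (tail G (p ! i)) = 1" "out_degree G (tail G (p ! i)) = 1"
    using inner_degree[OF up] by auto
qed

lemma endpoint_cases:
  assumes x: "x \<in> endpoints G D" and deg: "in_degree G x = 1"
  obtains u p where "(u, p) \<in> D" "p \<noteq> []" "x = tail G (hd p) \<or> x = head G (last p)"
proof -
  obtain u p where up: "(u, p) \<in> D" "x = hd (awalk_verts u p) \<or> x = last (awalk_verts u p)"
    using x by (auto simp: endpoints_def path_verts_def)
  have "p \<noteq> []"
  proof
    assume "p = []"
    then have "in_degree G u = 0" "x = u" using up D by (auto simp: path_decomposition_def)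
    then show False using deg by simp
  qed
  moreover from this have "x = tail G (hd p) \<or> x = head G (last p)"
    using up(2) by (auto simp: awalk_verts_conv hd_append hd_map)
  ultimately show ?thesis using up(1) that by blast
qed

text \<open>The vertex has a single in-arc and a single out-arc, both on \<open>p\<close>. A path
  with this endpoint is not trivial, as the in-degree is positive; it would begin or end with one of
  these arcs, hence be \<open>p\<close> itself by disjointness, and then the arc would occur at two
  positions of \<open>p\<close>.\<close>

lemma inner_not_endpoint:
  assumes up: "(u, p) \<in> D" and i: "1 \<le> i" "i < length p"
  shows "tail G (p ! i) \<notin> endpoints G D"
proof
  note iv = inner_vertex[OF up i]
  assume "tail G (p ! i) \<in> endpoints G D"
  then obtain u' p' where p': "(u', p') \<in> D" "p' \<noteq> []"
    "tail G (p ! i) = tail G (hd p') \<or> tail G (p ! i) = head G (last p')"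
    using iv(2) by (rule endpoint_cases)
  have arcs: "hd p' \<in> arcs G" "last p' \<in> arcs G" "p ! i \<in> arcs G" "p ! (i - 1) \<in> arcs G"
    using p'(2) path_arcs[OF p'(1)] path_arcs[OF up] i by auto
  from p'(3) have "p ! i = hd p' \<or> p ! (i - 1) = last p'"
    using one_out[OF iv(3)] one_in[OF iv(2)] iv(1) arcs by metis
  moreover have "p ! i \<in> set p" "p ! (i - 1) \<in> set p" "hd p' \<in> set p'" "last p' \<in> set p'"
    using i p'(2) by auto
  ultimately have "p' = p" using path_unique[OF up p'(1)] by (metis prod.inject)
  with \<open>p ! i = hd p' \<or> p ! (i - 1) = last p'\<close> have "p ! i = p ! 0 \<or> p ! (i - 1) = p ! (length p - 1)"
    using p'(2) by (simp add: hd_conv_nth last_conv_nth)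
  moreover have "0 < length p" "i - 1 < length p" "length p - 1 < length p" using i by auto
  ultimately have "i = 0 \<or> i - 1 = length p - 1"
    using path_distinct[OF up] i(2) by (simp only: nth_eq_iff_index_eq)
  then show False using i by auto
qed

text \<open>Since inner vertices of paths are never endpoints, only the first arc of a path can
  leave an endpoint. So at most \<open>card D\<close> arcs leave endpoints, however large the
  degrees of these are.\<close>

lemma first_arc:
  assumes e: "e \<in> arcs G" "tail G e \<in> endpoints G D"
  shows "\<exists>(u, p)\<in>D. p \<noteq> [] \<and> e = hd p"
proof -
  obtain u p where up: "(u, p) \<in> D" "e \<in> set p" using path_cover[OF e(1)] by blast
  then obtain i where i: "i < length p" "e = p ! i" by (auto simp: in_set_conv_nth)
  then have "i = 0" using inner_not_endpoint[OF up(1), of i] e(2) by (cases i) auto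
  then have "p \<noteq> [] \<and> e = hd p" using i by (cases p) auto
  then show ?thesis using up by blast
qed

lemma last_arc:
  assumes e: "e \<in> arcs G" "head G e \<in> endpoints G D"
  shows "\<exists>(u, p)\<in>D. p \<noteq> [] \<and> e = last p"
proof -
  obtain u p where up: "(u, p) \<in> D" "e \<in> set p" using path_cover[OF e(1)] by blast
  then obtain i where i: "i < length p" "e = p ! i" by (auto simp: in_set_conv_nth)
  then have "\<not> i + 1 < length p"
    using inner_not_endpoint[OF up(1), of "i + 1"] inner_vertex(1)[OF up(1), of "i + 1"] e(2) by auto
  then have "length p - 1 = i" using i by simp
  moreover have "p \<noteq> []" using i by auto
  ultimately have "p \<noteq> [] \<and> e = last p" using i(2) by (simp add: last_conv_nth)
  then show ?thesis using up by blast
qed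

text \<open>Finiteness is not part of \<open>path_decomposition\<close>: nonempty paths are told
  apart by their first arcs, as every arc lies on one path only, and empty ones by their
  vertices.\<close>

lemma fin_D: "finite D"
proof -
  have "inj_on (\<lambda>q. hd (snd q)) {q \<in> D. snd q \<noteq> []}"
  proof (rule inj_onI)
    fix q q' assume a: "q \<in> {q \<in> D. snd q \<noteq> []}" "q' \<in> {q \<in> D. snd q \<noteq> []}" "hd (snd q) = hd (snd q')"
    then show "q = q'" using path_unique[of "fst q" "snd q" "fst q'" "snd q'" "hd (snd q)"]
      hd_in_set[of "snd q"] hd_in_set[of "snd q'"] by auto
  qed
  moreover have "(\<lambda>q. hd (snd q)) ` {q \<in> D. snd q \<noteq> []} \<subseteq> arcs G"
    using path_arcs by fastforce
  ultimately have "finite {q \<in> D. snd q \<noteq> []}"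
    using finite_arcs by (rule inj_on_finite)
  moreover have "{q \<in> D. snd q = []} \<subseteq> verts G \<times> {[]}"
    using path_awalk by (force simp: awalk_def)
  then have "finite {q \<in> D. snd q = []}" by (rule finite_subset) simp
  ultimately have "finite ({q \<in> D. snd q \<noteq> []} \<union> {q \<in> D. snd q = []})" by (rule finite_UnI)
  then show ?thesis by (rule finite_subset[rotated]) blast
qed

lemma card_endpoints: "card (endpoints G D) \<le> 2 * card D"
proof -
  have "endpoints G D = (\<lambda>q. hd (path_verts G q)) ` D \<union> (\<lambda>q. last (path_verts G q)) ` D"
    by (auto simp: endpoints_def)
  then have "card (endpoints G D) \<le> card ((\<lambda>q. hd (path_verts G q)) ` D) + card ((\<lambda>q. last (path_verts G q)) ` D)"
    by (simp add: card_Un_le)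
  then show ?thesis using card_image_le[OF fin_D, of "\<lambda>q. hd (path_verts G q)"]
      card_image_le[OF fin_D, of "\<lambda>q. last (path_verts G q)"] by linarith
qed

lemma card_endpoint_arcs:
  "card {e \<in> arcs G. tail G e \<in> endpoints G D} \<le> card D"
  "card {e \<in> arcs G. head G e \<in> endpoints G D} \<le> card D"
proof -
  have "{e \<in> arcs G. tail G e \<in> endpoints G D} \<subseteq> (\<lambda>q. hd (snd q)) ` D" using first_arc by force
  then show "card {e \<in> arcs G. tail G e \<in> endpoints G D} \<le> card D"
    using fin_D by (meson card_image_le card_mono finite_imageI order.trans)
  have "{e \<in> arcs G. head G e \<in> endpoints G D} \<subseteq> (\<lambda>q. last (snd q)) ` D" using last_arc by force
  then show "card {e \<in> arcs G. head G e \<in> endpoints G D} \<le> card D"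
    using fin_D by (meson card_image_le card_mono finite_imageI order.trans)
qed

lemma endpoints_verts: "endpoints G D \<subseteq> verts G"
proof
  fix x assume "x \<in> endpoints G D"
  then obtain u p where up: "(u, p) \<in> D" "x = hd (awalk_verts u p) \<or> x = last (awalk_verts u p)"
    by (auto simp: endpoints_def path_verts_def)
  then have "x \<in> set (awalk_verts u p)" using hd_in_set last_in_set awalk_verts_non_Nil by metis
  then show "x \<in> verts G" using path_awalk[OF up(1)] by (auto simp: awalk_def intro: awalk_verts_in_verts)
qed

lemma non_endpoint:
  assumes v: "v \<in> verts G" "v \<notin> endpoints G D"
  shows "in_degree G v = 1" "out_degree G v = 1"
proof -
  obtain u p where up: "(u, p) \<in> D" "v \<in> set (awalk_verts u p)"
    using D v(1) by (force simp: path_decomposition_def path_verts_def)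
  have ends: "v \<noteq> hd (awalk_verts u p)" "v \<noteq> last (awalk_verts u p)"
    using v(2) up(1) by (force simp: endpoints_def path_verts_def)+
  obtain i where i: "i < length (awalk_verts u p)" "v = awalk_verts u p ! i"
    using up(2) by (auto simp: in_set_conv_nth)
  have "i \<noteq> 0" using ends(1) i(2) hd_conv_nth[OF awalk_verts_non_Nil] by metis
  moreover have "i \<noteq> length (awalk_verts u p) - 1" 
    using ends(2) i(2) last_conv_nth[OF awalk_verts_non_Nil] by metis
  ultimately have "v \<in> set (butlast (tl (awalk_verts u p)))"
    using inner_nth[of i "awalk_verts u p"] i by auto
  then show "in_degree G v = 1" "out_degree G v = 1" using inner_degree[OF up(1)] by auto
qed

end

section \<open>Wheeler graphs by ranks\<close>

locale wheeler_graph = decomposed_graph G D for G :: "('v, 'e) pre_digraph" and D +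
  fixes lab :: "'e \<Rightarrow> 'a :: linorder" and \<pi> :: "'v rel" and es :: "'e list" and ident :: "'v \<Rightarrow> nat"
  assumes wheeler: "wheeler_order G lab \<pi>"
    and es: "distinct es" "set es = arcs G" "sorted_wrt (\<lambda>e e'.
         (tail G e, tail G e') \<in> \<pi> \<and> tail G e \<noteq> tail G e' \<or>
         tail G e = tail G e' \<and> (head G e, head G e') \<in> \<pi>) es"
    and ids: "compatible_ids G D ident"
begin

abbreviation "rnk \<equiv> rank_in (verts G) \<pi>"

definition idr :: "nat \<Rightarrow> nat" where
  "idr j = ident (inv_into (verts G) rnk j)"

lemma lin: "linear_order_on (verts G) \<pi>"
  using wheeler by (simp add: wheeler_order_def)

lemmas rnk_less_iff = rank_in_less_iff[OF lin finite_verts]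
lemmas rnk_bij = rank_in_bij[OF lin finite_verts]

lemma rnk_less: "v \<in> verts G \<Longrightarrow> rnk v < card (verts G)"
  using rnk_bij by (auto simp: bij_betw_def)

lemma rnk_eq_iff: "u \<in> verts G \<Longrightarrow> v \<in> verts G \<Longrightarrow> rnk u = rnk v \<longleftrightarrow> u = v"
  using rnk_bij by (auto simp: bij_betw_def inj_on_def)

lemma rnk_le: "(u, v) \<in> \<pi> \<Longrightarrow> u \<in> verts G \<Longrightarrow> v \<in> verts G \<Longrightarrow> rnk u \<le> rnk v"
  using rnk_less_iff[of u v] by (cases "u = v") auto

lemma rnk_surj: "j < card (verts G) \<Longrightarrow> \<exists>v\<in>verts G. rnk v = j"
proof -
  assume "j < card (verts G)"
  then have "j \<in> rnk ` verts G" using rnk_bij by (simp add: bij_betw_def)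
  then show ?thesis by blast
qed

lemma idr_rnk: "v \<in> verts G \<Longrightarrow> idr (rnk v) = ident v"
  using rnk_bij by (simp add: idr_def bij_betw_def inv_into_f_f)

lemma rnk_Z: "v \<in> verts G \<Longrightarrow> rnk v \<in> rnk ` endpoints G D \<longleftrightarrow> v \<in> endpoints G D"
  using endpoints_verts rnk_eq_iff by blast

sublocale identified_graph "arcs G" "\<lambda>e. rnk (tail G e)" "\<lambda>e. rnk (head G e)" lab
  "card (verts G)" "rnk ` endpoints G D" es idr
proof
  show "finite (arcs G)" by simp
  show "rnk (tail G e) < card (verts G)" "rnk (head G e) < card (verts G)" if "e \<in> arcs G" for e
    using that by (auto intro: rnk_less)
  show "rnk (head G e) < rnk (head G e')" if "e \<in> arcs G" "e' \<in> arcs G" "lab e < lab e'" for e e'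
    using that wheeler by (auto simp: wheeler_order_def rnk_less_iff)
  show "rnk (head G e) \<le> rnk (head G e')"
    if "e \<in> arcs G" "e' \<in> arcs G" "lab e = lab e'" "rnk (tail G e) < rnk (tail G e')" for e e'
    using that wheeler by (auto simp: wheeler_order_def rnk_less_iff intro!: rnk_le)
  show "\<exists>e'\<in>arcs G. rnk (head G e') = v"
    if e: "e \<in> arcs G" and v: "rnk (head G e) < v" "v < card (verts G)" for e v
  proof -
    obtain x where x: "x \<in> verts G" "rnk x = v" using rnk_surj[OF v(2)] by blast
    have "in_arcs G (head G e) \<noteq> {}" using e by (auto simp: in_arcs_def)
    then have "in_degree G (head G e) > 0" by (simp add: in_degree_def card_gt_0_iff finite_in_arcs)
    \<comment> \<open>Vertices without in-arcs precede the head of \<open>e\<close>, but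
      \<open>x\<close> follows it.\<close>
    have "in_degree G x \<noteq> 0"
    proof
      assume "in_degree G x = 0"
      then have "(x, head G e) \<in> \<pi> \<and> x \<noteq> head G e"
        using wheeler x(1) e \<open>in_degree G (head G e) > 0\<close> by (auto simp: wheeler_order_def)
      then show False using rnk_less_iff[of x "head G e"] x e v(1) by auto
    qed
    then have "in_arcs G x \<noteq> {}" by (auto simp: in_degree_def)
    then show ?thesis using x by (auto simp: in_arcs_def)
  qed
  show "distinct es" by (rule es(1))
  show "set es = arcs G" by (rule es(2))
  show "sorted_wrt (\<lambda>e e'. rnk (tail G e) < rnk (tail G e') \<or>
      rnk (tail G e) = rnk (tail G e') \<and> rnk (head G e) \<le> rnk (head G e')) es"
    by (rule sorted_wrt_mono_rel[OF _ es(3)]) (use es(2) in \<open>auto simp: rnk_less_iff intro!: rnk_le\<close>)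
  show "rnk ` endpoints G D \<subseteq> {..<card (verts G)}" using endpoints_verts rnk_less by auto
next
  fix v assume v: "v < card (verts G)" "v \<notin> rnk ` endpoints G D"
  then obtain x where x: "x \<in> verts G" "rnk x = v" "x \<notin> endpoints G D" using rnk_surj by blast
  have "\<exists>!e. e \<in> arcs G \<and> head G e = x" "\<exists>!e. e \<in> arcs G \<and> tail G e = x"
    using non_endpoint[OF x(1,3)] one_in one_out by auto
  moreover have "rnk (head G e) = v \<longleftrightarrow> head G e = x" "rnk (tail G e) = v \<longleftrightarrow> tail G e = x" if "e \<in> arcs G" for e
    using that x rnk_eq_iff by auto
  ultimately show "\<exists>!e. e \<in> arcs G \<and> rnk (head G e) = v" "\<exists>!e. e \<in> arcs G \<and> rnk (tail G e) = v"
    by (metis (no_types, lifting))+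
next
  have "bij_betw (inv_into (verts G) rnk) {..<card (verts G)} (verts G)"
    by (rule bij_betw_inv_into[OF rnk_bij])
  moreover have "bij_betw ident (verts G) {..<card (verts G)}"
  proof -
    have inj: "inj_on ident (verts G)" and sub: "ident ` verts G \<subseteq> {..<card (verts G)}"
      using ids by (auto simp: compatible_ids_def)
    then have "ident ` verts G = {..<card (verts G)}"
      by (intro card_subset_eq) (auto simp: card_image)
    with inj show ?thesis by (simp add: bij_betw_def)
  qed
  ultimately have "bij_betw (ident \<circ> inv_into (verts G) rnk) {..<card (verts G)} {..<card (verts G)}"
    by (rule bij_betw_trans)
  then show "bij_betw idr {..<card (verts G)} {..<card (verts G)}"
    by (simp add: idr_def[abs_def] comp_def)
next
  fix e assume e: "e \<in> arcs G" "rnk (tail G e) \<notin> rnk ` endpoints G D" "rnk (head G e) \<notin> rnk ` endpoints G D"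
  then have "tail G e \<notin> endpoints G D" "head G e \<notin> endpoints G D" by auto
  then show "idr (rnk (head G e)) = idr (rnk (tail G e)) + 1"
    using e ids by (auto simp: idr_rnk compatible_ids_def)
qed

lemma size_bounds:
  shows "card ends \<le> card (runs (map lab es))"
    "card (rnk ` endpoints G D) \<le> 2 * card D"
    "card {e \<in> arcs G. rnk (tail G e) \<in> rnk ` endpoints G D} \<le> card D"
    "card {e \<in> arcs G. rnk (head G e) \<in> rnk ` endpoints G D} \<le> card D"
proof -
  have "ends = {p. p < length (map lab es) \<and> (p + 1 = length (map lab es) \<or> map lab es ! p \<noteq> map lab es ! (p + 1))}"
    by (auto simp: ends_def)
  then show "card ends \<le> card (runs (map lab es))" using card_run_ends[of "map lab es"] by simp
  show "card (rnk ` endpoints G D) \<le> 2 * card D"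
    using card_endpoints card_image_le[of "endpoints G D" rnk] finite_subset[OF endpoints_verts] by simp
  show "card {e \<in> arcs G. rnk (tail G e) \<in> rnk ` endpoints G D} \<le> card D"
    "card {e \<in> arcs G. rnk (head G e) \<in> rnk ` endpoints G D} \<le> card D"
    using card_endpoint_arcs by (simp_all add: rnk_Z cong: conj_cong)
qed

lemma reachable_snoc:
  "reachable_by G lab (P @ [c]) = head G ` {e \<in> arcs G. lab e = c \<and> tail G e \<in> reachable_by G lab P}"
proof (intro equalityI subsetI)
  fix v assume "v \<in> reachable_by G lab (P @ [c])"
  then obtain u p where p: "awalk u p v" "map lab p = P @ [c]" by (auto simp: reachable_by_def)
  then obtain p' e where e: "p = p' @ [e]" "map lab p' = P" "lab e = c"
    by (auto simp: map_eq_append_conv)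
  then have "awalk u p' (tail G e)" "e \<in> arcs G" "head G e = v"
    using p(1) by (auto simp: awalk_simps)
  then show "v \<in> head G ` {e \<in> arcs G. lab e = c \<and> tail G e \<in> reachable_by G lab P}"
    using e by (auto simp: reachable_by_def)
next
  fix v assume "v \<in> head G ` {e \<in> arcs G. lab e = c \<and> tail G e \<in> reachable_by G lab P}"
  then obtain e u p where e: "e \<in> arcs G" "lab e = c" "v = head G e" "awalk u p (tail G e)" "map lab p = P"
    by (auto simp: reachable_by_def)
  then have "awalk u (p @ [e]) v" by (auto simp: awalk_simps)
  moreover have "map lab (p @ [e]) = P @ [c]" using e by simp
  ultimately show "v \<in> reachable_by G lab (P @ [c])" unfolding reachable_by_def by blast
qed

lemma reachable_verts: "reachable_by G lab P \<subseteq> verts G"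
  by (auto simp: reachable_by_def intro: awalk_last_in_verts)

lemma rnk_reachable: "rnk ` reachable_by G lab P = fold step P {..<card (verts G)}"
proof (induction P rule: rev_induct)
  case Nil
  have "reachable_by G lab [] = verts G" by (auto simp: reachable_by_def awalk_simps)
  then show ?case using rnk_bij by (simp add: bij_betw_def)
next
  case (snoc c P)
  have "tail G e \<in> reachable_by G lab P \<longleftrightarrow> rnk (tail G e) \<in> rnk ` reachable_by G lab P" if "e \<in> arcs G" for e
    using that reachable_verts[of P] rnk_eq_iff by (auto simp: subset_iff)
  then have "{e \<in> arcs G. lab e = c \<and> tail G e \<in> reachable_by G lab P}
      = {e \<in> arcs G. lab e = c \<and> rnk (tail G e) \<in> rnk ` reachable_by G lab P}" by blast
  then have "rnk ` reachable_by G lab (P @ [c]) = step c (rnk ` reachable_by G lab P)"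
    unfolding reachable_snoc step_def image_image by simp
  then show ?case by (simp add: snoc.IH)
qed

lemma ident_reachable: "ident ` reachable_by G lab P = idr ` fold step P {..<card (verts G)}"
  using reachable_verts[of P] idr_rnk by (auto simp: image_image subset_iff simp flip: rnk_reachable)

end

section \<open>The queries\<close>

text \<open>
  Registers: 0 result, 1 and 2 first and last rank of the current interval, 3 whether it is
  nonempty, 4 identifier of its last vertex, 5 character, 6 flag, 7 index of the character.
  Dictionaries: 0 characters, 5 to 8 the linear pieces, 9 predecessors of identifiers in the
  order of ranks, 10 sampled identifiers.
\<close>

definition class_key :: "nat \<Rightarrow> expr" where
  "class_key r = Plus (Times (Minus (Var 7) (Num 1)) (look 1 (Num 2))) (Var r)"

definition piece_value :: "nat \<Rightarrow> expr" where
  "piece_value d = Plus (look d (Var 14)) (Times (Minus (Var 12) (Var 14)) (look 8 (Var 14)))"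

text \<open>Register 8 receives \<open>nxt\<close>, by which emptiness is decided afterwards. If the
  new interval is empty, register 3 is cleared and the value left in register 1 has no
  meaning.\<close>

definition advance_lo :: com where
  "advance_lo = Seq (assign 12 (class_key 1)) (Seq predecessor
     (Seq (assign 8 (piece_value 5)) (assign 1 (piece_value 6))))"

text \<open>Samples are stored plus 1, so 0 in register 9 means that there is none and that the
  identifier of the last vertex grows by 1.\<close>

definition advance_hi :: com where
  "advance_hi = Seq (assign 12 (class_key 2)) (Seq predecessor
     (Seq (assign 2 (piece_value 7)) (Seq (assign 9 (look 10 (Var 2)))
       (ifc (Var 9) (assign 4 (Minus (Var 9) (Num 1))) (assign 4 (Plus (Var 4) (Num 1)))))))"

definition advance :: com where
  "advance = ifc (Var 3)
     (Seq (assign 7 (look 0 (Var 5)))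
       (ifc (Var 7)
         (Seq advance_lo (ifc (Less (Var 2) (Var 8)) (assign 3 (Num 0)) advance_hi))
         (assign 3 (Num 0))))
     Skip"

text \<open>Subtracting the flag in register 3 instead of 1 avoids underflow for
  \<open>n = 0\<close>. Each character is read one round ahead, so that the flag set by
  \<open>Read\<close> can guard the loop.\<close>

definition count_query :: com where
  "count_query = Seq (assign 1 (Num 0)) (Seq (assign 3 (Less (Num 0) (look 1 (Num 2))))
     (Seq (assign 2 (Minus (look 1 (Num 2)) (Var 3))) (Seq (assign 4 (look 1 (Num 4)))
     (Seq (Read 5 6) (Seq (whilec (Var 6) (Seq advance (Read 5 6)))
       (ifc (Var 3) (assign 0 (Plus (Minus (Var 2) (Var 1)) (Num 1))) (assign 0 (Num 0))))))))"

definition report_next :: com where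
  "report_next = Seq (assign 12 (Plus (look 1 (Num 3)) (Var 4))) (Seq predecessor
     (assign 4 (Plus (look 9 (Var 14)) (Minus (Var 12) (Var 14)))))"

text \<open>Register 6 is 0 when counting ends, because the input is exhausted; it now marks the
  first report, which outputs the stored identifier without moving on.\<close>

definition report_query :: com where
  "report_query = Seq (ifc (Var 6) report_next (assign 6 (Num 1))) (assign 0 (Var 4))"

text \<open>The time bounds are bracketed like the programs so that they match the rules for
  \<open>wp\<close>; the branches of a conditional are added up, which avoids maxima.\<close>

definition lo_time :: "nat \<Rightarrow> nat" where
  "lo_time k = (cost (class_key 1) + 1) + (predecessor_time k +
     ((cost (piece_value 5) + 1) + (cost (piece_value 6) + 1)))"

definition hi_time :: "nat \<Rightarrow> nat" where
  "hi_time k = (cost (class_key 2) + 1) + (predecessor_time k +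
     ((cost (piece_value 7) + 1) + ((cost (look 10 (Var 2)) + 1) + (cost (Var 9) +
       ((cost (Minus (Var 9) (Num 1)) + 1) + (cost (Plus (Var 4) (Num 1)) + 1) + 1)))))"

definition advance_time :: "nat \<Rightarrow> nat" where
  "advance_time k = cost (Var 3) + (((cost (look 0 (Var 5)) + 1) +
     (cost (Var 7) + ((lo_time k + (cost (Less (Var 2) (Var 8)) + ((cost (Num 0) + 1) + hi_time k + 1)))
       + (cost (Num 0) + 1) + 1))) + 1 + 1)"

definition count_time :: "nat \<Rightarrow> nat \<Rightarrow> nat" where
  "count_time k l = (cost (Num 0) + 1) + ((cost (Less (Num 0) (look 1 (Num 2))) + 1) +
     ((cost (Minus (look 1 (Num 2)) (Var 3)) + 1) + ((cost (look 1 (Num 4)) + 1) +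
     (1 + ((l * (cost (Var 6) + (advance_time k + 1) + 1) + (cost (Var 6) + 1)) +
     (cost (Var 3) + ((cost (Plus (Minus (Var 2) (Var 1)) (Num 1)) + 1) + (cost (Num 0) + 1) + 1)))))))"

definition next_time :: "nat \<Rightarrow> nat" where
  "next_time k = (cost (Plus (look 1 (Num 3)) (Var 4)) + 1) + (predecessor_time k +
     (cost (Plus (look 9 (Var 14)) (Minus (Var 12) (Var 14))) + 1))"

definition report_time :: "nat \<Rightarrow> nat" where
  "report_time k = (cost (Var 6) + (next_time k + (cost (Num 1) + 1) + 1)) + (cost (Var 4) + 1)"

lemma wp_if:
  assumes "w \<ge> 1" "safe w M V e"
    and "val w M V e \<noteq> 0 \<Longrightarrow> wp w M c1 t1 V xs Q"
    and "val w M V e = 0 \<Longrightarrow> wp w M c2 t2 V xs Q"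
  shows "wp w M (ifc e c1 c2) (cost e + (t1 + t2 + 1)) V xs Q"
  using assms by (intro wp_ifc) (auto elim: wp_mono)

text \<open>One predecessor structure serves two purposes: keys below \<open>sg * n\<close> encode a
  label and a rank, the next \<open>n\<close> numbers the identifiers. The key 0 is always present,
  as predecessor search requires. Dictionary 0 sends characters that label no arc to 0, so a pattern
  may use any character of \<open>Sig\<close>.\<close>

locale wheeler_index = identified_graph E t h lab n Z es idr + predecessor_structure w M F k u m s
  for E :: "'e set" and t h :: "'e \<Rightarrow> nat" and lab :: "'e \<Rightarrow> 'a :: linorder"
    and n :: nat and Z :: "nat set" and es :: "'e list" and idr :: "nat \<Rightarrow> nat"
    and w :: nat and M :: "nat list" and F :: "nat \<Rightarrow> nat \<Rightarrow> nat" and k u m :: nat and s :: "nat \<Rightarrow> nat" +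
  fixes cidx :: "'a \<Rightarrow> nat" and sg :: nat and enc :: "'a \<Rightarrow> nat" and Sig :: "'a set"
  assumes cidx: "c \<in> lab ` E \<Longrightarrow> cidx c < sg"
    and keyset: "s ` {..<m} = {0} \<union> (\<lambda>(c, i). cidx c * n + i) ` breaks
      \<union> (\<lambda>j. sg * n + idr j) ` {j. j < n \<and> \<not> good j}"
    and size: "(sg + 1) * n + 2 < 2 ^ u"
    and enc: "c \<in> Sig \<Longrightarrow> enc c < 2 ^ w"
    and chars: "c \<in> Sig \<Longrightarrow> F 0 (enc c) = (if c \<in> lab ` E then cidx c + 1 else 0)"
    and params: "F 1 2 = n" "F 1 3 = sg * n" "n > 0 \<Longrightarrow> F 1 4 = idr (n - 1)"
    and pieces: "\<And>c i. (c, i) \<in> lab ` E \<times> {..<n} \<Longrightarrow> cidx c * n + i \<in> s ` {..<m} \<Longrightarrow>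
       F 5 (cidx c * n + i) = nxt c i \<and> F 6 (cidx c * n + i) = lo c i \<and>
       F 7 (cidx c * n + i) = hi c i \<and> F 8 (cidx c * n + i) = of_bool (act c i)"
    and prevs: "x < n \<Longrightarrow> sg * n + x \<in> s ` {..<m} \<Longrightarrow> F 9 (sg * n + x) = prev x"
    and toe: "j < n \<Longrightarrow> F 10 j = (if good (j + 1) then 0 else idr j + 1)"
begin

lemma idr_less: "j < n \<Longrightarrow> idr j < n"
  using idr by (auto dest: bij_betwE)

lemma w_bounds: "(16::nat) \<le> 2 ^ w" "(sg + 1) * n + 2 < 2 ^ w" "n + 2 < 2 ^ w"
  and key_bound: "c \<in> lab ` E \<Longrightarrow> i < n \<Longrightarrow> cidx c * n + i < sg * n"
proof -
  have "(2::nat) ^ 4 \<le> 2 ^ w" using uw pow_bounds(3) by (intro power_increasing) auto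
  then show "(16::nat) \<le> 2 ^ w" by simp
  show *: "(sg + 1) * n + 2 < 2 ^ w" using size pow_bounds(7) by (rule less_trans)
  have "n \<le> (sg + 1) * n" by simp
  then show "n + 2 < 2 ^ w" using * by (rule le_less_trans[OF add_right_mono])
  show "cidx c * n + i < sg * n" if "c \<in> lab ` E" "i < n" for c i
  proof -
    have "cidx c * n + i < (cidx c + 1) * n" using that by simp
    also have "\<dots> \<le> sg * n" using cidx[OF that(1)] by (intro mult_le_mono1) simp
    finally show ?thesis .
  qed
qed

text \<open>The pair of the label and rank 0 is always a break, so the key found belongs to the same
  label; being the greatest key up to the query, it starts the piece that contains
  \<open>i\<close>.\<close>

lemma wp_piece:
  assumes V: "V 12 = cidx c * n + i" and c: "c \<in> lab ` E" and i: "i < n"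
    and Q: "\<And>a b d y. y \<le> V 12 \<Longrightarrow> F 5 y + (V 12 - y) * F 8 y = nxt c i \<Longrightarrow>
       F 6 y + (V 12 - y) * F 8 y = lo c i \<Longrightarrow> F 7 y + (V 12 - y) * F 8 y = hi c i \<Longrightarrow>
       Q (V(10 := a, 11 := b, 13 := d, 14 := y)) xs"
  shows "wp w M predecessor (predecessor_time k) V xs Q"
proof (rule wp_predecessor[where V = V and q = "cidx c * n + i"])
  show "V 12 = cidx c * n + i" by (rule V)
  show "cidx c * n + i + 1 < 2 ^ u" using key_bound[OF c i] size by (simp add: add_mult_distrib)
next
  fix a b d y
  assume y: "y \<in> s ` {..<m}" "y \<le> cidx c * n + i"
    "\<And>x. x \<in> s ` {..<m} \<Longrightarrow> x \<le> cidx c * n + i \<Longrightarrow> x \<le> y"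
  have "(c, 0) \<in> breaks" using c i by (auto simp: breaks_def)
  then have "cidx c * n \<in> s ` {..<m}" unfolding keyset by force
  then have "cidx c * n \<le> y" using y(3) by simp
  then obtain i0 where i0: "y = cidx c * n + i0" by (metis le_add_diff_inverse)
  then have le: "i0 \<le> i" using y(2) by simp
  have nb: "(c, j) \<notin> breaks" if "i0 < j" "j \<le> i" for j
  proof
    assume "(c, j) \<in> breaks"
    then have "cidx c * n + j \<in> s ` {..<m}" unfolding keyset by force
    then show False using y(3)[of "cidx c * n + j"] that i0 by simp
  qed
  have F: "F 5 y = nxt c i0 \<and> F 6 y = lo c i0 \<and> F 7 y = hi c i0 \<and> F 8 y = of_bool (act c i0)"
    unfolding i0 using pieces[of c i0] c le i y(1) i0 by simp
  have d: "V 12 - y = i - i0" using V i0 by simp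
  show "Q (V(10 := a, 11 := b, 13 := d, 14 := y)) xs"
  proof (rule Q)
    show "y \<le> V 12" using V y(2) by simp
  qed (use piece[OF le i c nb] F d in \<open>simp_all add: mult.commute\<close>)
qed

lemma piece_value:
  assumes "d < 11" "V 14 = y" "V 12 = q" "y \<le> q" "q < 2 ^ w" "F d y + (q - y) * F 8 y = X" "X < 2 ^ w"
  shows "ok V (piece_value d)" "ev V (piece_value d) = X"
proof -
  have "(q - y) * F 8 y < 2 ^ w" using assms(6,7) by simp
  then show "ok V (piece_value d)" "ev V (piece_value d) = X"
    unfolding piece_value_def using assms by simp_all
qed

lemma class_key:
  assumes "V 7 = cidx c + 1" "c \<in> lab ` E" "V r < n" "r < 100"
  shows "ok V (class_key r)" "ev V (class_key r) = cidx c * n + V r"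
proof -
  have "cidx c * n + V r < sg * n" "cidx c < sg" using key_bound assms(2,3) cidx by auto
  moreover have "sg * n < 2 ^ w" "sg * 1 \<le> sg * n" using w_bounds(2) assms(3) by (simp, intro mult_le_mono2, simp)
  ultimately have "cidx c * n + V r < 2 ^ w" "cidx c * n < 2 ^ w" "cidx c + 1 < 2 ^ w" by linarith+
  then show "ok V (class_key r)" "ev V (class_key r) = cidx c * n + V r"
    unfolding class_key_def using assms w_bounds(1) params(1) by simp_all
qed

lemma wp_advance_lo:
  assumes V: "V 7 = cidx c + 1" "c \<in> lab ` E" "V 1 < n"
    and Q: "\<And>V'. (\<And>x. x \<in> {0,2,3,4,5,6,7} \<Longrightarrow> V' x = V x) \<Longrightarrow> V' 8 = nxt c (V 1) \<Longrightarrow>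
      V' 1 = lo c (V 1) \<Longrightarrow> Q V' xs"
  shows "wp w M advance_lo (lo_time k) V xs Q"
  unfolding advance_lo_def lo_time_def
proof (rule wp_seq, rule wp_assign[OF w], rule class_key(1)[OF V], simp, simp, rule wp_seq,
    rule wp_piece[of _ c "V 1"])
  show "(V(12 := ev V (class_key 1))) 12 = cidx c * n + V 1" using class_key(2)[OF V] by simp
  fix a b d y
  let ?q = "(V(12 := ev V (class_key 1))) 12"
  let ?V = "V(12 := ev V (class_key 1), 10 := a, 11 := b, 13 := d, 14 := y)"
  assume y: "y \<le> ?q" "F 5 y + (?q - y) * F 8 y = nxt c (V 1)" "F 6 y + (?q - y) * F 8 y = lo c (V 1)"
  have q: "?q < 2 ^ w" using class_key(2)[OF V] key_bound[OF V(2,3)] w_bounds(2) by simp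
  have n: "nxt c (V 1) < 2 ^ w" "lo c (V 1) < 2 ^ w" using nxt_le[of c "V 1"] lo_le[of c "V 1"] w_bounds(3) by auto
  have 5: "ok ?V (piece_value 5)" "ev ?V (piece_value 5) = nxt c (V 1)"
    by (rule piece_value[OF _ _ _ y(1) q y(2) n(1)]; simp)+
  have 6: "ok (?V(8 := nxt c (V 1))) (piece_value 6)" "ev (?V(8 := nxt c (V 1))) (piece_value 6) = lo c (V 1)"
    by (rule piece_value[OF _ _ _ y(1) q y(3) n(2)]; simp)+
  show "wp w M (Seq (assign 8 (piece_value 5)) (assign 1 (piece_value 6)))
     (cost (piece_value 5) + 1 + (cost (piece_value 6) + 1)) ?V xs Q"
    by (rule wp_seq, rule wp_assign[OF w 5(1)], simp, unfold 5(2), rule wp_assign[OF w 6(1)], simp,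
        unfold 6(2), rule Q) auto
qed (use V in auto)

lemma wp_advance_hi:
  assumes V: "V 7 = cidx c + 1" "c \<in> lab ` E" "V 2 < n" and ne: "nxt c a0 \<le> V 2" and id: "V 4 = idr (V 2)"
    and Q: "\<And>V'. (\<And>x. x \<in> {0,1,3,5,6,7,8} \<Longrightarrow> V' x = V x) \<Longrightarrow> V' 2 = hi c (V 2) \<Longrightarrow>
      V' 4 = idr (hi c (V 2)) \<Longrightarrow> Q V' xs"
  shows "wp w M advance_hi (hi_time k) V xs Q"
  unfolding advance_hi_def hi_time_def
proof (rule wp_seq, rule wp_assign[OF w], rule class_key(1)[OF V], simp, simp, rule wp_seq,
    rule wp_piece[of _ c "V 2"])
  show "(V(12 := ev V (class_key 2))) 12 = cidx c * n + V 2" using class_key(2)[OF V] by simp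
  fix a b d y
  let ?q = "(V(12 := ev V (class_key 2))) 12"
  let ?V = "V(12 := ev V (class_key 2), 10 := a, 11 := b, 13 := d, 14 := y)"
  assume y: "y \<le> ?q" "F 7 y + (?q - y) * F 8 y = hi c (V 2)"
  have q: "?q < 2 ^ w" using class_key(2)[OF V] key_bound[OF V(2,3)] w_bounds(2) by simp
  have hn: "hi c (V 2) < n" using step_interval(2)[OF V(3) ne] by simp
  have hw: "hi c (V 2) < 2 ^ w" using hn w_bounds(3) by simp
  have idw: "idr j < 2 ^ w" if "j < n" for j
    using idr_less[OF that] w_bounds(3) by simp
  have 7: "ok ?V (piece_value 7)" "ev ?V (piece_value 7) = hi c (V 2)"
    by (rule piece_value[OF _ _ _ y(1) q y(2) hw]; simp)+
  let ?V2 = "?V(2 := hi c (V 2))"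
  let ?V3 = "?V2(9 := F 10 (hi c (V 2)))"
  have 10: "ok ?V2 (look 10 (Var 2))" "ev ?V2 (look 10 (Var 2)) = F 10 (hi c (V 2))"
    using hw by simp_all
  show "wp w M (Seq (assign 2 (piece_value 7)) (Seq (assign 9 (look 10 (Var 2)))
       (ifc (Var 9) (assign 4 (Minus (Var 9) (Num 1))) (assign 4 (Plus (Var 4) (Num 1))))))
     ((cost (piece_value 7) + 1) + ((cost (look 10 (Var 2)) + 1) + (cost (Var 9) +
       ((cost (Minus (Var 9) (Num 1)) + 1) + (cost (Plus (Var 4) (Num 1)) + 1) + 1)))) ?V xs Q"
  proof (rule wp_seq, rule wp_assign[OF w 7(1)], simp, unfold 7(2), rule wp_seq,
      rule wp_assign[OF w 10(1)], simp, unfold 10(2), rule wp_if[OF w])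
    assume "ev ?V3 (Var 9) \<noteq> 0"
    then have F10: "F 10 (hi c (V 2)) = idr (hi c (V 2)) + 1" using toe[OF hn] by (auto split: if_splits)
    show "wp w M (assign 4 (Minus (Var 9) (Num 1))) (cost (Minus (Var 9) (Num 1)) + 1) ?V3 xs Q"
    proof (rule wp_assign[OF w])
      show "ok ?V3 (Minus (Var 9) (Num 1))"
        using F10 w_bounds(1,3) idr_less[OF hn] by simp
    qed (auto intro!: Q simp: F10)
  next
    assume "ev ?V3 (Var 9) = 0"
    then have "good (hi c (V 2) + 1)" using toe[OF hn] by (auto split: if_splits)
    then have id': "idr (hi c (V 2)) = V 4 + 1" using toehold[OF V(3) ne] id by simp
    show "wp w M (assign 4 (Plus (Var 4) (Num 1))) (cost (Plus (Var 4) (Num 1)) + 1) ?V3 xs Q"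
    proof (rule wp_assign[OF w])
      show "ok ?V3 (Plus (Var 4) (Num 1))"
        using id' idw[OF hn] w_bounds(1) by simp
    qed (auto intro!: Q simp: id')
  qed simp
qed (use V in auto)

definition represents :: "(nat \<Rightarrow> nat) \<Rightarrow> nat set \<Rightarrow> bool" where
  "represents V S \<longleftrightarrow> (if V 3 = 0 then S = {} else
     S = {V 1..V 2} \<and> V 1 \<le> V 2 \<and> V 2 < n \<and> V 4 = idr (V 2))"

lemma wp_advance:
  assumes S: "represents V S" and c: "c \<in> Sig" "V 5 = enc c"
  shows "wp w M advance (advance_time k) V xs (\<lambda>V' xs'. xs' = xs \<and> represents V' (step c S))"
    (is "wp w M _ _ _ _ ?Q")
  unfolding advance_def advance_time_def
proof (rule wp_if[OF w])
  assume "ev V (Var 3) = 0"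
  then have "represents V (step c S)" using S by (simp add: represents_def step_def)
  then show "wp w M Skip 1 V xs ?Q" by (intro wp_skip) simp
next
  assume "ev V (Var 3) \<noteq> 0"
  then have V: "V 3 \<noteq> 0" "S = {V 1..V 2}" "V 1 \<le> V 2" "V 2 < n" "V 4 = idr (V 2)"
    using S by (auto simp: represents_def)
  note st = step_interval[OF V(4), of c "V 1"]
  let ?V = "V(7 := F 0 (enc c))"
  have 0: "ok V (look 0 (Var 5))" "ev V (look 0 (Var 5)) = F 0 (enc c)" using enc[OF c(1)] c(2) by simp_all
  show "wp w M (Seq (assign 7 (look 0 (Var 5)))
       (ifc (Var 7)
         (Seq advance_lo (ifc (Less (Var 2) (Var 8)) (assign 3 (Num 0)) advance_hi))
         (assign 3 (Num 0)))) ((cost (look 0 (Var 5)) + 1) +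
     (cost (Var 7) + ((lo_time k + (cost (Less (Var 2) (Var 8)) + ((cost (Num 0) + 1) + hi_time k + 1)))
       + (cost (Num 0) + 1) + 1))) V xs ?Q"
  proof (rule wp_seq, rule wp_assign[OF w 0(1)], simp, unfold 0(2), rule wp_if[OF w])
    assume "ev ?V (Var 7) = 0"
    then have "c \<notin> lab ` E" using chars[OF c(1)] by (simp split: if_splits)
    then have "step c S = {}" by (auto simp: step_def)
    then show "wp w M (assign 3 (Num 0)) (cost (Num 0) + 1) ?V xs ?Q"
      by (intro wp_assign[OF w]) (auto simp: represents_def)
  next
    assume "ev ?V (Var 7) \<noteq> 0"
    then have cE: "c \<in> lab ` E" "?V 7 = cidx c + 1" using chars[OF c(1)] by (auto split: if_splits)
    show "wp w M (Seq advance_lo (ifc (Less (Var 2) (Var 8)) (assign 3 (Num 0)) advance_hi))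
       (lo_time k + (cost (Less (Var 2) (Var 8)) + ((cost (Num 0) + 1) + hi_time k + 1))) ?V xs
       ?Q"
    proof (rule wp_seq, rule wp_advance_lo[where V = ?V and c = c])
      show "?V 7 = cidx c + 1" "c \<in> lab ` E" using cE by auto
      show "?V 1 < n" using V by simp
      fix V1 :: "nat \<Rightarrow> nat" assume V1: "\<And>x. x \<in> {0,2,3,4,5,6,7} \<Longrightarrow> V1 x = ?V x" "V1 8 = nxt c (?V 1)" "V1 1 = lo c (?V 1)"
      have V1': "V1 2 = V 2" "V1 3 = V 3" "V1 4 = V 4" "V1 7 = cidx c + 1" "V1 8 = nxt c (V 1)" "V1 1 = lo c (V 1)"
        using V1(1)[of 2] V1(1)[of 3] V1(1)[of 4] V1(1)[of 7] V1(2,3) cE(2) by simp_all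
      show "wp w M (ifc (Less (Var 2) (Var 8)) (assign 3 (Num 0)) advance_hi)
         (cost (Less (Var 2) (Var 8)) + ((cost (Num 0) + 1) + hi_time k + 1)) V1 xs
         ?Q"
      proof (rule wp_if[OF w])
        assume "ev V1 (Less (Var 2) (Var 8)) \<noteq> 0"
        then have "step c S = {}" using V1' st(1) V(2) by simp
        then show "wp w M (assign 3 (Num 0)) (cost (Num 0) + 1) V1 xs ?Q"
          by (intro wp_assign[OF w]) (auto simp: represents_def)
      next
        assume "ev V1 (Less (Var 2) (Var 8)) = 0"
        then have ne: "nxt c (V 1) \<le> V1 2" using V1' by simp
        have r: "step c S = {lo c (V 1)..hi c (V 2)}" "lo c (V 1) \<le> hi c (V 2)" "hi c (V 2) < n"
          using st ne V1' V(2) by simp_all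
        show "wp w M advance_hi (hi_time k) V1 xs ?Q"
        proof (rule wp_advance_hi[where V = V1 and c = c and ?a0.0 = "V 1"])
          show "V1 7 = cidx c + 1" "c \<in> lab ` E" "nxt c (V 1) \<le> V1 2" using V1'(4) cE(1) ne by auto
          fix V2 :: "nat \<Rightarrow> nat" assume V2: "\<And>x. x \<in> {0,1,3,5,6,7,8} \<Longrightarrow> V2 x = V1 x" "V2 2 = hi c (V1 2)" "V2 4 = idr (hi c (V1 2))"
          have "V2 1 = lo c (V 1)" "V2 3 = V 3" "V2 2 = hi c (V 2)"
            using V2(1)[of 1] V2(1)[of 3] V2(2) V1' by simp_all
          then show "xs = xs \<and> represents V2 (step c S)" using r V2(3) V(1) V1' by (simp add: represents_def)
        qed (use V V1' in simp_all)
      qed simp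
    qed
  qed simp
qed simp

lemma wp_count_query:
  assumes P: "set P \<subseteq> Sig"
  shows "wp w M count_query (count_time k (length P)) V (map enc P)
    (\<lambda>V' xs'. xs' = [] \<and> V' 6 = 0 \<and> V' 0 = card (fold step P {..<n}) \<and> represents V' (fold step P {..<n}))"
    (is "wp w M _ _ _ _ ?Q")
proof -
  let ?loop = "whilec (Var 6) (Seq advance (Read 5 6))"
    and ?tl = "length P * (cost (Var 6) + (advance_time k + 1) + 1) + (cost (Var 6) + 1)"
    and ?out = "ifc (Var 3) (assign 0 (Plus (Minus (Var 2) (Var 1)) (Num 1))) (assign 0 (Num 0))"
    and ?to = "cost (Var 3) + ((cost (Plus (Minus (Var 2) (Var 1)) (Num 1)) + 1) + (cost (Num 0) + 1) + 1)"
  let ?rest = "Seq (Read 5 6) (Seq ?loop ?out)" and ?tr = "1 + (?tl + ?to)"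
  \<comment> \<open>\<open>j\<close> counts the characters still to be processed, the next of which
    has already been read into register 5.\<close>
  define I where "I = (\<lambda>j V xs. \<exists>R P'. P = R @ P' \<and> represents V (fold step R {..<n}) \<and>
    (case P' of [] \<Rightarrow> j = 0 \<and> V 6 = 0 \<and> xs = [] | c # P'' \<Rightarrow> j = Suc (length P'') \<and> V 6 = 1 \<and> V 5 = enc c \<and> xs = map enc P''))"
  have read: "wp w M (Read 5 6) 1 V (map enc P') (I (length P'))"
    if "P = R @ P'" "represents V (fold step R {..<n})" for R P' V
  proof (rule wp_read[OF w])
    assume "map enc P' = []"
    then show "I (length P') (V(6 := 0)) []"
      unfolding I_def using that by (intro exI[of _ R] exI[of _ P']) (auto simp: represents_def)
  next
    fix a as assume "map enc P' = a # as"
    then obtain c P'' where "P' = c # P''" "a = enc c" "as = map enc P''" by auto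
    then show "I (length P') (V(5 := a, 6 := 1)) as"
      unfolding I_def using that by (intro exI[of _ R] exI[of _ P']) (auto simp: represents_def)
  qed simp_all
  have loop: "wp w M ?loop
      ?tl V1 xs1
      (\<lambda>V' xs'. xs' = [] \<and> V' 6 = 0 \<and> represents V' (fold step P {..<n}))" if "I (length P) V1 xs1" for V1 xs1
  proof (rule wp_whilec[OF w, where I = I])
    fix j V xs assume "I (Suc j) V xs"
    then obtain R c P'' where R: "P = R @ c # P''" "represents V (fold step R {..<n})"
      "j = length P''" "V 6 = 1" "V 5 = enc c" "xs = map enc P''"
    proof -
      obtain R P' where "P = R @ P'" "represents V (fold step R {..<n})" "case P' of [] \<Rightarrow> Suc j = 0 \<and> V 6 = 0 \<and> xs = []
          | c # P'' \<Rightarrow> Suc j = Suc (length P'') \<and> V 6 = 1 \<and> V 5 = enc c \<and> xs = map enc P''"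
        using \<open>I (Suc j) V xs\<close> unfolding I_def by blast
      then show ?thesis using that by (cases P') auto
    qed
    have "c \<in> Sig" using P R(1) by auto
    have "wp w M (Seq advance (Read 5 6)) (advance_time k + 1) V xs (I j)"
    proof (rule wp_seq, rule wp_mono[OF wp_advance[OF R(2) \<open>c \<in> Sig\<close> R(5)]], simp)
      fix V' xs' assume "xs' = xs \<and> represents V' (step c (fold step R {..<n}))"
      then show "wp w M (Read 5 6) 1 V' xs' (I j)"
        using read[of "R @ [c]" P'' V'] R by simp
    qed
    then show "ok V (Var 6) \<and> ev V (Var 6) \<noteq> 0 \<and> wp w M (Seq advance (Read 5 6)) (advance_time k + 1) V xs (I j)"
      using R by simp
  next
    fix V xs assume "I 0 V xs"
    then show "ok V (Var 6) \<and> ev V (Var 6) = 0 \<and> xs = [] \<and> V 6 = 0 \<and> represents V (fold step P {..<n})"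
    proof -
      obtain R P' where "P = R @ P'" "represents V (fold step R {..<n})" "case P' of [] \<Rightarrow> (0::nat) = 0 \<and> V 6 = 0 \<and> xs = []
          | c # P'' \<Rightarrow> 0 = Suc (length P'') \<and> V 6 = 1 \<and> V 5 = enc c \<and> xs = map enc P''"
        using \<open>I 0 V xs\<close> unfolding I_def by blast
      then show ?thesis by (cases P') auto
    qed
  qed (rule that)
  have final: "wp w M ?out
     ?to V2 xs ?Q"
    if "xs = [] \<and> V2 6 = 0 \<and> represents V2 (fold step P {..<n})" for V2 xs
  proof -
    have rp: "represents (V2(0 := x)) (fold step P {..<n})" for x
      using that by (cases "V2 3 = 0") (simp_all add: represents_def)
    show ?thesis
    proof (rule wp_if[OF w])
      assume "ev V2 (Var 3) \<noteq> 0"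
      then have r: "fold step P {..<n} = {V2 1..V2 2}" "V2 1 \<le> V2 2" "V2 2 < n"
        using that by (simp_all add: represents_def)
      have v: "ev V2 (Plus (Minus (Var 2) (Var 1)) (Num 1)) = card (fold step P {..<n})" using r by simp
      have "V2 2 < 2 ^ w" "V2 2 - V2 1 + 1 < 2 ^ w" using r(3) w_bounds(3) by linarith+
      then show "wp w M (assign 0 (Plus (Minus (Var 2) (Var 1)) (Num 1)))
          (cost (Plus (Minus (Var 2) (Var 1)) (Num 1)) + 1) V2 xs ?Q"
        by (intro wp_assign[OF w], unfold v) (use that r(2) w_bounds(1) rp in simp_all)
    next
      assume "ev V2 (Var 3) = 0"
      then have "card (fold step P {..<n}) = 0" using that by (simp add: represents_def)
      then show "wp w M (assign 0 (Num 0)) (cost (Num 0) + 1) V2 xs ?Q"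
        by (intro wp_assign[OF w]) (use that rp in simp_all)
    qed simp
  qed
  have b: "(2::nat) < 2 ^ w" "(4::nat) < 2 ^ w" "(1::nat) < 2 ^ w" "n < 2 ^ w" using w_bounds by auto
  define V0 where "V0 = V(1 := 0, 3 := of_bool (0 < n), 2 := n - of_bool (0 < n), 4 := F 1 4)"
  have "represents V0 (fold step [] {..<n})"
  proof (cases "n = 0")
    case False
    then have "{..<n} = {0..n - 1}" by auto
    then show ?thesis using False params(3) by (simp add: represents_def V0_def)
  next
    case True
    then have "V0 3 = 0" by (simp add: V0_def)
    then show ?thesis using True unfolding represents_def by simp
  qed
  from read[OF _ this, of P] have "wp w M (Read 5 6) 1 V0 (map enc P) (I (length P))" by simp
  then have "wp w M ?rest
     ?tr V0 (map enc P) ?Q"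
    by (rule wp_seq[OF wp_mono[OF _ order.refl wp_seq[OF wp_mono[OF loop order.refl final]]]])
  then have V0: "wp w M ?rest
     ?tr
     (V(1 := 0, 3 := of_bool (0 < n), 2 := n - of_bool (0 < n), 4 := F 1 4)) (map enc P) ?Q"
    by (simp add: V0_def)
  let ?A = "V(1 := 0)" and ?B = "V(1 := 0, 3 := of_bool (0 < n))"
    and ?C = "V(1 := 0, 3 := of_bool (0 < n), 2 := n - of_bool (0 < n))"
  have e: "ok V (Num 0)" "ev V (Num 0) = 0"
    "ok ?A (Less (Num 0) (look 1 (Num 2)))" "ev ?A (Less (Num 0) (look 1 (Num 2))) = of_bool (0 < n)"
    "ok ?B (Minus (look 1 (Num 2)) (Var 3))" "ev ?B (Minus (look 1 (Num 2)) (Var 3)) = n - of_bool (0 < n)"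
    "ok ?C (look 1 (Num 4))" "ev ?C (look 1 (Num 4)) = F 1 4"
    using b params(1) by simp_all
  show ?thesis
    unfolding count_query_def count_time_def
    by (rule wp_seq, rule wp_assign[OF w e(1)], simp, unfold e(2), rule wp_seq, rule wp_assign[OF w e(3)], simp,
      unfold e(4), rule wp_seq, rule wp_assign[OF w e(5)], simp, unfold e(6), rule wp_seq,
      rule wp_assign[OF w e(7)], simp, unfold e(8), rule V0)
qed

text \<open>The identifier of a good rank is 1 plus that of the tail of its in-arc. Hence, for
  \<open>n > 0\<close>, the rank of identifier 0 is not good and \<open>sg * n\<close> is a key,
  which keeps a search that starts among the identifiers from leaving their range.\<close>

lemma good_idr_pos: "good j \<Longrightarrow> j < n \<and> 0 < idr j"
proof -
  assume "good j"
  then obtain e where "e \<in> E" "h e = j" "t e \<notin> Z" "h e \<notin> Z" by (auto simp: good_def)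
  then show ?thesis using compat[of e] hn[of e] by simp
qed

lemma wp_report_next:
  assumes V: "V 4 = idr j" "0 < j" "j < n"
    and Q: "\<And>V'. V' 6 = V 6 \<Longrightarrow> V' 4 = idr (j - 1) \<Longrightarrow> Q V' xs"
  shows "wp w M report_next (next_time k) V xs Q"
proof -
  have x: "idr j < n" using idr_less V(3) by simp
  have b: "sg * n + idr j < 2 ^ w" "sg * n + idr j + 1 < 2 ^ u" "sg * n < 2 ^ w" "(3::nat) < 2 ^ w"
    using x w_bounds size by (auto simp: add_mult_distrib)
  have e: "ok V (Plus (look 1 (Num 3)) (Var 4))" "ev V (Plus (look 1 (Num 3)) (Var 4)) = sg * n + idr j"
    using b V(1) params(2) by simp_all
  show ?thesis
    unfolding report_next_def next_time_def
  proof (rule wp_seq, rule wp_assign[OF w e(1)], simp, unfold e(2), rule wp_seq, 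
      rule wp_predecessor[where q = "sg * n + idr j" and V = "V(12 := sg * n + idr j)"])
    show "(V(12 := sg * n + idr j)) 12 = sg * n + idr j" by simp
    show "sg * n + idr j + 1 < 2 ^ u" by fact
    fix a b' d y
    assume y: "y \<in> s ` {..<m}" "y \<le> sg * n + idr j" "\<And>x. x \<in> s ` {..<m} \<Longrightarrow> x \<le> sg * n + idr j \<Longrightarrow> x \<le> y"
    have key: "sg * n + z \<in> s ` {..<m}" if "z < n" "\<not> good (rk z)" for z
      unfolding keyset using that rk_less idr_rk by force
    have "\<not> good (rk 0)" using good_idr_pos[of "rk 0"] idr_rk[of 0] V(3) by auto
    then have "sg * n \<le> y" using key[of 0] y(3)[of "sg * n"] V(3) by simp
    then obtain z where z: "y = sg * n + z" by (metis le_add_diff_inverse)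
    then have le: "z \<le> idr j" using y(2) by simp
    have "good (rk x)" if "z < x" "x \<le> idr j" for x
    proof (rule ccontr)
      assume "\<not> good (rk x)"
      then have "sg * n + x \<le> y" using key[of x] y(3)[of "sg * n + x"] that \<open>idr j < n\<close> by simp
      then show False using that z by simp
    qed
    then have pr: "prev (idr j) = prev z + (idr j - z)" using prev_piece[OF le x] by blast
    moreover have "prev (idr j) = idr (j - 1)" using rk_idr V by (simp add: prev_def)
    moreover have "F 9 y = prev z" using prevs[of z] y(1) z le x by simp
    ultimately have 9: "F 9 y + (idr j - z) = idr (j - 1)" by simp
    have "idr (j - 1) < n" using idr_less V(3) by simp
    then have jn: "idr (j - 1) < 2 ^ w" using w_bounds(3) by simp
    let ?V = "V(12 := sg * n + idr j, 10 := a, 11 := b', 13 := d, 14 := y)"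
    have "y < 2 ^ w" using y(2) b(1) by simp
    then have e2: "ok ?V (Plus (look 9 (Var 14)) (Minus (Var 12) (Var 14)))"
      "ev ?V (Plus (look 9 (Var 14)) (Minus (Var 12) (Var 14))) = idr (j - 1)"
      using b y(2) 9 jn z by simp_all
    show "wp w M (assign 4 (Plus (look 9 (Var 14)) (Minus (Var 12) (Var 14))))
       (cost (Plus (look 9 (Var 14)) (Minus (Var 12) (Var 14))) + 1) ?V xs Q"
      by (rule wp_assign[OF w e2(1)], simp, unfold e2(2), rule Q) auto
  qed
qed

text \<open>\<open>i\<close> counts the reports made. By truncated subtraction
  \<open>b - (i - 1)\<close> is \<open>b\<close> for \<open>i = 0\<close> as well as for
  \<open>i = 1\<close>, because the first report does not move on.\<close>

definition reporting :: "nat \<Rightarrow> nat \<Rightarrow> (nat \<Rightarrow> nat) \<Rightarrow> bool" where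
  "reporting b i V \<longleftrightarrow> V 6 = of_bool (i > 0) \<and> V 4 = idr (b - (i - 1))"

lemma wp_report_query:
  assumes V: "reporting b i V" and i: "i \<le> b" "b < n"
  shows "wp w M report_query (report_time k) V xs (\<lambda>V' xs'. reporting b (Suc i) V' \<and> V' 0 = idr (b - i))"
  unfolding report_query_def report_time_def
proof -
  let ?Q = "\<lambda>V' xs'. reporting b (Suc i) V' \<and> V' 0 = idr (b - i)"
  have out: "wp w M (assign 0 (Var 4)) (cost (Var 4) + 1) V' xs' ?Q"
    if "V' 6 = 1" "V' 4 = idr (b - i)" for V' xs'
    using that by (intro wp_assign[OF w]) (auto simp: reporting_def)
  show "wp w M (Seq (ifc (Var 6) report_next (assign 6 (Num 1))) (assign 0 (Var 4)))
    (cost (Var 6) + (next_time k + (cost (Num 1) + 1) + 1) + (cost (Var 4) + 1)) V xs ?Q"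
  proof (rule wp_seq, rule wp_if[OF w])
    assume "ev V (Var 6) \<noteq> 0"
    then have "i > 0" "V 6 = 1" "V 4 = idr (b - (i - 1))" using V by (auto simp: reporting_def)
    then show "wp w M report_next (next_time k) V xs
        (\<lambda>V' xs'. wp w M (assign 0 (Var 4)) (cost (Var 4) + 1) V' xs' ?Q)"
      using i by (intro wp_report_next[of _ "b - (i - 1)"] out) auto
  next
    assume "ev V (Var 6) = 0"
    then have "i = 0" "V 4 = idr b" using V by (auto simp: reporting_def)
    then show "wp w M (assign 6 (Num 1)) (cost (Num 1) + 1) V xs
        (\<lambda>V' xs'. wp w M (assign 0 (Var 4)) (cost (Var 4) + 1) V' xs' ?Q)"
      using w_bounds(1) by (intro wp_assign[OF w] out) auto
  qed simp
qed

lemma answers: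
  assumes P: "set P \<subseteq> Sig"
    and tc: "real (count_time k (length P)) \<le> tcnt" and tr: "real (report_time k) \<le> trep"
  shows "answers_query w count_query report_query M [] (map enc P) (idr ` fold step P {..<n}) tcnt trep"
proof -
  define S where "S = fold step P {..<n}"
  define N where "N = card S"
  have "wp w M count_query (count_time k (length P)) (\<lambda>_. 0) (map enc P)
    (\<lambda>V' xs'. xs' = [] \<and> V' 6 = 0 \<and> V' 0 = card S \<and> represents V' S)"
    unfolding S_def by (rule wp_count_query[OF P])
  moreover have "mem (start M (map enc P)) = M \<and> inp (start M (map enc P)) = map enc P \<and>
      (\<forall>x<100. regs (start M (map enc P)) x = (\<lambda>_. 0) x)" by (simp add: start_def)
  ultimately obtain t0 s0 V0 where 0: "exec w count_query (start M (map enc P)) t0 s0"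
    "t0 \<le> count_time k (length P)" "mem s0 = M" "\<forall>x<100. regs s0 x = V0 x"
    "V0 6 = 0" "V0 0 = card S" "represents V0 S" unfolding wp_def by blast
  define b where "b = V0 2"
  have rep: "S = {V0 1..b}" "V0 1 \<le> b" "b < n" "V0 4 = idr b" "N = b - V0 1 + 1" if "N > 0"
    using 0(7) that by (auto simp: represents_def N_def b_def split: if_splits)
  define inv where "inv = (\<lambda>i (st :: state). mem st = M \<and> (N > 0 \<longrightarrow> (\<exists>V. (\<forall>x<100. regs st x = V x) \<and> reporting b i V)))"
  \<comment> \<open>\<open>answers_query\<close> asks for a single sequence of states. Guarding the
    claim by \<open>i < N\<close> makes the successor state a total function of \<open>i\<close> and
    the current state, from which \<open>rec_nat\<close> builds the sequence.\<close>
  have "\<exists>st'. (i < N \<longrightarrow> (\<exists>t. exec w report_query st t st' \<and> real t \<le> trep) \<and> regs st' 0 = idr (b - i) \<and> inv (Suc i) st')"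
    if iv: "i < N \<longrightarrow> inv i st" for i st
  proof (cases "i < N")
    case True
    then obtain V where V: "mem st = M" "\<forall>x<100. regs st x = V x" "reporting b i V"
      using iv by (auto simp: inv_def)
    have "i \<le> b" "b < n" using rep True by auto
    from wp_report_query[OF V(3) this, of "inp st"] V(1,2)
    obtain t' st' V' where "exec w report_query st t' st'" "t' \<le> report_time k" "mem st' = M"
      "\<forall>x<100. regs st' x = V' x" "reporting b (Suc i) V'" "V' 0 = idr (b - i)"
      unfolding wp_def by blast
    then show ?thesis using tr by (intro exI[of _ st']) (auto simp: inv_def)
  qed auto
  then obtain nx where nx: "\<And>i st. i < N \<Longrightarrow> inv i st \<Longrightarrow>
      (\<exists>t. exec w report_query st t (nx i st) \<and> real t \<le> trep) \<and> regs (nx i st) 0 = idr (b - i) \<and> inv (Suc i) (nx i st)"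
    by metis
  define st where "st = rec_nat s0 nx"
  have st_simps: "st 0 = s0" "st (Suc i) = nx i (st i)" for i by (simp_all add: st_def)
  have inv: "inv i (st i)" if "i \<le> N" for i
    using that
  proof (induction i)
    case 0
    have "reporting b 0 V0" if "N > 0" using rep[OF that] \<open>V0 6 = 0\<close> by (simp add: reporting_def)
    then show ?case using 0 \<open>mem s0 = M\<close> \<open>\<forall>x<100. regs s0 x = V0 x\<close> by (auto simp: st_simps inv_def)
  next
    case (Suc i)
    then show ?case using nx[of i "st i"] by (simp add: st_simps)
  qed
  have inj: "inj_on idr {..<n}" using idr by (simp add: bij_betw_def)
  have sub: "S \<subseteq> {..<n}" using 0(7) by (auto simp: represents_def split: if_splits)
  have card: "card (idr ` S) = N" unfolding N_def by (rule card_image[OF inj_on_subset[OF inj sub]])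
  have "bij_betw (\<lambda>i. b - i) {..<N} S"
  proof (cases "N > 0")
    case True
    note r = rep[OF True]
    show ?thesis
      by (rule bij_betw_byWitness[where f' = "\<lambda>i. b - i"]) (use r in auto)
  next
    case False
    then have "N = 0" by simp
    moreover have "finite S" using sub by (rule finite_subset) simp
    ultimately show ?thesis by (simp add: N_def bij_betw_def)
  qed
  moreover have "bij_betw idr S (idr ` S)" using inj_on_subset[OF inj sub] by (simp add: bij_betw_def)
  ultimately have "bij_betw (idr \<circ> (\<lambda>i. b - i)) {..<N} (idr ` S)" by (rule bij_betw_trans)
  moreover have "regs (st (Suc i)) 0 = (idr \<circ> (\<lambda>i. b - i)) i" if "i \<in> {..<N}" for i
    using nx[of i "st i"] inv[of i] that by (simp add: st_simps)
  ultimately have bij: "bij_betw (\<lambda>i. regs (st (Suc i)) 0) {..<N} (idr ` S)"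
    by (metis (no_types, lifting) bij_betw_cong)
  show ?thesis
    unfolding answers_query_def S_def[symmetric] card
  proof (intro exI[of _ st] conjI allI impI)
    show "\<exists>t. exec w count_query (start (M @ []) (map enc P)) t (st 0) \<and> real t \<le> tcnt"
      using 0(1,2) tc by (intro exI[of _ t0]) (auto simp: st_simps)
    show "regs (st 0) 0 = N" using 0(4,6) by (simp add: st_simps N_def)
    show "\<exists>t. exec w report_query (st i) t (st (Suc i)) \<and> real t \<le> trep" if "i < N" for i
      using nx[OF that inv] that by (simp add: st_simps)
    show "bij_betw (\<lambda>i. regs (st (Suc i)) 0) {..<N} (idr ` S)" by (rule bij)
    show "take (length M) (mem (st i)) = M" if "i \<le> N" for i using inv[OF that] by (simp add: inv_def)
  qed
qed

end

section \<open>Building the dictionaries\<close>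

definition sparse :: "nat \<Rightarrow> nat \<Rightarrow> (nat \<Rightarrow> nat) \<Rightarrow> bool" where
  "sparse w N f \<longleftrightarrow> finite {q. f q \<noteq> 0} \<and> {q. f q \<noteq> 0} \<subseteq> {..<2 ^ w} \<and> (\<forall>q. f q < 2 ^ w) \<and>
     card {q. f q \<noteq> 0} \<le> N"

lemma sparseI:
  assumes "{q. f q \<noteq> 0} \<subseteq> A" "finite A" "card A \<le> N" "A \<subseteq> {..<2 ^ w}" "\<And>q. f q < 2 ^ w"
  shows "sparse w N f"
  unfolding sparse_def
  using assms finite_subset[OF assms(1,2)] card_mono[OF assms(2,1)] by auto

text \<open>A representative contributes up to one node for each of the \<open>u + 1\<close>
  heights; a block of \<open>u + 1\<close> keys pays for them, so the trie has at most
  \<open>m\<close> nodes.\<close>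

lemma card_reps:
  assumes "g > 0"
  shows "finite (reps g s m)" "card (reps g s m) * g \<le> m"
proof -
  have sub: "reps g s m \<subseteq> (\<lambda>j. s (j * g)) ` {1..(m - 1) div g}"
  proof
    fix y assume "y \<in> reps g s m"
    then obtain j where j: "1 \<le> j" "j * g < m" "y = s (j * g)" by (auto simp: reps_def)
    then have "j \<le> (m - 1) div g" using assms by (simp add: less_eq_div_iff_mult_less_eq)
    then show "y \<in> (\<lambda>j. s (j * g)) ` {1..(m - 1) div g}" using j by auto
  qed
  then show "finite (reps g s m)" by (rule finite_subset) simp
  have "card (reps g s m) \<le> card ((\<lambda>j. s (j * g)) ` {1..(m - 1) div g})" by (rule card_mono[OF _ sub]) simp
  also have "\<dots> \<le> (m - 1) div g" by (rule order.trans[OF card_image_le]) auto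
  finally have "card (reps g s m) * g \<le> (m - 1) div g * g" by (rule mult_le_mono1)
  also have "\<dots> \<le> m - 1" by simp
  finally show "card (reps g s m) * g \<le> m" by simp
qed

lemma loglog_ge_1: "1 \<le> loglog n"
  by (simp add: loglog_def)

text \<open>For \<open>n >= 4\<close>, the logarithm of \<open>(n + 2)^2\<close> is at most
  \<open>4 * log 2 n\<close>, which bounds \<open>2 ^ k - 1\<close>; a second logarithm gives
  \<open>k <= 3 + log 2 (log 2 n)\<close>. For smaller \<open>n\<close> one has
  \<open>k <= 2\<close>, and the truncation in \<open>loglog\<close> settles this case.\<close>

lemma log_height_bound:
  assumes k: "k = 0 \<or> 2 ^ (2 ^ k - 1) \<le> (n + 2)\<^sup>2"
  shows "real k \<le> 4 * loglog n"
proof (cases "k = 0 \<or> n < 4")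
  case True
  have "k \<le> 2"
  proof (rule ccontr)
    assume "\<not> k \<le> 2"
    then have "(2::nat) ^ 3 \<le> 2 ^ k" by (intro power_increasing) auto
    then have "(2::nat) ^ 7 \<le> 2 ^ (2 ^ k - 1)" by (intro power_increasing) auto
    also have "\<dots> \<le> (n + 2)\<^sup>2" using k \<open>\<not> k \<le> 2\<close> by auto
    also have "(n + 2)\<^sup>2 \<le> 5\<^sup>2" using True \<open>\<not> k \<le> 2\<close> by (intro power_mono) auto
    finally show False by simp
  qed
  then show ?thesis using loglog_ge_1[of n] by simp
next
  case False
  then have n: "n \<ge> 4" and k2: "2 ^ (2 ^ k - 1) \<le> (n + 2)\<^sup>2" using k by auto
  have "n + 2 \<le> n\<^sup>2"
  proof -
    have "n + 2 \<le> 4 * n" using n by simp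
    also have "\<dots> \<le> n * n" using n by (rule mult_le_mono1)
    finally show ?thesis by (simp add: power2_eq_square)
  qed
  then have "(n + 2)\<^sup>2 \<le> (n\<^sup>2)\<^sup>2" by (intro power_mono) auto
  then have "2 ^ (2 ^ k - 1) \<le> n ^ 4" using k2 by (simp flip: power_mult)
  then have "real (2 ^ (2 ^ k - 1)) \<le> real (n ^ 4)" by (rule of_nat_mono)
  then have "log 2 (real (2 ^ (2 ^ k - 1))) \<le> log 2 (real (n ^ 4))"
    by (subst log_le_cancel_iff) (use n in auto)
  then have "real (2 ^ k - 1) \<le> 4 * log 2 (real n)" using n by (simp add: log_nat_power)
  moreover have "real (2 ^ k - 1) = 2 ^ k - 1" by simp
  moreover have ln2: "2 \<le> log 2 (real n)"
  proof -
    have "log 2 4 \<le> log 2 (real n)" by (subst log_le_cancel_iff) (use n in auto)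
    then show ?thesis using log2_of_power_eq[of 4 2] by simp
  qed
  ultimately have "2 ^ k \<le> 8 * log 2 (real n)" by linarith
  then have "log 2 (2 ^ k) \<le> log 2 (8 * log 2 (real n))"
    using ln2 by (subst log_le_cancel_iff) auto
  also have "\<dots> = 3 + log 2 (log 2 (real n))"
    using ln2 log2_of_power_eq[of 8 3] by (subst log_mult) auto
  finally have "real k \<le> 3 + log 2 (log 2 (real n))" by simp
  then show ?thesis using loglog_ge_1[of n] by (simp add: loglog_def max_def split: if_splits)
qed

text \<open>The least \<open>k\<close> for which the universe exceeds \<open>(n + 2)^2\<close>. The
  number of bits is 1 less than a power of two, so that the heights \<open>0, ..., u\<close> are
  exactly the range of the binary search.\<close>

lemma tree_height_exists:
  obtains k where "(n + 2)\<^sup>2 < (2::nat) ^ (2 ^ (k + 1) - 1)" "k = 0 \<or> 2 ^ (2 ^ k - 1) \<le> (n + 2)\<^sup>2"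
proof -
  let ?P = "\<lambda>k. (n + 2)\<^sup>2 < (2::nat) ^ (2 ^ (k + 1) - 1)"
  have "?P ((n + 2)\<^sup>2)"
  proof -
    have "(n + 2)\<^sup>2 < (2::nat) ^ ((n + 2)\<^sup>2)" by (rule less_exp)
    also have "(n + 2)\<^sup>2 \<le> 2 ^ ((n + 2)\<^sup>2 + 1) - 1"
      using less_exp[of "(n + 2)\<^sup>2 + 1"] by linarith
    then have "(2::nat) ^ ((n + 2)\<^sup>2) \<le> 2 ^ (2 ^ ((n + 2)\<^sup>2 + 1) - 1)" by (intro power_increasing) auto
    finally show ?thesis .
  qed
  then have ex: "?P (LEAST k. ?P k)" by (rule LeastI)
  show ?thesis
  proof (cases "LEAST k. ?P k")
    case 0
    then show ?thesis using that[of 0] ex by simp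
  next
    case (Suc k')
    then have "\<not> ?P k'" using not_less_Least[of k' ?P] by simp
    then show ?thesis using that[of "Suc k'"] ex Suc by simp
  qed
qed

text \<open>Trie codes combine a height with a prefix of \<open>u\<close> bits, for which
  \<open>2 * u + 2 <= w\<close> leaves room. The logarithmic word length gives this bound, since
  \<open>2 ^ (2 ^ k)\<close> is at most \<open>2 * (n + 2)^2\<close>.\<close>

lemma tree_height_bound:
  assumes k: "k = 0 \<or> 2 ^ (2 ^ k - 1) \<le> (n + 2)\<^sup>2" and w: "(n + 2) ^ 20 \<le> (2::nat) ^ w"
  shows "2 ^ (k + 2) \<le> w"
proof -
  have L: "2 \<le> n + 2" by simp
  have "(2::nat) ^ (2 ^ k) \<le> 2 * (n + 2)\<^sup>2"
  proof (cases "k = 0")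
    case False
    have "(2::nat) ^ (2 ^ k) = 2 * 2 ^ (2 ^ k - 1)" by (simp flip: power_Suc)
    then show ?thesis using k False by simp
  qed simp
  then have "((2::nat) ^ (2 ^ k)) ^ 4 \<le> (2 * (n + 2)\<^sup>2) ^ 4" by (intro power_mono) auto
  also have "\<dots> = 2 ^ 4 * (n + 2) ^ 8" by (simp add: power_mult_distrib flip: power_mult)
  also have "\<dots> \<le> (n + 2) ^ 4 * (n + 2) ^ 8" using L by (intro mult_le_mono1 power_mono) auto
  also have "\<dots> = (n + 2) ^ 12" by (simp flip: power_add)
  also have "\<dots> \<le> (n + 2) ^ 20" by (intro power_increasing) auto
  finally have "(2::nat) ^ (2 ^ k * 4) \<le> 2 ^ w" using w by (simp add: power_mult)
  then show ?thesis by simp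
qed

context identified_graph begin

text \<open>By \<open>W1\<close> arcs with different labels have different heads, so one arc per
  label gives an injection into the ranks. This keeps the keys, which combine a label with a rank,
  polynomial in \<open>n\<close>.\<close>

lemma card_labels: "card (lab ` E) \<le> n"
proof -
  define g where "g = (\<lambda>c. h (SOME e. e \<in> E \<and> lab e = c))"
  have g: "\<exists>e\<in>E. lab e = c \<and> h e = g c" if "c \<in> lab ` E" for c
  proof -
    have "\<exists>e. e \<in> E \<and> lab e = c" using that by blast
    then have "(SOME e. e \<in> E \<and> lab e = c) \<in> E \<and> lab (SOME e. e \<in> E \<and> lab e = c) = c" by (rule someI_ex)
    then show ?thesis unfolding g_def by blast
  qed
  have "inj_on g (lab ` E)"
  proof (rule inj_onI)
    fix c c' assume c: "c \<in> lab ` E" "c' \<in> lab ` E" "g c = g c'"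
    obtain e e' where "e \<in> E" "lab e = c" "h e = g c" "e' \<in> E" "lab e' = c'" "h e' = g c'"
      using g c(1,2) by metis
    then show "c = c'" using W1[of e e'] W1[of e' e] c(3) by (cases c c' rule: linorder_cases) auto
  qed
  moreover have "g ` lab ` E \<subseteq> {..<n}" using g hn by fastforce
  ultimately have "card (lab ` E) \<le> card {..<n}" by (intro card_inj_on_le) auto
  then show ?thesis by simp
qed

end

text \<open>All times are made up of constants and fixed numbers of terms
  \<open>search_time\<close>, which is linear in \<open>k\<close>. The costs of expressions depend
  on no input, so they disappear in the constant and need not be computed.\<close>

lemma linear_times:
  obtains A where "\<And>k. report_time k \<le> A * (k + 2)" "\<And>k l. count_time k l \<le> A * (k + 2) * l + A"
proof -
  have add: "\<exists>A. \<forall>k. f k + g k \<le> A * (k + 2)" if fg: "\<exists>A. \<forall>k. f k \<le> A * (k + 2)" "\<exists>A. \<forall>k. g k \<le> A * (k + 2)"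
    for f g :: "nat \<Rightarrow> nat"
  proof -
    obtain A A' where "\<forall>k. f k \<le> A * (k + 2)" "\<forall>k. g k \<le> A' * (k + 2)" using fg by blast
    then have "f k + g k \<le> A * (k + 2) + A' * (k + 2)" for k by (intro add_mono) auto
    then have "\<forall>k. f k + g k \<le> (A + A') * (k + 2)" by (simp only: add_mult_distrib simp_thms)
    then show ?thesis by blast
  qed
  have const: "\<exists>A. \<forall>k. c \<le> A * (k + 2)" for c :: nat
    by (intro exI[of _ c]) simp
  have search: "\<exists>A. \<forall>k. search_time e k \<le> A * (k + 2)" for e
    by (intro exI[of _ "cost e + cost (look 1 (Num 0)) + 20"]) (simp add: search_time_def mult.commute)
  have p: "\<exists>A. \<forall>k. predecessor_time k \<le> A * (k + 2)"
    unfolding predecessor_time_def by (intro add const search)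
  have a: "\<exists>A. \<forall>k. advance_time k + 3 \<le> A * (k + 2)"
    unfolding advance_time_def lo_time_def hi_time_def by (intro add const p)
  have r: "\<exists>A. \<forall>k. report_time k \<le> A * (k + 2)"
    unfolding report_time_def next_time_def by (intro add const p)
  obtain A2 A3 where A: "\<forall>k. advance_time k + 3 \<le> A2 * (k + 2)"
    "\<forall>k. report_time k \<le> A3 * (k + 2)" using a r by blast
  define B where "B = count_time 0 0"
  have B: "count_time k l \<le> A2 * (k + 2) * l + B" for k l
  proof -
    have "count_time k l = l * (advance_time k + 3) + B" by (simp add: count_time_def B_def algebra_simps)
    also have "\<dots> \<le> l * (A2 * (k + 2)) + B"
      using A(1)[rule_format, of k] by (intro add_right_mono mult_le_mono2) simp
    finally show ?thesis by (simp add: mult.commute)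
  qed
  define A where "A = A2 + A3 + B"
  have le: "x * (k + 2) \<le> A * (k + 2)" if "x \<le> A" for x k using that by (rule mult_le_mono1)
  have "report_time k \<le> A * (k + 2)" for k
    by (rule order.trans[OF A(2)[rule_format] le]) (simp add: A_def)
  moreover have "count_time k l \<le> A * (k + 2) * l + A" for k l
    by (rule order.trans[OF B add_mono[OF mult_le_mono1[OF le]]]) (simp_all add: A_def)
  ultimately show ?thesis using that by blast
qed

section \<open>The tables of the trie\<close>

definition node_table :: "nat \<Rightarrow> nat set \<Rightarrow> nat \<Rightarrow> nat" where
  "node_table u Y q = of_bool (\<exists>i\<le>u. \<exists>y\<in>Y. q = i * 2 ^ u + y div 2 ^ i)"

definition rank_table :: "nat \<Rightarrow> nat set \<Rightarrow> nat \<Rightarrow> nat" where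
  "rank_table u Y q = (if q div 2 ^ u \<le> u \<and> node Y (q div 2 ^ u + 1) (q mod 2 ^ u div 2)
      then card {y \<in> Y. y div 2 ^ (q div 2 ^ u) < q mod 2 ^ u} else 0)"

lemma node_table:
  assumes "i \<le> u" "\<And>y. y \<in> Y \<Longrightarrow> y + 1 < 2 ^ u" "z < 2 ^ u"
  shows "node_table u Y (i * 2 ^ u + z) = of_bool (node Y i z)"
proof -
  have "i * 2 ^ u + z = j * 2 ^ u + y div 2 ^ j \<longleftrightarrow> i = j \<and> z = y div 2 ^ j" if "y \<in> Y" for j y
  proof -
    have "y div 2 ^ j < 2 ^ u" using assms(2)[OF that] div_le_dividend[of y "2 ^ j"] by linarith
    then have "(j * 2 ^ u + y div 2 ^ j) div 2 ^ u = j" "(j * 2 ^ u + y div 2 ^ j) mod 2 ^ u = y div 2 ^ j" by auto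
    moreover have "(i * 2 ^ u + z) div 2 ^ u = i" "(i * 2 ^ u + z) mod 2 ^ u = z" using assms(3) by auto
    ultimately show ?thesis by metis
  qed
  then have "(\<exists>j\<le>u. \<exists>y\<in>Y. i * 2 ^ u + z = j * 2 ^ u + y div 2 ^ j) \<longleftrightarrow> node Y i z"
    using assms(1) unfolding node_def by auto
  then show ?thesis by (simp add: node_table_def)
qed

lemma rank_table:
  assumes "i \<le> u" "z < 2 ^ u"
  shows "rank_table u Y (i * 2 ^ u + z)
    = (if node Y (i + 1) (z div 2) then card {y \<in> Y. y div 2 ^ i < z} else 0)"
  using assms by (simp add: rank_table_def)

lemma trie_code_less:
  assumes "i \<le> u" "z < 2 ^ u" "2 * u \<le> w"
  shows "i * 2 ^ u + z < (2::nat) ^ w"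
proof -
  have "i * 2 ^ u + z < (i + 1) * 2 ^ u" using assms by simp
  also have "i + 1 \<le> 2 ^ u" using assms(1) less_exp[of u] by linarith
  then have "(i + 1) * 2 ^ u \<le> 2 ^ u * 2 ^ u" by (rule mult_le_mono1)
  also have "\<dots> = 2 ^ (2 * u)" by (simp add: mult_2 power_add)
  also have "(2::nat) ^ (2 * u) \<le> 2 ^ w" using assms by (intro power_increasing) auto
  finally show ?thesis .
qed

lemma sparse_node_table:
  assumes Y: "finite Y" "(u + 1) * card Y \<le> N" "\<And>y. y \<in> Y \<Longrightarrow> y + 1 < 2 ^ u" and w: "2 * u \<le> w" "w \<ge> 1"
  shows "sparse w N (node_table u Y)"
proof (rule sparseI)
  let ?A = "(\<lambda>(i, y). i * 2 ^ u + y div 2 ^ i) ` ({..u} \<times> Y)"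
  show "{q. node_table u Y q \<noteq> 0} \<subseteq> ?A"
    by (auto simp: node_table_def)
  have "card ?A \<le> card ({..u} \<times> Y)"
    using Y(1) by (intro card_image_le) auto
  then show "card ?A \<le> N"
    using Y(2) by (simp add: card_cartesian_product)
  show "?A \<subseteq> {..<2 ^ w}"
  proof
    fix q assume "q \<in> ?A"
    then obtain i y where q: "q = i * 2 ^ u + y div 2 ^ i" "i \<le> u" "y \<in> Y" by auto
    have "y div 2 ^ i < 2 ^ u" using Y(3)[OF q(3)] div_le_dividend[of y "2 ^ i"] by linarith
    then show "q \<in> {..<2 ^ w}" using trie_code_less[OF q(2) _ w(1)] q(1) by simp
  qed
  have "(2::nat) ^ 1 \<le> 2 ^ w" using w(2) by (rule power_increasing) simp
  then show "node_table u Y q < 2 ^ w" for q by (simp add: node_table_def)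
qed (use Y in simp)

text \<open>Ranks are stored at both children of every node, hence the factor 2; \<open>b\<close>
  selects the child.\<close>

lemma sparse_rank_table:
  assumes Y: "finite Y" "2 * ((u + 1) * card Y) \<le> N" "\<And>y. y \<in> Y \<Longrightarrow> y + 1 < 2 ^ u"
    and w: "2 * u \<le> w" "card Y < 2 ^ w"
  shows "sparse w N (rank_table u Y)"
proof (rule sparseI)
  let ?f = "\<lambda>(i, y, b). i * 2 ^ u + (2 * (y div 2 ^ (i + 1)) + b)"
  let ?A = "{..u} \<times> Y \<times> {0, 1::nat}"
  show "{q. rank_table u Y q \<noteq> 0} \<subseteq> ?f ` ?A"
  proof
    fix q assume "q \<in> {q. rank_table u Y q \<noteq> 0}"
    then obtain y where y: "q div 2 ^ u \<le> u" "y \<in> Y" "y div 2 ^ (q div 2 ^ u + 1) = q mod 2 ^ u div 2"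
      by (auto simp: rank_table_def node_def split: if_splits)
    have "q mod 2 ^ u = 2 * (q mod 2 ^ u div 2) + q mod 2 ^ u mod 2" by simp
    then have "q = q div 2 ^ u * 2 ^ u + (2 * (q mod 2 ^ u div 2) + q mod 2 ^ u mod 2)"
      using div_mult_mod_eq[of q "2 ^ u"] by simp
    then have "q = ?f (q div 2 ^ u, y, q mod 2 ^ u mod 2)" using y(3) by simp
    moreover have "(q div 2 ^ u, y, q mod 2 ^ u mod 2) \<in> ?A" using y by auto
    ultimately show "q \<in> ?f ` ?A" by (rule image_eqI)
  qed
  have "card (?f ` ?A) \<le> card ?A" using Y(1) by (intro card_image_le) auto
  also have "\<dots> = 2 * ((u + 1) * card Y)" by (simp add: card_cartesian_product)
  finally show "card (?f ` ?A) \<le> N" using Y(2) by simp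
  show "?f ` ?A \<subseteq> {..<2 ^ w}"
  proof
    fix q assume "q \<in> ?f ` ?A"
    then obtain i y b where q: "q = i * 2 ^ u + (2 * (y div 2 ^ (i + 1)) + b)" "i \<le> u" "y \<in> Y" "b \<le> 1" by auto
    have "y div 2 ^ (i + 1) = y div 2 ^ i div 2" by (simp only: Suc_eq_plus1[symmetric] power_Suc2 div_mult2_eq)
    then have "2 * (y div 2 ^ (i + 1)) \<le> y" using div_le_dividend[of y "2 ^ i"] by linarith
    then have "2 * (y div 2 ^ (i + 1)) + b < 2 ^ u" using Y(3)[OF q(3)] q(4) by linarith
    then show "q \<in> {..<2 ^ w}" using trie_code_less[OF q(2) _ w(1)] q(1) by simp
  qed
  have "card {y \<in> Y. P y} \<le> card Y" for P using Y(1) by (intro card_mono) auto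
  then have "rank_table u Y q \<le> card Y" for q by (simp add: rank_table_def)
  then show "rank_table u Y q < 2 ^ w" for q using w(2) by (rule le_less_trans)
qed (use Y in simp)

context identified_graph begin

text \<open>The dictionaries are given as functions with finite support; the main work is to check
  that each has at most \<open>N\<close> nonzero entries and only keys and values that fit in a
  word.\<close>

lemma index_exists:
  assumes sizes: "card ends \<le> r" "card Z \<le> 2 * d" "card {e \<in> E. t e \<in> Z} \<le> d" "card {e \<in> E. h e \<in> Z} \<le> d"
    and w: "(n + 2) ^ 20 \<le> (2::nat) ^ w"
    and enc: "inj_on enc Sig" "enc ` Sig \<subseteq> {..<2 ^ w}" and Sig: "lab ` E \<subseteq> Sig"
  obtains M F k u m s cidx sg where
    "wheeler_index E t h lab n Z es idr w M F k u m s cidx sg enc Sig"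
    "words w M" "length M \<le> 80000 * max 1 (r + d)" "real k \<le> 4 * loglog n"
proof -
  obtain k where k: "(n + 2)\<^sup>2 < (2::nat) ^ (2 ^ (k + 1) - 1)" "k = 0 \<or> 2 ^ (2 ^ k - 1) \<le> (n + 2)\<^sup>2"
    by (rule tree_height_exists)
  define u where "u = 2 ^ (k + 1) - (1::nat)"
  have u: "u + 1 = 2 ^ (k + 1)" by (simp add: u_def)
  have nu: "(n + 2)\<^sup>2 < 2 ^ u" using k(1) by (simp add: u_def)
  have uw: "2 * u + 2 \<le> w" using tree_height_bound[OF k(2) w] u by simp
  define sg where "sg = card (lab ` E)"
  have finL: "finite (lab ` E)" using finE by simp
  have sgn: "sg \<le> n" using card_labels by (simp add: sg_def)
  obtain cidx where cb: "bij_betw cidx (lab ` E) {0..<sg}"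
    using ex_bij_betw_finite_nat[OF finL] by (auto simp: sg_def)
  have cidx: "cidx c < sg" if "c \<in> lab ` E" for c using cb that by (auto dest: bij_betwE)
  have cinv: "inv_into (lab ` E) cidx (cidx c) = c" if "c \<in> lab ` E" for c
    using cb that by (simp add: bij_betw_def inv_into_f_f)
  note br = card_breaks[OF sizes]
  define bad where "bad = {j. j < n \<and> \<not> good j}"
  have bad: "finite bad" "card bad \<le> 1 + 3 * r + 14 * d" "card bad \<le> n"
  proof -
    have "bad \<subseteq> {..<n}" by (auto simp: bad_def)
    then show "finite bad" "card bad \<le> n" using card_mono[of "{..<n}" bad] by (auto intro: finite_subset)
    show "card bad \<le> 1 + 3 * r + 14 * d" using card_bad[OF sizes] by (simp add: bad_def)
  qed
  define X where "X = {0} \<union> (\<lambda>(c, i). cidx c * n + i) ` breaks \<union> (\<lambda>j. sg * n + idr j) ` bad"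
  have finX: "finite X" using br(1) bad(1) by (simp add: X_def)
  define m where "m = card X"
  have m0: "m > 0" using finX by (auto simp: m_def card_gt_0_iff X_def)
  have idr_lt: "idr j < n" if "j < n" for j using idr that by (auto dest: bij_betwE)
  have Xlt: "x < (sg + 1) * n + 1" if "x \<in> X" for x
  proof -
    have "cidx c * n + i < sg * n" if "(c, i) \<in> breaks" for c i
    proof -
      have "cidx c * n + i < (cidx c + 1) * n" using that by (auto simp: breaks_def)
      also have "\<dots> \<le> sg * n" using cidx that by (intro mult_le_mono1) (auto simp: breaks_def Suc_le_eq)
      finally show ?thesis .
    qed
    then show ?thesis using \<open>x \<in> X\<close> idr_lt by (fastforce simp: X_def bad_def)
  qed
  have sgn2: "(sg + 1) * n + 2 \<le> (n + 2)\<^sup>2"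
  proof -
    have "(sg + 1) * n \<le> (n + 1) * n" using sgn by (intro mult_le_mono1) simp
    then have "(sg + 1) * n + 2 \<le> (n + 1) * n + 2" by (rule add_right_mono)
    also have "\<dots> \<le> (n + 2)\<^sup>2" by (simp add: power2_eq_square)
    finally show ?thesis .
  qed
  have size: "(sg + 1) * n + 2 < 2 ^ u" using sgn2 nu by (rule le_less_trans)
  have Xu: "x + 1 < 2 ^ u" if "x \<in> X" for x using Xlt[OF that] size by linarith
  have mX: "m \<le> (sg + 1) * n + 1"
  proof -
    have "X \<subseteq> {..<(sg + 1) * n + 1}" using Xlt by blast
    then show ?thesis using card_mono[of "{..<(sg + 1) * n + 1}" X] by (simp add: m_def)
  qed
  have mrd: "m \<le> 2 + 6 * r + 22 * d"
  proof -
    have "m \<le> card ({0} \<union> (\<lambda>(c, i). cidx c * n + i) ` breaks) + card ((\<lambda>j. sg * n + idr j) ` bad)"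
      unfolding m_def X_def by (rule card_Un_le)
    also have "\<dots> \<le> (card {0::nat} + card ((\<lambda>(c, i). cidx c * n + i) ` breaks)) + card ((\<lambda>j. sg * n + idr j) ` bad)"
      by (intro add_right_mono card_Un_le)
    also have "\<dots> \<le> (1 + (3 * r + 8 * d)) + (1 + 3 * r + 14 * d)"
      using card_image_le[OF br(1), of "\<lambda>(c, i). cidx c * n + i"] card_image_le[OF bad(1), of "\<lambda>j. sg * n + idr j"]
        br(2) bad(2) by (intro add_mono) auto
    finally show ?thesis by simp
  qed
  define s where "s = (\<lambda>i. sorted_list_of_set X ! i)"
  have sX: "s ` {..<m} = X"
  proof -
    have "s ` {..<m} = set (sorted_list_of_set X)"
      unfolding s_def m_def by (auto simp: set_conv_nth)
    then show ?thesis using finX by simp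
  qed
  have s: "strict_mono_on {..<m} s"
    using sorted_wrt_nth_less[OF strict_sorted_list_of_set[of X]]
    by (auto simp: strict_mono_on_def s_def m_def)
  have s0: "s 0 = 0"
  proof -
    have "0 \<in> s ` {..<m}" unfolding sX by (simp add: X_def)
    then obtain i where i: "i < m" "s i = 0" by auto
    then show ?thesis using strict_mono_on_less_eq[OF s, of 0 i] by auto
  qed
  define Y where "Y = reps (u + 1) s m"
  have Y: "finite Y" "card Y * (u + 1) \<le> m" using card_reps[of "u + 1" s m] by (auto simp: Y_def)
  have YX: "y \<in> X" if "y \<in> Y" for y
    using that unfolding sX[symmetric] by (auto simp: Y_def reps_def)
  define f0 where "f0 = (\<lambda>q. if q \<in> enc ` lab ` E then cidx (inv_into (lab ` E) enc q) + 1 else 0)"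
  define f1 where "f1 = (\<lambda>q::nat. if q < 5 then [2 ^ k, 2 ^ u, n, sg * n, if n > 0 then idr (n - 1) else 0] ! q else 0)"
  define f4 where "f4 = (\<lambda>i. if i < m then s i + 1 else 0)"
  define sample where "sample = (\<lambda>v y. if y \<in> X \<and> y < sg * n
      then v (inv_into (lab ` E) cidx (y div n)) (y mod n) else (0::nat))"
  define f9 where "f9 = (\<lambda>y. if y \<in> X \<and> sg * n \<le> y \<and> y < sg * n + n then prev (y - sg * n) else 0)"
  define f10 where "f10 = (\<lambda>j. if j < n \<and> \<not> good (j + 1) then idr j + 1 else 0)"
  define fl where "fl = [f0, f1, node_table u Y, rank_table u Y, f4, sample nxt, sample lo, sample hi, sample (\<lambda>c i. of_bool (act c i)), f9, f10]"
  define F where "F = (\<lambda>j. fl ! j)"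
  \<comment> \<open>A common bound on the sizes: \<open>2 * m\<close> for the rank table, 5
    parameters, \<open>sg\<close> characters, and the sampled identifiers, at most one for each bad
    rank and one for the last rank.\<close>
  define N where "N = 2 * m + 5 + sg + (card bad + 1)"
  have N1: "N \<le> 10 * (n + 2)\<^sup>2"
  proof -
    have "n + 2 \<le> (n + 2)\<^sup>2" by (simp add: power2_eq_square)
    then show ?thesis using mX sgn2 sgn bad(3) unfolding N_def by linarith
  qed
  \<comment> \<open>With \<open>m <= 2 + 6 * r + 22 * d\<close>, the number \<open>N + 1\<close> is
    at most \<open>12 + 16 * r + 58 * d\<close>, and \<open>12 + 58 = 70\<close>.\<close>
  have N2: "N + 1 \<le> 70 * max 1 (r + d)"
  proof -
    have "sg \<le> r" using br(3) by (simp add: sg_def)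
    moreover define R where "R = max 1 (r + d)"
    then have "1 \<le> R" "r + d \<le> R" by auto
    ultimately show ?thesis using mrd bad(2) unfolding N_def R_def[symmetric] by linarith
  qed
  have L: "(2::nat) ^ j * (n + 2) ^ i \<le> 2 ^ w" if "i + j \<le> 20" for i j
  proof -
    have "(2::nat) ^ j * (n + 2) ^ i \<le> (n + 2) ^ j * (n + 2) ^ i" by (intro mult_le_mono1 power_mono) auto
    also have "\<dots> = (n + 2) ^ (i + j)" by (simp add: power_add)
    also have "\<dots> \<le> (n + 2) ^ 20" using that by (intro power_increasing) auto
    finally show ?thesis using w by linarith
  qed
  have pos: "1 \<le> (n + 2)\<^sup>2" by simp
  \<comment> \<open>This needs the largest word length: \<open>12100 < 2 ^ 14\<close>, and
    \<open>2 ^ 14 * (n + 2) ^ 4\<close> is at most \<open>(n + 2) ^ 18\<close>, which the exponent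
    20 covers.\<close>
  have w2: "100 * (N + 1)\<^sup>2 < 2 ^ w"
  proof -
    have "N + 1 \<le> 11 * (n + 2)\<^sup>2" using N1 pos by linarith
    then have "(N + 1)\<^sup>2 \<le> (11 * (n + 2)\<^sup>2)\<^sup>2" by (intro power_mono) auto
    also have "\<dots> = 121 * (n + 2) ^ 4" by (simp add: power_mult_distrib flip: power_mult)
    finally have "100 * (N + 1)\<^sup>2 \<le> 12100 * (n + 2) ^ 4" by simp
    also have "\<dots> < 2 ^ 14 * (n + 2) ^ 4" by simp
    also have "\<dots> \<le> 2 ^ w" by (rule L) simp
    finally show ?thesis .
  qed
  have w3: "11 * (100 * (N + 1) + 1) < 2 ^ w"
  proof -
    have "N + 1 \<le> 11 * (n + 2)\<^sup>2" using N1 pos by linarith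
    moreover have "11 * (100 * (N + 1) + 1) = 1100 * N + 1111" by simp
    ultimately have "11 * (100 * (N + 1) + 1) \<le> 12111 * (n + 2)\<^sup>2" using pos by linarith
    also have "\<dots> < 2 ^ 14 * (n + 2)\<^sup>2" by simp
    also have "\<dots> \<le> 2 ^ w" by (rule L) simp
    finally show ?thesis .
  qed
  have 4: "4 * (2::nat) ^ u \<le> 2 ^ w"
  proof -
    have "(2::nat) ^ (u + 2) \<le> 2 ^ w" using uw by (intro power_increasing) auto
    then show ?thesis by simp
  qed
  have nw: "n + 2 < 2 ^ u"
  proof -
    have "n + 2 \<le> (n + 2)\<^sup>2" by (simp add: power2_eq_square)
    then show ?thesis using nu by (rule le_less_trans)
  qed
  have sgw: "sg * n + n + 2 < 2 ^ u" using size by (simp add: add_mult_distrib)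
  have "sparse w N f0"
  proof (rule sparseI)
    show "{q. f0 q \<noteq> 0} \<subseteq> enc ` lab ` E" by (auto simp: f0_def)
    show "card (enc ` lab ` E) \<le> N" using card_image_le[OF finL, of enc] by (simp add: N_def sg_def)
    show "enc ` lab ` E \<subseteq> {..<2 ^ w}" using enc(2) Sig by blast
    fix q
    have "cidx (inv_into (lab ` E) enc q) < sg" if "q \<in> enc ` lab ` E"
      using that by (intro cidx inv_into_into)
    then have "f0 q \<le> sg" by (auto simp: f0_def Suc_le_eq)
    then show "f0 q < 2 ^ w" using sgn nw 4 by linarith
  qed (use finL in simp)
  moreover have "sparse w N f1"
  proof (rule sparseI[where A = "{..<5}"])
    show "{..<5} \<subseteq> {..<(2::nat) ^ w}" using nw 4 by auto
    have "(2::nat) ^ k \<le> u + 1" unfolding u by simp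
    then have "k < w" "u < w" using less_exp[of k] uw by linarith+
    moreover have "n < 2 ^ w" "sg * n < 2 ^ w" using 4 sgw by linarith+
    moreover have "idr (n - 1) < 2 ^ w" if "n > 0" using idr_lt[of "n - 1"] that 4 sgw by linarith
    ultimately have "x < 2 ^ w" if "x \<in> set [2 ^ k, 2 ^ u, n, sg * n, if n > 0 then idr (n - 1) else 0]" for x
      using that by (auto split: if_splits)
    then show "f1 q < 2 ^ w" for q
      using nth_mem[of q "[2 ^ k, 2 ^ u, n, sg * n, if n > 0 then idr (n - 1) else 0]"] by (auto simp: f1_def)
  qed (auto simp: f1_def N_def)
  moreover have "sparse w N (node_table u Y)" "sparse w N (rank_table u Y)"
  proof -
    have c: "(u + 1) * card Y \<le> m" using Y(2) by (simp only: mult.commute)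
    have "card Y \<le> card Y * (u + 1)" by simp
    then have "card Y \<le> m" using Y(2) by linarith
    then have "card Y < 2 ^ w" using mX size 4 by linarith
    moreover have "(u + 1) * card Y \<le> N" "2 * ((u + 1) * card Y) \<le> N" using c unfolding N_def by linarith+
    ultimately show "sparse w N (node_table u Y)" "sparse w N (rank_table u Y)"
      using Y(1) Xu[OF YX] uw by (auto intro!: sparse_node_table sparse_rank_table simp del: One_nat_def)
  qed
  moreover have "sparse w N f4"
  proof (rule sparseI[where A = "{..<m}"])
    show "{..<m} \<subseteq> {..<2 ^ w}" using mX size 4 by auto
    have "s i \<in> X" if "i < m" for i using that sX by blast
    then show "f4 i < 2 ^ w" for i using Xu[of "s i"] 4 by (auto simp: f4_def)
  qed (auto simp: f4_def N_def)
  moreover have sample_sparse: "sparse w N (sample v)" if "\<And>c i. v c i \<le> n + 1" for v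
  proof (rule sparseI[where A = X])
    show "X \<subseteq> {..<2 ^ w}" using Xu 4 by fastforce
    show "sample v q < 2 ^ w" for q using that nw 4 by (auto simp: sample_def intro: le_less_trans[of _ "n + 1"])
  qed (use finX in \<open>auto simp: sample_def N_def m_def\<close>)
  moreover have "sparse w N f9"
  proof (rule sparseI[where A = X])
    show "X \<subseteq> {..<2 ^ w}" using Xu 4 by fastforce
    have "prev x < n" if "x < n" for x
      using rk_less[OF that] idr_lt[of "rk x - 1"] by (simp add: prev_def)
    then have "f9 q \<le> n" for q by (auto simp: f9_def intro!: less_imp_le)
    moreover have "n < 2 ^ w" using 4 sgw by linarith
    ultimately show "f9 q < 2 ^ w" for q by (rule le_less_trans)
  qed (use finX in \<open>auto simp: f9_def N_def m_def\<close>)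
  moreover have "sparse w N f10"
  proof (rule sparseI[where A = "{n - 1} \<union> (\<lambda>j. j - 1) ` bad"])
    \<comment> \<open>A rank is sampled unless its successor is good; besides the predecessors of
      bad ranks this concerns the last rank, which has no successor.\<close>
    show "{q. f10 q \<noteq> 0} \<subseteq> {n - 1} \<union> (\<lambda>j. j - 1) ` bad"
    proof
      fix q assume q: "q \<in> {q. f10 q \<noteq> 0}"
      show "q \<in> {n - 1} \<union> (\<lambda>j. j - 1) ` bad"
      proof (cases "q + 1 < n")
        case True
        then have "q + 1 \<in> bad" using q by (auto simp: f10_def bad_def split: if_splits)
        then have "q + 1 - 1 \<in> (\<lambda>j. j - 1) ` bad" by (rule imageI)
        then show ?thesis by simp
      qed (use q in \<open>auto simp: f10_def split: if_splits\<close>)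
    qed
    have "card ((\<lambda>j. j - 1) ` bad) \<le> card bad" by (rule card_image_le[OF bad(1)])
    then show "card ({n - 1} \<union> (\<lambda>j. j - 1) ` bad) \<le> N"
      using card_Un_le[of "{n - 1}" "(\<lambda>j. j - 1) ` bad"] by (simp add: N_def)
    show "{n - 1} \<union> (\<lambda>j. j - 1) ` bad \<subseteq> {..<2 ^ w}"
    proof
      have nw': "n + 1 < 2 ^ w" using 4 sgw by linarith
      fix q assume "q \<in> {n - 1} \<union> (\<lambda>j. j - 1) ` bad"
      then have "q \<le> n" by (auto simp: bad_def)
      then show "q \<in> {..<2 ^ w}" using nw' by simp
    qed
    have "f10 q \<le> n" for q using idr_lt[of q] by (auto simp: f10_def)
    moreover have "n < 2 ^ w" using 4 sgw by linarith
    ultimately show "f10 q < 2 ^ w" for q by (rule le_less_trans)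
  qed (use bad in simp)
  ultimately have all: "\<forall>f\<in>set fl. sparse w N f"
    using nxt_le lo_le hi_le by (auto simp: fl_def le_SucI intro!: sample_sparse)
  have sp: "sparse w N (F j)" if "j < 11" for j
  proof -
    have "j < length fl" using that by (simp add: fl_def)
    then show ?thesis unfolding F_def using all nth_mem by blast
  qed
  obtain M where M: "stores w M 11 F" "length M \<le> 11 * (100 * (N + 1) + 1)"
    by (rule stores_exists[of 11 F w N]) (use sp w2 w3 in \<open>auto simp: sparse_def\<close>)
  have F: "F 0 = f0" "F 1 = f1" "F 2 = node_table u Y" "F 3 = rank_table u Y" "F 4 = f4" "F 5 = sample nxt" "F 6 = sample lo"
    "F 7 = sample hi" "F 8 = sample (\<lambda>c i. of_bool (act c i))" "F 9 = f9" "F 10 = f10"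
    by (simp_all add: F_def fl_def)
  have sample_eq: "sample v (cidx c * n + i) = v c i"
    if "c \<in> lab ` E" "i < n" "cidx c * n + i \<in> X" for v c i
  proof -
    have "cidx c * n + i < (cidx c + 1) * n" using that by simp
    also have "\<dots> \<le> sg * n" using cidx[OF that(1)] by (intro mult_le_mono1) simp
    finally show ?thesis using that by (simp add: sample_def cinv)
  qed
  have "wheeler_index E t h lab n Z es idr w M F k u m s cidx sg enc Sig"
  proof (unfold_locales, unfold F)
    show "w \<ge> 1" using uw by simp
    show "stores w M 11 F" by fact
    show "u + 1 = 2 ^ (k + 1)" "2 * u + 2 \<le> w" "strict_mono_on {..<m} s" "s 0 = 0" "m > 0" by fact+
    show "m < 2 ^ u" using mX size by linarith
    show "s i < 2 ^ u" if "i < m" for i using Xu[of "s i"] sX that by auto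
    show "f1 0 = 2 ^ k" "f1 1 = 2 ^ u" "f1 2 = n" "f1 3 = sg * n" by (simp_all add: f1_def)
    show "f1 4 = idr (n - 1)" if "n > 0" using that by (simp add: f1_def)
    show "node_table u Y (i * 2 ^ u + z) = of_bool (node (reps (u + 1) s m) i z)" if "i \<le> u" "z < 2 ^ u" for i z
      using node_table[OF that(1) _ that(2)] Xu[OF YX] by (auto simp: Y_def)
    show "rank_table u Y (i * 2 ^ u + z) = (if node (reps (u + 1) s m) (i + 1) (z div 2)
       then card {y \<in> reps (u + 1) s m. y div 2 ^ i < z} else 0)" if "i \<le> u" "z < 2 ^ u" for i z
      using rank_table[OF that] by (simp add: Y_def)
    show "f4 i = (if i < m then s i + 1 else 0)" for i by (simp add: f4_def)
    show "cidx c < sg" if "c \<in> lab ` E" for c by (rule cidx[OF that])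
    show "s ` {..<m} = {0} \<union> (\<lambda>(c, i). cidx c * n + i) ` breaks \<union> (\<lambda>j. sg * n + idr j) ` {j. j < n \<and> \<not> good j}"
      unfolding sX X_def bad_def ..
    show "(sg + 1) * n + 2 < 2 ^ u" by fact
    show "enc c < 2 ^ w" if "c \<in> Sig" for c using enc(2) that by blast
    show "f0 (enc c) = (if c \<in> lab ` E then cidx c + 1 else 0)" if "c \<in> Sig" for c
    proof -
      have inj: "inj_on enc (lab ` E)" using inj_on_subset[OF enc(1) Sig] .
      have "enc c \<in> enc ` lab ` E \<longleftrightarrow> c \<in> lab ` E"
        using inj_on_image_mem_iff[OF enc(1) that Sig] .
      then show ?thesis using inv_into_f_f[OF inj, of c] by (simp add: f0_def)
    qed
    show "sample nxt (cidx c * n + i) = nxt c i \<and> sample lo (cidx c * n + i) = lo c i \<and>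
       sample hi (cidx c * n + i) = hi c i \<and> sample (\<lambda>c i. of_bool (act c i)) (cidx c * n + i) = of_bool (act c i)"
      if "(c, i) \<in> lab ` E \<times> {..<n}" "cidx c * n + i \<in> s ` {..<m}" for c i
      using sample_eq[of c i] that sX by auto
    show "f9 (sg * n + x) = prev x" if "x < n" "sg * n + x \<in> s ` {..<m}" for x
      using that sX by (simp add: f9_def)
    show "f10 j = (if good (j + 1) then 0 else idr j + 1)" if "j < n" for j
      using that by (simp add: f10_def)
  qed
  moreover have "words w M" using M(1) by (simp add: stores_def)
  moreover have "length M \<le> 80000 * max 1 (r + d)" using M(2) N2 by simp
  moreover have "real k \<le> 4 * loglog n" by (rule log_height_bound[OF k(2)])
  ultimately show ?thesis using that by blast
qed

end

section \<open>Assembly, with constants that do not depend on the graph\<close>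

theorem theorem3:
  fixes k :: nat
  shows "\<exists>K0 :: nat. \<forall>K :: nat. \<exists>cnt rep. \<exists>C :: real.
    \<forall>(G :: ('v, 'e) pre_digraph) (lab :: 'e \<Rightarrow> 'a :: linorder) \<pi> B D ident
      (\<Sigma> :: 'a set) (enc :: 'a \<Rightarrow> nat) (w :: nat) n r \<upsilon>.
      fin_digraph G \<and> wheeler_order G lab \<pi> \<and> is_BWT G lab \<pi> B \<and>
      path_decomposition G D \<and> compatible_ids G D ident \<and>
      n = card (verts G) \<and> r = card (runs B) \<and> \<upsilon> = card D \<and>
      card (arcs G) \<le> k * n ^ k \<and>
      real K0 * log 2 (real (n + 2)) \<le> real w \<and> real w \<le> real K * log 2 (real (n + 2)) \<and>
      lab ` arcs G \<subseteq> \<Sigma> \<and> inj_on enc \<Sigma> \<and> enc ` \<Sigma> \<subseteq> {..<2 ^ w}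
      \<longrightarrow>
      (\<exists>S l. words w S \<and> real (length S + l) \<le> C * real (max 1 (r + \<upsilon>)) \<and>
        (\<forall>W P. words w W \<and> length W = l \<and> set P \<subseteq> \<Sigma> \<longrightarrow>
          answers_query w cnt rep S W (map enc P) (ident ` reachable_by G lab P)
            (C * real (length P) * loglog n + C) (C * loglog n)))"
proof -
  obtain A where A: "\<And>k. report_time k \<le> A * (k + 2)" "\<And>k l. count_time k l \<le> A * (k + 2) * l + A"
    by (rule linear_times) blast
  \<comment> \<open>80000 bounds the space per unit of \<open>max 1 (r + \<upsilon>)\<close>;
    \<open>6 * A\<close> absorbs \<open>A * (k + 2)\<close>, as \<open>k <= 4 * loglog n\<close> and
    \<open>loglog n >= 1\<close>.\<close>
  define C :: real where "C = 80000 + 6 * real A"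
  have main: "\<exists>S l. words w S \<and> real (length S + l) \<le> C * real (max 1 (r + \<upsilon>)) \<and>
        (\<forall>W P. words w W \<and> length W = l \<and> set P \<subseteq> \<Sigma> \<longrightarrow>
          answers_query w count_query report_query S W (map enc P) (ident ` reachable_by G lab P)
            (C * real (length P) * loglog n + C) (C * loglog n))"
    if H: "fin_digraph G" "wheeler_order G lab \<pi>" "is_BWT G lab \<pi> B"
      "path_decomposition G D" "compatible_ids G D ident"
      "n = card (verts G)" "r = card (runs B)" "\<upsilon> = card D"
      "real (20::nat) * log 2 (real (n + 2)) \<le> real w"
      "lab ` arcs G \<subseteq> \<Sigma>" "inj_on enc \<Sigma>" "enc ` \<Sigma> \<subseteq> {..<2 ^ w}"
    for G :: "('v, 'e) pre_digraph" and lab :: "'e \<Rightarrow> 'a" and \<pi> B D ident \<Sigma> enc w n r \<upsilon>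
  proof -
    obtain es where bwt: "distinct es" "set es = arcs G" "B = map lab es" "sorted_wrt (\<lambda>e e'.
         (tail G e, tail G e') \<in> \<pi> \<and> tail G e \<noteq> tail G e' \<or>
         tail G e = tail G e' \<and> (head G e, head G e') \<in> \<pi>) es"
      using H(3) by (auto simp: is_BWT_def)
    interpret fin_digraph G by (rule H(1))
    interpret wheeler_graph G D lab \<pi> es ident
      by unfold_locales (rule H(4) H(2) bwt(1) bwt(2) bwt(4) H(5))+
    have w: "(n + 2) ^ 20 \<le> (2::nat) ^ w"
    proof -
      have "log 2 (real (n + 2) ^ 20) \<le> real w" using H(9) by (simp add: log_nat_power)
      then have "real (n + 2) ^ 20 \<le> 2 powr real w" by (simp add: log_le_iff)
      then have "real ((n + 2) ^ 20) \<le> real (2 ^ w)" by (simp add: powr_realpow)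
      then show ?thesis by (rule of_nat_le_iff[THEN iffD1])
    qed
    obtain M F k u m s cidx sg where
      index: "wheeler_index (arcs G) (\<lambda>e. rank_in (verts G) \<pi> (tail G e)) (\<lambda>e. rank_in (verts G) \<pi> (head G e))
        lab (card (verts G)) (rank_in (verts G) \<pi> ` endpoints G D) es idr w M F k u m s cidx sg enc \<Sigma>"
      and M0: "words w M" "length M \<le> 80000 * max 1 (card (runs (map lab es)) + card D)"
        "real k \<le> 4 * loglog (card (verts G))"
      by (rule index_exists[OF size_bounds w[unfolded H(6)] H(11,12,10)])
    have M: "words w M" "length M \<le> 80000 * max 1 (r + \<upsilon>)" and k: "real k \<le> 4 * loglog n"
      using M0 H(6-8) bwt(3) by simp_all
    interpret index: wheeler_index "arcs G" "\<lambda>e. rank_in (verts G) \<pi> (tail G e)" "\<lambda>e. rank_in (verts G) \<pi> (head G e)"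
        lab "card (verts G)" "rank_in (verts G) \<pi> ` endpoints G D" es idr w M F k u m s cidx sg enc \<Sigma>
      by (rule index)
    have k6: "real A * (real k + 2) \<le> 6 * real A * loglog n"
    proof -
      have "real k + 2 \<le> 6 * loglog n" using k loglog_ge_1[of n] by simp
      then have "real A * (real k + 2) \<le> real A * (6 * loglog n)" by (rule mult_left_mono) simp
      then show ?thesis by simp
    qed
    have C6: "6 * real A * loglog n \<le> C * loglog n"
      using loglog_ge_1[of n] by (intro mult_right_mono) (auto simp: C_def)
    have "answers_query w count_query report_query M W (map enc P) (ident ` reachable_by G lab P)
            (C * real (length P) * loglog n + C) (C * loglog n)"
      if "words w W" "length W = 0" "set P \<subseteq> \<Sigma>" for W P
    proof -
      have "real (count_time k (length P)) \<le> real (A * (k + 2) * length P + A)"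
        using A(2) by (rule of_nat_mono)
      also have "\<dots> = real A * (real k + 2) * real (length P) + real A" by (simp add: algebra_simps)
      also have "\<dots> \<le> C * loglog n * real (length P) + C"
        using k6 C6 by (intro add_mono mult_right_mono) (auto simp: C_def)
      finally have c: "real (count_time k (length P)) \<le> C * real (length P) * loglog n + C"
        by (simp add: algebra_simps)
      have "real (report_time k) \<le> real (A * (k + 2))" using A(1) by (rule of_nat_mono)
      also have "\<dots> = real A * (real k + 2)" by (simp add: algebra_simps)
      finally have "real (report_time k) \<le> C * loglog n" using k6 C6 by linarith
      from index.answers[OF that(3) c this] show ?thesis
        using that(2) unfolding ident_reachable H(6) by simp
    qed
    moreover have "real (length M + 0) \<le> C * real (max 1 (r + \<upsilon>))"
    proof -
      have "real (length M + 0) \<le> real (80000 * max 1 (r + \<upsilon>))" using M(2) by (intro of_nat_mono) simp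
      also have "\<dots> = 80000 * real (max 1 (r + \<upsilon>))" by (simp only: of_nat_mult of_nat_numeral)
      also have "\<dots> \<le> C * real (max 1 (r + \<upsilon>))" by (intro mult_right_mono) (auto simp: C_def)
      finally show ?thesis .
    qed
    ultimately show ?thesis using M(1) by blast
  qed
  \<comment> \<open>20 is the constant \<open>K0\<close>; the two programs and \<open>C\<close> are
    chosen before the graph, the alphabet and the word length.\<close>
  show ?thesis
    by (intro exI[of _ 20] allI exI[of _ count_query] exI[of _ report_query] exI[of _ C] impI) (elim conjE, rule main)
qed

end
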